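(* Let $\mathbf V$ be a monoid variety whose membership problem is decidable (given a finite monoid, decide whether it belongs to $\mathbf V$). Then there is an algorithm that, given a functional NFT, decides whether the function it defines is definable by an unambiguous $\mathbf V$-NFT.
   Context: A (real-time) NFT is $T=(Q,I,F,\Delta,i,t)$ with partial $\Delta:Q\times\Sigma\times Q\to\Sigma^\ast$, $i:I\to\Sigma^\ast$, $t:F\to\Sigma^\ast$, relating $u$ to $i(q_0)wt(q_f)$ for each successful run $q_0\xrightarrow{u\mid w}q_f$ ($q_0\in I$, $q_f\in F$); it is functional if this relation is a function, and unambiguous if its underlying automaton (outputs forgotten) has at most one successful run on each word. The transition monoid of the underlying automaton with state set $Q$ is $\Sigma^\ast/\equiv$ where $u\equiv v$ iff for all $p,q\in Q$ there is a run $p\to q$ on $u$ iff on $v$; a $\mathbf V$-NFT is an NFT whose transition monoid lies in $\mathbf V$. *)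

theory Defs
  imports Main "HOL-Library.Nat_Bijection"
begin

datatype recf = Zf | Sf | Idf nat | Cnf recf "recf list" | Prf recf recf | Mnf recf

inductive rec_eval :: "recf \<Rightarrow> nat list \<Rightarrow> nat \<Rightarrow> bool" where
  zero: "rec_eval Zf xs 0"
| succ: "rec_eval Sf [x] (Suc x)"
| proj: "i < length xs \<Longrightarrow> rec_eval (Idf i) xs (xs ! i)"
| comp: "list_all2 (\<lambda>g y. rec_eval g xs y) gs ys \<Longrightarrow> rec_eval f ys z \<Longrightarrow> rec_eval (Cnf f gs) xs z"
| prim0: "rec_eval f xs y \<Longrightarrow> rec_eval (Prf f g) (0 # xs) y"
| primS: "rec_eval (Prf f g) (n # xs) y \<Longrightarrow> rec_eval g (y # n # xs) z
          \<Longrightarrow> rec_eval (Prf f g) (Suc n # xs) z"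
| mini: "rec_eval f (n # xs) 0 \<Longrightarrow> (\<forall>m<n. \<exists>y. 0 < y \<and> rec_eval f (m # xs) y)
          \<Longrightarrow> rec_eval (Mnf f) xs n"

definition decides_on :: "recf \<Rightarrow> ('a \<Rightarrow> nat) \<Rightarrow> ('a \<Rightarrow> bool) \<Rightarrow> ('a \<Rightarrow> bool) \<Rightarrow> bool" where
  "decides_on p enc D P \<longleftrightarrow> (\<forall>x. D x \<longrightarrow> rec_eval p [enc x] (if P x then 1 else 0))"

type_synonym fmon = "nat \<times> nat list list"

definition fsize :: "fmon \<Rightarrow> nat" where "fsize M = fst M"
definition fmul :: "fmon \<Rightarrow> nat \<Rightarrow> nat \<Rightarrow> nat" where "fmul M a b = snd M ! a ! b"

definition is_unit :: "fmon \<Rightarrow> nat \<Rightarrow> bool" where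
  "is_unit M e \<longleftrightarrow> e < fsize M \<and> (\<forall>a<fsize M. fmul M e a = a \<and> fmul M a e = a)"

definition funit :: "fmon \<Rightarrow> nat" where "funit M = (SOME e. is_unit M e)"

definition wf_fmon :: "fmon \<Rightarrow> bool" where
  "wf_fmon M \<longleftrightarrow> length (snd M) = fsize M
     \<and> (\<forall>r\<in>set (snd M). length r = fsize M \<and> (\<forall>x\<in>set r. x < fsize M))
     \<and> (\<forall>a b c. a < fsize M \<and> b < fsize M \<and> c < fsize M \<longrightarrow>
            fmul M (fmul M a b) c = fmul M a (fmul M b c))
     \<and> (\<exists>e. is_unit M e)"

definition fmon_hom :: "fmon \<Rightarrow> fmon \<Rightarrow> (nat \<Rightarrow> nat) \<Rightarrow> bool" where
  "fmon_hom M N f \<longleftrightarrow> (\<forall>a<fsize M. f a < fsize N)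
     \<and> (\<forall>a b. a < fsize M \<and> b < fsize M \<longrightarrow> f (fmul M a b) = fmul N (f a) (f b))
     \<and> f (funit M) = funit N"

definition fmon_prod :: "fmon \<Rightarrow> fmon \<Rightarrow> fmon" where
  "fmon_prod M N = (let n1 = fsize M; n2 = fsize N in
     (n1 * n2, map (\<lambda>i. map (\<lambda>j. fmul M (i div n2) (j div n2) * n2 + fmul N (i mod n2) (j mod n2))
                   [0..<n1*n2]) [0..<n1*n2]))"

definition trivial_fmon :: fmon where "trivial_fmon = (1, [[0]])"

definition monoid_variety :: "fmon set \<Rightarrow> bool" where
  "monoid_variety V \<longleftrightarrow> (\<forall>M\<in>V. wf_fmon M)
     \<and> trivial_fmon \<in> V
     \<and> (\<forall>M N. M \<in> V \<longrightarrow> wf_fmon N \<longrightarrow>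
           (\<exists>f. fmon_hom N M f \<and> inj_on f {..<fsize N}) \<longrightarrow> N \<in> V)
     \<and> (\<forall>M N. M \<in> V \<longrightarrow> wf_fmon N \<longrightarrow>
           (\<exists>f. fmon_hom M N f \<and> f ` {..<fsize M} = {..<fsize N}) \<longrightarrow> N \<in> V)
     \<and> (\<forall>M N. M \<in> V \<longrightarrow> N \<in> V \<longrightarrow> fmon_prod M N \<in> V)"

definition enc_fmon :: "fmon \<Rightarrow> nat" where
  "enc_fmon M = prod_encode (fst M, list_encode (map list_encode (snd M)))"

text \<open>NFT k m trans iout tout: transitions (p,a,q,w) mean Delta(p,a,q) = w;
  iout lists (q, i(q)) for q in I; tout lists (q, t(q)) for q in F.\<close>
datatype nft = NFT (alph: nat) (nstates: nat)
  (trans: "(nat \<times> nat \<times> nat \<times> nat list) list")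
  (iout: "(nat \<times> nat list) list") (tout: "(nat \<times> nat list) list")

definition wf_nft :: "nft \<Rightarrow> bool" where
  "wf_nft T \<longleftrightarrow>
     (\<forall>(p,a,q,w)\<in>set (trans T). p < nstates T \<and> a < alph T \<and> q < nstates T \<and> set w \<subseteq> {..<alph T})
   \<and> distinct (map (\<lambda>(p,a,q,w). (p,a,q)) (trans T))
   \<and> (\<forall>(q,w)\<in>set (iout T). q < nstates T \<and> set w \<subseteq> {..<alph T})
   \<and> distinct (map fst (iout T))
   \<and> (\<forall>(q,w)\<in>set (tout T). q < nstates T \<and> set w \<subseteq> {..<alph T})
   \<and> distinct (map fst (tout T))"

inductive nft_run :: "nft \<Rightarrow> nat \<Rightarrow> nat list \<Rightarrow> nat list \<Rightarrow> nat \<Rightarrow> bool" where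
  nil: "nft_run T p [] [] p"
| cons: "(p, a, r, x) \<in> set (trans T) \<Longrightarrow> nft_run T r u y q \<Longrightarrow> nft_run T p (a # u) (x @ y) q"

definition nft_rel :: "nft \<Rightarrow> nat list \<Rightarrow> nat list \<Rightarrow> bool" where
  "nft_rel T u v \<longleftrightarrow> (\<exists>q0 x w qf y. (q0, x) \<in> set (iout T) \<and> (qf, y) \<in> set (tout T)
       \<and> nft_run T q0 u w qf \<and> v = x @ w @ y)"

definition functional_nft :: "nft \<Rightarrow> bool" where
  "functional_nft T \<longleftrightarrow> (\<forall>u v v'. nft_rel T u v \<longrightarrow> nft_rel T u v' \<longrightarrow> v = v')"

definition acc_run :: "nft \<Rightarrow> nat list \<Rightarrow> nat list \<Rightarrow> bool" where
  "acc_run T u qs \<longleftrightarrow> length qs = Suc (length u)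
     \<and> hd qs \<in> fst ` set (iout T) \<and> last qs \<in> fst ` set (tout T)
     \<and> (\<forall>j<length u. \<exists>w. (qs ! j, u ! j, qs ! Suc j, w) \<in> set (trans T))"

definition unambiguous_nft :: "nft \<Rightarrow> bool" where
  "unambiguous_nft T \<longleftrightarrow> (\<forall>u qs qs'. acc_run T u qs \<longrightarrow> acc_run T u qs' \<longrightarrow> qs = qs')"

definition reach :: "nft \<Rightarrow> nat \<Rightarrow> nat list \<Rightarrow> nat \<Rightarrow> bool" where
  "reach T p u q \<longleftrightarrow> (\<exists>w. nft_run T p u w q)"

text \<open>u and v are equivalent in the transition monoid iff tm T u = tm T v.\<close>
definition tm :: "nft \<Rightarrow> nat list \<Rightarrow> (nat \<times> nat) set" where
  "tm T u = {(p, q). p < nstates T \<and> q < nstates T \<and> reach T p u q}"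

definition words :: "nat \<Rightarrow> nat list set" where "words k = {u. set u \<subseteq> {..<k}}"

text \<open>The transition monoid Sigma*/equiv is isomorphic to some member of V.\<close>
definition V_nft :: "fmon set \<Rightarrow> nft \<Rightarrow> bool" where
  "V_nft V T \<longleftrightarrow> (\<exists>M\<in>V. \<exists>\<phi>.
      \<phi> ` words (alph T) = {..<fsize M}
    \<and> (\<forall>u\<in>words (alph T). \<forall>v\<in>words (alph T). \<phi> u = \<phi> v \<longleftrightarrow> tm T u = tm T v)
    \<and> (\<forall>u\<in>words (alph T). \<forall>v\<in>words (alph T). \<phi> (u @ v) = fmul M (\<phi> u) (\<phi> v)))"

definition enc_nft :: "nft \<Rightarrow> nat" where
  "enc_nft T = list_encode
     [alph T, nstates T,
      list_encode (map (\<lambda>(p,a,q,w). list_encode [p, a, q, list_encode w]) (trans T)),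
      list_encode (map (\<lambda>(q,w). prod_encode (q, list_encode w)) (iout T)),
      list_encode (map (\<lambda>(q,w). prod_encode (q, list_encode w)) (tout T))]"

definition unamb_V_definable :: "fmon set \<Rightarrow> nft \<Rightarrow> bool" where
  "unamb_V_definable V T \<longleftrightarrow> (\<exists>T'. wf_nft T' \<and> alph T' = alph T
      \<and> unambiguous_nft T' \<and> V_nft V T' \<and> nft_rel T' = nft_rel T)"

end

theory Submission
  imports Defs "HOL-Library.Sublist" "HOL-Library.FuncSet"
begin

text \<open>
  Call congruences \<open>L\<close>, \<open>R\<close> on words compatible with the function \<open>f\<close> if the domain of \<open>f\<close> is
  saturated and \<open>f(uv)\<^sup>-\<^sup>1 f(uv') = f(u'v)\<^sup>-\<^sup>1 f(u'v')\<close> holds in the free group whenever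
  \<open>u L u'\<close> and \<open>v R v'\<close>: all matrices \<open>(f(uv))\<close> over a pair of classes have rank one. The kernel of the
  transition map of a functional transducer is compatible with its function. Conversely, if the kernel
  of a morphism onto a finite monoid \<open>M\<close> is compatible with \<open>f\<close>, then longest common prefixes turn the
  factorizations of these matrices into the outputs of an unambiguous transducer with states
  \<open>M \<times> M\<close> (a bimachine) and transition monoid isomorphic to \<open>M\<close>.

  For fixed \<open>R\<close> the coarsest \<open>L\<close> compatible with \<open>R\<close> is a congruence whose index is bounded in
  terms of the given transducer: if two states accept \<open>R\<close>-equivalent words, then by pumping the delay
  between two runs leading to them on a common input is already attained on a short input. Coarsening
  first the left and then, by mirroring, the right congruence leads from any monoid in the variety to a quotient of
  bounded size. Hence it suffices to search the monoids up to this bound, and compatibility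
  with a given morphism needs to be tested on short words only.
\<close>

section \<open>Computable functions\<close>

text \<open>The rank-one condition records what a cut in a run permits: if an accepting run on
  \<open>u @ v\<close> passes through \<open>p\<close>, its output is \<open>x @ y\<close> with
  \<open>x\<close> belonging to \<open>u\<close> and \<open>y\<close> to \<open>v\<close>, so
  exchanging \<open>u\<close> for a word with the same state transitions changes the left factor
  only. Since compatibility is a condition on a pair, the coarsest \<open>L\<close> depends on the
  chosen \<open>R\<close>; there is no single congruence of \<open>f\<close> to compute, and the
  algorithm has to search. The proof must therefore bound the search by data of \<open>T\<close>
  alone, independently of the monoid that witnesses definability. The coarsest \<open>L\<close> is
  closed under appending and the coarsest \<open>R\<close> under prepending, neither on both sides.
  A congruence is regained as the largest one inside both. A word acts on the at most
  \<open>b = lbound T\<close> classes of \<open>L\<close> and on those of \<open>R\<close>, and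
  these two maps determine its class; this is the origin of the bound
  \<open>b ^ (2 * b)\<close>.\<close>

definition rec1 :: "(nat \<Rightarrow> nat) \<Rightarrow> bool" where
  "rec1 F \<longleftrightarrow> (\<exists>p. \<forall>x. rec_eval p [x] (F x))"

definition rec2 :: "(nat \<Rightarrow> nat \<Rightarrow> nat) \<Rightarrow> bool" where
  "rec2 F \<longleftrightarrow> (\<exists>p. \<forall>x y. rec_eval p [x, y] (F x y))"

definition rec3 :: "(nat \<Rightarrow> nat \<Rightarrow> nat \<Rightarrow> nat) \<Rightarrow> bool" where
  "rec3 F \<longleftrightarrow> (\<exists>p. \<forall>x y z. rec_eval p [x, y, z] (F x y z))"

lemma rec_eval_comp1: "rec_eval g xs y \<Longrightarrow> rec_eval f [y] z \<Longrightarrow> rec_eval (Cnf f [g]) xs z"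
  by (rule rec_eval.comp) auto

lemma rec_eval_comp2:
  "rec_eval g xs y \<Longrightarrow> rec_eval h xs y' \<Longrightarrow> rec_eval f [y, y'] z \<Longrightarrow> rec_eval (Cnf f [g, h]) xs z"
  by (rule rec_eval.comp) auto

lemma rec1_id: "rec1 (\<lambda>x. x)"
  unfolding rec1_def by (rule exI[of _ "Idf 0"]) (use proj[of 0 "[x]" for x] in simp)

lemma rec2_fst: "rec2 (\<lambda>x y. x)"
  unfolding rec2_def by (rule exI[of _ "Idf 0"]) (use proj[of 0 "[x, y]" for x y] in simp)

lemma rec2_snd: "rec2 (\<lambda>x y. y)"
  unfolding rec2_def by (rule exI[of _ "Idf 1"]) (use proj[of 1 "[x, y]" for x y] in simp)

lemma rec3_1: "rec3 (\<lambda>x y z. x)"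
  unfolding rec3_def by (rule exI[of _ "Idf 0"]) (use proj[of 0 "[x, y, z]" for x y z] in simp)

lemma rec3_2: "rec3 (\<lambda>x y z. y)"
  unfolding rec3_def by (rule exI[of _ "Idf 1"]) (use proj[of 1 "[x, y, z]" for x y z] in simp)

lemma rec3_3: "rec3 (\<lambda>x y z. z)"
  unfolding rec3_def by (rule exI[of _ "Idf 2"]) (use proj[of 2 "[x, y, z]" for x y z] in simp)

lemma rec1_Suc: "rec1 Suc"
  unfolding rec1_def by (rule exI[of _ Sf]) (auto intro: rec_eval.succ)

lemma rec1_zero: "rec1 (\<lambda>x. 0)" and rec2_zero: "rec2 (\<lambda>x y. 0)"
  unfolding rec1_def rec2_def by (rule exI[of _ Zf], auto intro: rec_eval.zero)+

lemma rec1_comp1: "rec1 f \<Longrightarrow> rec1 g \<Longrightarrow> rec1 (\<lambda>x. f (g x))"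
  unfolding rec1_def by (meson rec_eval_comp1)

lemma rec1_comp2: "rec2 f \<Longrightarrow> rec1 g \<Longrightarrow> rec1 h \<Longrightarrow> rec1 (\<lambda>x. f (g x) (h x))"
  unfolding rec1_def rec2_def by (meson rec_eval_comp2)

lemma rec2_comp1: "rec1 f \<Longrightarrow> rec2 g \<Longrightarrow> rec2 (\<lambda>x y. f (g x y))"
  unfolding rec1_def rec2_def by (meson rec_eval_comp1)

lemma rec2_comp2: "rec2 f \<Longrightarrow> rec2 g \<Longrightarrow> rec2 h \<Longrightarrow> rec2 (\<lambda>x y. f (g x y) (h x y))"
  unfolding rec2_def by (meson rec_eval_comp2)

lemma rec3_comp1: "rec1 f \<Longrightarrow> rec3 g \<Longrightarrow> rec3 (\<lambda>x y z. f (g x y z))"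
  unfolding rec1_def rec3_def by (meson rec_eval_comp1)

lemma rec3_comp2: "rec2 f \<Longrightarrow> rec3 g \<Longrightarrow> rec3 h \<Longrightarrow> rec3 (\<lambda>x y z. f (g x y z) (h x y z))"
  unfolding rec2_def rec3_def by (meson rec_eval_comp2)

text \<open>The argument order of \<open>g\<close> (accumulator, counter, parameter) is the one
  prescribed by \<open>primS\<close>.\<close>

lemma rec2_prim:
  assumes "rec1 f" and "rec3 g"
  shows "rec2 (\<lambda>n x. rec_nat (f x) (\<lambda>m y. g y m x) n)"
proof -
  from assms obtain p q where p: "\<And>x. rec_eval p [x] (f x)"
    and q: "\<And>x y z. rec_eval q [x, y, z] (g x y z)"
    unfolding rec1_def rec3_def by blast
  have "rec_eval (Prf p q) [n, x] (rec_nat (f x) (\<lambda>m y. g y m x) n)" for n x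
    by (induction n) (auto intro: prim0 primS p q)
  then show ?thesis unfolding rec2_def by blast
qed

lemma rec2_add: "rec2 (+)"
proof -
  have "rec2 (\<lambda>n x. rec_nat x (\<lambda>m y. Suc y) n)"
    by (rule rec2_prim[OF rec1_id rec3_comp1[OF rec1_Suc rec3_1]])
  moreover have "(\<lambda>n x. rec_nat x (\<lambda>m y. Suc y) n) = (+)"
    by (intro ext, rename_tac n x, induct_tac n) auto
  ultimately show ?thesis by metis
qed

lemma rec1_pred: "rec1 (\<lambda>x. x - Suc 0)"
proof -
  have "rec2 (\<lambda>n x. rec_nat 0 (\<lambda>m y. m) n)"
    by (rule rec2_prim[OF rec1_zero rec3_2])
  from rec1_comp2[OF this rec1_id rec1_id]
  have "rec1 (\<lambda>x. rec_nat 0 (\<lambda>m y. m) x)" .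
  moreover have "(\<lambda>x. rec_nat 0 (\<lambda>m y. m) x) = (\<lambda>x. x - Suc 0)"
    by (intro ext, rename_tac n, case_tac n) auto
  ultimately show ?thesis by metis
qed

lemma rec2_diff: "rec2 (-)"
proof -
  have "rec2 (\<lambda>n x. rec_nat x (\<lambda>m y. y - Suc 0) n)"
    by (rule rec2_prim[OF rec1_id rec3_comp1[OF rec1_pred rec3_1]])
  moreover have "rec_nat x (\<lambda>m y. y - Suc 0) n = x - n" for n x :: nat
    by (induct n) auto
  ultimately have "rec2 (\<lambda>n x. x - n)" by simp
  from rec2_comp2[OF this rec2_snd rec2_fst] show ?thesis by simp
qed

lemma rec2_mult: "rec2 (*)"
proof -
  have "rec2 (\<lambda>n x. rec_nat 0 (\<lambda>m y. y + x) n)"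
    by (rule rec2_prim[OF rec1_zero rec3_comp2[OF rec2_add rec3_1 rec3_3]])
  moreover have "rec_nat 0 (\<lambda>m y. y + x) n = n * x" for n x :: nat
    by (induct n) auto
  ultimately show ?thesis by simp
qed

lemma rec1_triangle: "rec1 triangle"
proof -
  have "rec2 (\<lambda>n x. rec_nat 0 (\<lambda>m y. y + Suc m) n)"
    by (rule rec2_prim[OF rec1_zero rec3_comp2[OF rec2_add rec3_1 rec3_comp1[OF rec1_Suc rec3_2]]])
  from rec1_comp2[OF this rec1_id rec1_id]
  have "rec1 (\<lambda>x. rec_nat 0 (\<lambda>m y. y + Suc m) x)" .
  moreover have "rec_nat 0 (\<lambda>m y. y + Suc m) n = triangle n" for n
    by (induct n) auto
  ultimately show ?thesis by simp
qed

lemma rec2_prod_encode: "rec2 (\<lambda>x y. prod_encode (x, y))"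
  unfolding prod_encode_def case_prod_conv
  by (intro rec2_comp2[OF rec2_add] rec2_comp1[OF rec1_triangle] rec2_add rec2_fst)

lemma triangle_mono: "m \<le> n \<Longrightarrow> triangle m \<le> triangle n"
  by (induction n) (auto simp: le_Suc_eq)

text \<open>Cantor pairing is \<open>prod_encode (a, b) = triangle (a + b) + a\<close>, so
  \<open>a + b\<close> is the least \<open>s\<close> with \<open>z < triangle (Suc s)\<close>.
  Truncated subtraction turns this test into the vanishing of
  \<open>Suc z - triangle (Suc s)\<close>, and minimization finds \<open>s\<close>.\<close>

lemma rec1_prod_decode_sum: "rec1 (\<lambda>z. fst (prod_decode z) + snd (prod_decode z))"
proof -
  have "rec2 (\<lambda>s z. Suc z - triangle (Suc s))"
    by (intro rec2_comp2[OF rec2_diff] rec2_comp1[OF rec1_triangle] rec2_comp1[OF rec1_Suc]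
        rec2_fst rec2_snd)
  then obtain p where p: "\<And>s z. rec_eval p [s, z] (Suc z - triangle (Suc s))"
    unfolding rec2_def by blast
  have "rec_eval (Mnf p) [z] (a + b)" if z: "z = prod_encode (a, b)" for z a b
  proof (rule mini)
    have "Suc z - triangle (Suc (a + b)) = 0"
      unfolding z prod_encode_def by simp
    then show "rec_eval p [a + b, z] 0" using p[of "a + b" z] by simp
    show "\<forall>m<a + b. \<exists>y>0. rec_eval p [m, z] y"
    proof (intro allI impI)
      fix m assume "m < a + b"
      then have "triangle (Suc m) \<le> triangle (a + b)" by (intro triangle_mono) simp
      then have "0 < Suc z - triangle (Suc m)" unfolding z prod_encode_def by simp
      then show "\<exists>y>0. rec_eval p [m, z] y" using p by blast
    qed
  qed
  then have "rec_eval (Mnf p) [z] (fst (prod_decode z) + snd (prod_decode z))" for z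
    by (metis prod.collapse prod_decode_inverse)
  then show ?thesis unfolding rec1_def by blast
qed

lemma rec1_prod_decode_fst: "rec1 (\<lambda>z. fst (prod_decode z))"
proof -
  have "rec1 (\<lambda>z. z - triangle (fst (prod_decode z) + snd (prod_decode z)))"
    by (intro rec1_comp2[OF rec2_diff] rec1_comp1[OF rec1_triangle] rec1_prod_decode_sum rec1_id)
  moreover have "z - triangle (fst (prod_decode z) + snd (prod_decode z)) = fst (prod_decode z)" for z
  proof -
    have "z = prod_encode (fst (prod_decode z), snd (prod_decode z))" by simp
    then have "z = triangle (fst (prod_decode z) + snd (prod_decode z)) + fst (prod_decode z)"
      by (simp only: prod_encode_def case_prod_conv)
    then show ?thesis by (metis add_diff_cancel_left')
  qed
  ultimately show ?thesis by simp
qed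

lemma rec1_prod_decode_snd: "rec1 (\<lambda>z. snd (prod_decode z))"
  using rec1_comp2[OF rec2_diff rec1_prod_decode_sum rec1_prod_decode_fst] by simp

section \<open>Computability on coded data types\<close>

class coded =
  fixes code :: "'a \<Rightarrow> nat"
  assumes code_inj: "code x = code y \<Longrightarrow> x = y"

lemma code_eq_iff: "code x = code y \<longleftrightarrow> x = y"
  using code_inj by blast

instantiation nat :: coded
begin
definition code_nat :: "nat \<Rightarrow> nat" where "code_nat x = x"
instance by standard (simp add: code_nat_def)
end

instantiation bool :: coded
begin
definition code_bool :: "bool \<Rightarrow> nat" where "code_bool b = (if b then 1 else 0)"
instance by standard (simp add: code_bool_def split: if_splits)
end

instantiation prod :: (coded, coded) coded
begin
definition code_prod :: "'a \<times> 'b \<Rightarrow> nat" where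
  "code_prod z = prod_encode (code (fst z), code (snd z))"
instance by standard (auto simp: code_prod_def prod_eq_iff dest: code_inj)
end

instantiation list :: (coded) coded
begin
definition code_list :: "'a list \<Rightarrow> nat" where "code_list xs = list_encode (map code xs)"
instance
proof
  fix xs ys :: "'a list" assume "code xs = code ys"
  then have "map code xs = map (code :: 'a \<Rightarrow> nat) ys" by (simp add: code_list_def list_encode_eq)
  then show "xs = ys" by (rule map_injective) (auto intro: injI code_inj)
qed
end

lemma code_list_simps [simp]:
  "code [] = 0" "code (x # xs) = Suc (prod_encode (code x, code xs))"
  by (simp_all add: code_list_def)

text \<open>The program must halt with the right code on every value of the type, including
  ill-formed monoid tables and transducers. Hence every auxiliary function of the decision procedure
  has to be total and computable outside its intended domain too.\<close>

definition computable :: "('a::coded \<Rightarrow> 'b::coded) \<Rightarrow> bool" where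
  "computable f \<longleftrightarrow> (\<exists>p. \<forall>x. rec_eval p [code x] (code (f x)))"

lemma computableI: "rec1 F \<Longrightarrow> (\<And>x. F (code x) = code (f x)) \<Longrightarrow> computable f"
  unfolding rec1_def computable_def by metis

lemma computable_lift1:
  assumes "rec1 F" "computable f" "\<And>x. F (code (f x)) = code (g x)"
  shows "computable g"
  using assms unfolding rec1_def computable_def by (metis rec_eval_comp1)

lemma computable_lift2:
  assumes "rec2 F" "computable f" "computable g" "\<And>x. F (code (f x)) (code (g x)) = code (h x)"
  shows "computable h"
proof -
  from assms(1) obtain p where p: "\<And>x y. rec_eval p [x, y] (F x y)" unfolding rec2_def by blast
  from assms(2,3) obtain q r where "\<And>x. rec_eval q [code x] (code (f x))"
    "\<And>x. rec_eval r [code x] (code (g x))" unfolding computable_def by blast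
  then have "rec_eval (Cnf p [q, r]) [code x] (code (h x))" for x
    using rec_eval_comp2[of q "[code x]" "code (f x)" r "code (g x)" p] p[of "code (f x)" "code (g x)"]
      assms(4) by metis
  then show ?thesis unfolding computable_def by blast
qed

lemma computable_app: "computable g \<Longrightarrow> computable f \<Longrightarrow> computable (\<lambda>x. g (f x))"
  unfolding computable_def by (meson rec_eval_comp1)

lemma computable_Pair: "computable f \<Longrightarrow> computable g \<Longrightarrow> computable (\<lambda>x. (f x, g x))"
  by (rule computable_lift2[OF rec2_prod_encode, where f = f and g = g]) (auto simp: code_prod_def)

named_theorems computable_intros

lemma computable_id [computable_intros]: "computable (\<lambda>x. x)"
  by (rule computableI[OF rec1_id]) simp

lemma computable_const [computable_intros]: "computable (\<lambda>x. c)"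
proof -
  have "rec1 (\<lambda>x. n)" for n
    by (induction n) (auto intro: rec1_zero rec1_comp1[OF rec1_Suc])
  then show ?thesis by (rule computableI) simp
qed

lemmas [computable_intros] = computable_Pair

lemma computable_fst [computable_intros]: "computable f \<Longrightarrow> computable (\<lambda>x. fst (f x))"
  by (rule computable_lift1[OF rec1_prod_decode_fst]) (auto simp: code_prod_def)

lemma computable_snd [computable_intros]: "computable f \<Longrightarrow> computable (\<lambda>x. snd (f x))"
  by (rule computable_lift1[OF rec1_prod_decode_snd]) (auto simp: code_prod_def)

lemma computable_Suc [computable_intros]: "computable f \<Longrightarrow> computable (\<lambda>x. Suc (f x))"
  by (rule computable_lift1[OF rec1_Suc]) (auto simp: code_nat_def)

lemma computable_add [computable_intros]: "computable f \<Longrightarrow> computable g \<Longrightarrow> computable (\<lambda>x. f x + g x :: nat)"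
  by (rule computable_lift2[OF rec2_add, where f = f and g = g]) (auto simp: code_nat_def)

lemma computable_diff [computable_intros]: "computable f \<Longrightarrow> computable g \<Longrightarrow> computable (\<lambda>x. f x - g x :: nat)"
  by (rule computable_lift2[OF rec2_diff, where f = f and g = g]) (auto simp: code_nat_def)

lemma computable_mult [computable_intros]: "computable f \<Longrightarrow> computable g \<Longrightarrow> computable (\<lambda>x. f x * g x :: nat)"
  by (rule computable_lift2[OF rec2_mult, where f = f and g = g]) (auto simp: code_nat_def)

lemma rec1_is_zero: "rec1 (\<lambda>x. 1 - x)"
  using rec1_comp2[OF rec2_diff rec1_comp1[OF rec1_Suc rec1_zero] rec1_id] by simp

lemma computable_Not [computable_intros]: "computable P \<Longrightarrow> computable (\<lambda>x. \<not> P x)"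
  by (rule computable_lift1[OF rec1_is_zero]) (auto simp: code_bool_def)

lemma computable_conj [computable_intros]: "computable P \<Longrightarrow> computable Q \<Longrightarrow> computable (\<lambda>x. P x \<and> Q x)"
  by (rule computable_lift2[OF rec2_mult, where f = P and g = Q]) (auto simp: code_bool_def)

lemma computable_disj [computable_intros]:
  assumes "computable P" "computable Q" shows "computable (\<lambda>x. P x \<or> Q x)"
proof -
  have "computable (\<lambda>x. \<not> (\<not> P x \<and> \<not> Q x))" by (intro computable_Not computable_conj assms)
  then show ?thesis by simp
qed

lemma computable_imp [computable_intros]:
  assumes "computable P" "computable Q" shows "computable (\<lambda>x. P x \<longrightarrow> Q x)"
proof -
  have "computable (\<lambda>x. \<not> P x \<or> Q x)" by (intro computable_Not computable_disj assms)
  then show ?thesis by (simp only: imp_conv_disj)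
qed

lemma computable_le [computable_intros]: "computable f \<Longrightarrow> computable g \<Longrightarrow> computable (\<lambda>x. f x \<le> (g x :: nat))"
  by (rule computable_lift2[OF rec2_comp1[OF rec1_is_zero rec2_diff], where f = f and g = g]) (auto simp: code_bool_def code_nat_def)

lemma computable_less [computable_intros]: "computable f \<Longrightarrow> computable g \<Longrightarrow> computable (\<lambda>x. f x < (g x :: nat))"
  using computable_le[OF computable_Suc, of f g] by (simp add: Suc_le_eq)

lemma computable_code: "computable f \<Longrightarrow> computable (\<lambda>x. code (f x))"
  by (rule computable_lift1[OF rec1_id]) (auto simp: code_nat_def)

text \<open>Injectivity of \<open>code\<close> reduces equality on any coded type to comparing
  numbers.\<close>

lemma computable_eq [computable_intros]:
  assumes "computable f" "computable g" shows "computable (\<lambda>x. f x = g x)"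
proof -
  have "computable (\<lambda>x. code (f x) \<le> code (g x) \<and> code (g x) \<le> code (f x))"
    by (intro computable_conj computable_le computable_code assms)
  moreover have "(\<lambda>x. code (f x) \<le> code (g x) \<and> code (g x) \<le> code (f x)) = (\<lambda>x. f x = g x)"
    using code_eq_iff order.eq_iff by metis
  ultimately show ?thesis by simp
qed

lemma computable_If [computable_intros]:
  assumes "computable P" "computable f" "computable g"
  shows "computable (\<lambda>x. if P x then f x else g x)"
proof -
  \<comment> \<open>Both branches are total, so the choice can be made arithmetically, with the
    Boolean code as a weight.\<close>
  have "computable (\<lambda>x. code (P x) * code (f x) + (1 - code (P x)) * code (g x))"
    using assms by (intro computable_intros computable_code) 
  then show ?thesis
    by (rule computable_lift1[OF rec1_id]) (auto simp: code_bool_def code_nat_def)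
qed

lemma computable_rec_nat:
  assumes "computable a" "computable (\<lambda>z. b (fst z) (fst (snd z)) (snd (snd z)))" "computable n"
  shows "computable (\<lambda>x. rec_nat (a x) (\<lambda>m y. b x m y) (n x))"
proof -
  obtain p where p: "\<And>x. rec_eval p [code x] (code (a x))"
    using assms(1) unfolding computable_def by blast
  obtain q where q': "\<And>z. rec_eval q [code z] (code (b (fst z) (fst (snd z)) (snd (snd z))))"
    using assms(2) unfolding computable_def by blast
  have q: "rec_eval q [prod_encode (code x, prod_encode (m, code y))] (code (b x m y))" for x m y
    using q'[of "(x, m, y)"] by (simp add: code_prod_def code_nat_def)
  obtain r where r: "\<And>x y. rec_eval r [x, y] (prod_encode (x, y))"
    using rec2_prod_encode unfolding rec2_def by blast
  have idf: "rec_eval (Idf 0) [u, v, w] u" "rec_eval (Idf 1) [u, v, w] v" "rec_eval (Idf 2) [u, v, w] w"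
    for u v w
    using proj[of 0 "[u, v, w]"] proj[of 1 "[u, v, w]"] proj[of 2 "[u, v, w]"] by simp_all
  \<comment> \<open>The environment \<open>x\<close> travels as the parameter of the primitive
    recursion; \<open>?q\<close> packs it with counter and accumulator into the code of one triple,
    since a \<open>computable\<close> function takes one argument.\<close>
  let ?q = "Cnf q [Cnf r [Idf 2, Cnf r [Idf 1, Idf 0]]]"
  have "rec_eval ?q [code y, m, code x] (code (b x m y))" for x m y
    by (rule rec_eval_comp1[OF rec_eval_comp2[OF idf(3) rec_eval_comp2[OF idf(2,1) r] r] q])
  then have pr: "rec_eval (Prf p ?q) [m, code x] (code (rec_nat (a x) (\<lambda>m y. b x m y) m))" for x m
    by (induction m) (auto intro: prim0 primS p)
  from assms(3) obtain s where s: "\<And>x. rec_eval s [code x] (n x)"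
    unfolding computable_def code_nat_def by blast
  have "rec_eval (Cnf (Prf p ?q) [s, Idf 0]) [code x] (code (rec_nat (a x) (\<lambda>m y. b x m y) (n x)))" for x
    by (rule rec_eval_comp2[OF s _ pr]) (use proj[of 0] in force)
  then show ?thesis unfolding computable_def by blast
qed

lemma computable_power [computable_intros]:
  assumes "computable f" "computable g" shows "computable (\<lambda>x. f x ^ g x :: nat)"
proof -
  have "computable (\<lambda>x. rec_nat 1 (\<lambda>m y. y * f x) (g x))"
    by (intro computable_rec_nat computable_intros computable_app[OF assms(1)] assms)
  moreover have "rec_nat 1 (\<lambda>m y. y * c) n = c ^ n" for c n :: nat by (induction n) auto
  ultimately show ?thesis by simp
qed

lemma computable_Cons [computable_intros]: "computable f \<Longrightarrow> computable g \<Longrightarrow> computable (\<lambda>x. f x # g x)"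
  by (rule computable_lift2[OF rec2_comp1[OF rec1_Suc rec2_prod_encode], where f = f and g = g]) auto

lemma computable_tl [computable_intros]: "computable f \<Longrightarrow> computable (\<lambda>x. tl (f x))"
proof (rule computable_lift1[OF rec1_comp1[OF rec1_prod_decode_snd rec1_pred]])
  \<comment> \<open>This covers the empty list: its code \<open>0\<close> has predecessor
    \<open>0\<close>, which decodes to tail code \<open>0\<close> again.\<close>
  have "prod_decode 0 = (0, 0)"
    by (simp add: prod_decode_def prod_decode_aux.simps)
  then show "snd (prod_decode (code (f x) - Suc 0)) = code (tl (f x))" for x
    by (cases "f x") auto
qed

lemma computable_hd [computable_intros]:
  assumes "computable f" shows "computable (\<lambda>x. hd (f x))"
proof -
  \<comment> \<open>\<open>hd []\<close> is unspecified but one fixed value, so its code can be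
    built into the program as a constant.\<close>
  have "computable (\<lambda>x. if f x = [] then code (hd (f x)) else fst (prod_decode (code (f x) - 1)))"
  proof -
    have "computable (\<lambda>x. fst (prod_decode (code (f x) - 1)))"
      by (rule computable_lift1[OF rec1_comp1[OF rec1_prod_decode_fst rec1_pred] assms]) (simp add: code_nat_def)
    from computable_If[OF computable_eq[OF assms computable_const[of "[]"]] computable_const[of "code (hd [])"] this]
    show ?thesis by (rule back_subst[of computable]) auto
  qed
  then show ?thesis
    by (rule computable_lift1[OF rec1_id]) (auto simp: code_nat_def neq_Nil_conv)
qed

text \<open>Only recursion on numbers is available, so the fold is run as an iteration consuming one
  list entry per round. The code of a list bounds its length; the surplus rounds act on the empty
  list and change nothing.\<close>

lemma computable_foldl:
  assumes "computable l" "computable a" "computable (\<lambda>z. b (fst z) (fst (snd z)) (snd (snd z)))"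
  shows "computable (\<lambda>x. foldl (\<lambda>y e. b x y e) (a x) (l x))"
proof -
  define step where "step = (\<lambda>x (s :: 'b list \<times> 'c).
    if fst s = [] then s else (tl (fst s), b x (snd s) (hd (fst s))))"
  have iter: "rec_nat (xs, y) (\<lambda>_. step x) n = (drop n xs, foldl (b x) y (take n xs))" for x xs y n
  proof (induction n)
    case (Suc n)
    have "rec_nat (xs, y) (\<lambda>_. step x) (Suc n) = step x (drop n xs, foldl (b x) y (take n xs))"
      by (simp only: nat.rec Suc)
    then show ?case
      by (cases "n < length xs")
        (simp_all add: step_def take_Suc_conv_app_nth hd_drop_conv_nth drop_Suc tl_drop)
  qed simp
  have len: "length (xs :: 'b list) \<le> code xs" for xs
    by (induction xs) (auto intro: order_trans[OF _ le_prod_encode_2])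
  have "computable (\<lambda>x. snd (rec_nat (l x, a x) (\<lambda>m s. step x s) (code (l x))))"
  proof (intro computable_intros computable_rec_nat assms computable_code)
    have "computable (\<lambda>z :: 'a \<times> 'b list \<times> 'c. b (fst z) (snd (snd z)) (hd (fst (snd z))))"
      using computable_app[OF assms(3), of "\<lambda>z :: 'a \<times> 'b list \<times> 'c. (fst z, snd (snd z), hd (fst (snd z)))"]
      by (simp add: computable_intros)
    from computable_app[OF this, of "\<lambda>z. (fst z, snd (snd z))"]
    have "computable (\<lambda>z :: 'a \<times> nat \<times> 'b list \<times> 'c. b (fst z) (snd (snd (snd z))) (hd (fst (snd (snd z)))))"
      by (simp add: computable_intros)
    then show "computable (\<lambda>z :: 'a \<times> nat \<times> 'b list \<times> 'c. step (fst z) (snd (snd z)))"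
      unfolding step_def by (intro computable_If computable_intros)
  qed
  then show ?thesis by (simp add: iter len)
qed

text \<open>The step of a fold sees environment, accumulator and entry; this lets a function of
  environment and entry ignore the accumulator.\<close>

lemma computable_env:
  assumes "computable (\<lambda>z. F (fst z) (snd z))"
  shows "computable (\<lambda>z. F (fst z) (snd (snd z)))"
  using computable_app[OF assms, of "\<lambda>z. (fst z, snd (snd z))"] by (simp add: computable_intros)

lemma computable_rev [computable_intros]:
  assumes "computable l" shows "computable (\<lambda>x. rev (l x))"
proof -
  have "computable (\<lambda>x. foldl (\<lambda>y e. e # y) [] (l x))"
    by (intro computable_foldl computable_intros assms)
  moreover have "foldl (\<lambda>y e. e # y) ys xs = rev xs @ ys" for xs ys :: "'b list"
    by (induction xs arbitrary: ys) auto
  ultimately show ?thesis by simp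
qed

lemma computable_map [computable_intros]:
  assumes "computable (\<lambda>z. F (fst z) (snd z))" "computable l"
  shows "computable (\<lambda>x. map (\<lambda>y. F x y) (l x))"
proof -
  have "computable (\<lambda>x. rev (foldl (\<lambda>y e. F x e # y) [] (l x)))"
    by (intro computable_foldl computable_intros assms computable_env)
  moreover have "foldl (\<lambda>y e. f e # y) ys xs = rev (map f xs) @ ys" for f :: "'b \<Rightarrow> 'c" and xs ys
    by (induction xs arbitrary: ys) auto
  ultimately show ?thesis by simp
qed

lemma computable_append [computable_intros]:
  assumes "computable f" "computable g" shows "computable (\<lambda>x. f x @ g x)"
proof -
  have "computable (\<lambda>x. foldl (\<lambda>y e. e # y) (g x) (rev (f x)))"
    by (intro computable_foldl computable_intros assms)
  moreover have "foldl (\<lambda>y e. e # y) ys xs = rev xs @ ys" for xs ys :: "'b list"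
    by (induction xs arbitrary: ys) auto
  ultimately show ?thesis by simp
qed

lemma computable_concat [computable_intros]:
  assumes "computable l" shows "computable (\<lambda>x. concat (l x))"
proof -
  have "computable (\<lambda>x. foldl (\<lambda>y e. y @ e) [] (l x))"
    by (intro computable_foldl computable_intros assms)
  moreover have "foldl (\<lambda>y e. y @ e) ys xss = ys @ concat xss" for ys and xss :: "'b list list"
    by (induction xss arbitrary: ys) auto
  ultimately show ?thesis by simp
qed

lemma computable_filter [computable_intros]:
  assumes "computable (\<lambda>z. P (fst z) (snd z))" "computable l"
  shows "computable (\<lambda>x. filter (\<lambda>y. P x y) (l x))"
proof -
  have "computable (\<lambda>x. concat (map (\<lambda>y. if P x y then [y] else []) (l x)))"
    by (intro computable_concat computable_map computable_If computable_intros assms)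
  moreover have "concat (map (\<lambda>y. if Q y then [y] else []) xs) = filter Q xs" for Q :: "'b \<Rightarrow> bool" and xs
    by (induction xs) auto
  ultimately show ?thesis by simp
qed

lemma computable_Ball [computable_intros]:
  assumes "computable (\<lambda>z. P (fst z) (snd z))" "computable l"
  shows "computable (\<lambda>x. \<forall>y\<in>set (l x). P x y)"
proof -
  have "computable (\<lambda>x. foldl (\<lambda>y e. y \<and> P x e) True (l x))"
    by (intro computable_foldl computable_intros assms computable_env)
  moreover have "foldl (\<lambda>y e. y \<and> Q e) b xs \<longleftrightarrow> b \<and> (\<forall>y\<in>set xs. Q y)" for Q :: "'b \<Rightarrow> bool" and b xs
    by (induction xs arbitrary: b) auto
  ultimately show ?thesis by simp
qed

lemma computable_Bex [computable_intros]:
  assumes "computable (\<lambda>z. P (fst z) (snd z))" "computable l"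
  shows "computable (\<lambda>x. \<exists>y\<in>set (l x). P x y)"
proof -
  have "computable (\<lambda>x. \<not> (\<forall>y\<in>set (l x). \<not> P x y))"
    by (intro computable_intros assms)
  then show ?thesis by simp
qed

lemma computable_length [computable_intros]:
  assumes "computable l" shows "computable (\<lambda>x. length (l x))"
proof -
  have "computable (\<lambda>x. foldl (\<lambda>y e. Suc y) 0 (l x))"
    by (intro computable_foldl computable_intros assms)
  moreover have "foldl (\<lambda>y e. Suc y) n xs = length xs + n" for n and xs :: "'b list"
    by (induction xs arbitrary: n) auto
  ultimately show ?thesis by simp
qed

lemma computable_upt0 [computable_intros]:
  assumes "computable f" shows "computable (\<lambda>x. [0..<f x])"
proof -
  have "computable (\<lambda>x. rec_nat [] (\<lambda>m y. y @ [m]) (f x))"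
    by (intro computable_rec_nat computable_intros assms)
  moreover have "rec_nat [] (\<lambda>m y. y @ [m]) n = [0..<n]" for n by (induction n) auto
  ultimately show ?thesis by simp
qed

lemma computable_drop [computable_intros]:
  assumes "computable f" "computable l" shows "computable (\<lambda>x. drop (f x) (l x))"
proof -
  have "computable (\<lambda>x. rec_nat (l x) (\<lambda>m y. tl y) (f x))"
    by (intro computable_rec_nat computable_intros assms)
  moreover have "rec_nat xs (\<lambda>m y. tl y) n = drop n xs" for n and xs :: "'b list"
    by (induction n) (auto simp: drop_Suc tl_drop)
  ultimately show ?thesis by simp
qed

lemma computable_take [computable_intros]:
  assumes "computable f" "computable l" shows "computable (\<lambda>x. take (f x) (l x))"
proof -
  have "computable (\<lambda>x. rev (drop (length (l x) - f x) (rev (l x))))"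
    by (intro computable_intros assms)
  moreover have "rev (drop (length xs - n) (rev xs)) = take n xs" for n and xs :: "'b list"
    by (cases "n \<le> length xs") (simp_all add: rev_drop)
  ultimately show ?thesis by simp
qed

lemma computable_n_lists [computable_intros]:
  assumes "computable f" "computable l" shows "computable (\<lambda>x. List.n_lists (f x) (l x))"
proof -
  have "computable (\<lambda>x. rec_nat [[]] (\<lambda>m yss. concat (map (\<lambda>ys. map (\<lambda>y. y # ys) (l x)) yss)) (f x))"
    by (intro computable_rec_nat computable_intros assms computable_app[OF assms(2)])
  moreover have "rec_nat [[]] (\<lambda>m yss. concat (map (\<lambda>ys. map (\<lambda>y. y # ys) xs) yss)) n = List.n_lists n xs"
    for n and xs :: "'b list"
    by (induction n) auto
  ultimately show ?thesis by simp
qed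

section \<open>Quotients of words\<close>

text \<open>This says \<open>A\<^sup>-\<^sup>1 B = C\<^sup>-\<^sup>1 D\<close> in the free group.\<close>

definition minor :: "'a list \<Rightarrow> 'a list \<Rightarrow> 'a list \<Rightarrow> 'a list \<Rightarrow> bool" where
  "minor A B C D \<longleftrightarrow> (\<exists>x y s t. A = x @ s \<and> B = x @ t \<and> C = y @ s \<and> D = y @ t)"

lemma minorI: "minor (x @ s) (x @ t) (y @ s) (y @ t)"
  unfolding minor_def by blast

lemma minor_refl [simp]: "minor A B A B"
  using minorI[of "[]" A B "[]"] by simp

lemma minor_sym: "minor A B C D \<Longrightarrow> minor C D A B"
  unfolding minor_def by blast

lemma minor_swap: "minor A B C D \<Longrightarrow> minor B A D C"
  unfolding minor_def by blast

lemma minor_rev: "minor A B C D \<Longrightarrow> minor (rev A) (rev C) (rev B) (rev D)"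
  unfolding minor_def by (metis rev_append)

text \<open>The middle row \<open>C\<close>, \<open>D\<close> is cut in two ways. Comparing the two
  cuts of \<open>C\<close>, the piece between them can be moved into the left factors or into the
  right factors.\<close>

lemma minor_trans:
  assumes "minor A B C D" "minor C D E F" shows "minor A B E F"
proof -
  obtain x y s t where 1: "A = x @ s" "B = x @ t" "C = y @ s" "D = y @ t"
    using assms(1) unfolding minor_def by blast
  obtain y' z s' t' where 2: "C = y' @ s'" "D = y' @ t'" "E = z @ s'" "F = z @ t'"
    using assms(2) unfolding minor_def by blast
  from 1(3) 2(1) have "y @ s = y' @ s'" by simp
  then show ?thesis
    unfolding append_eq_append_conv2
  proof (elim exE disjE conjE)
    fix c assume "y = y' @ c" "c @ s = s'"
    then show ?thesis using 1 2 minorI[of x s t "z @ c"] by auto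
  next
    fix c assume "y @ c = y'" "s = c @ s'"
    then show ?thesis using 1 2 minorI[of "x @ c" s' t' z] by auto
  qed
qed

text \<open>By \<open>minor_rev\<close>, reversing all words transposes the matrix, so gluing
  matrices along a column becomes gluing them along a row, which is
  \<open>minor_trans\<close>.\<close>

lemma minor_compose: "minor A B C D \<Longrightarrow> minor B E D F \<Longrightarrow> minor A E C F"
  using minor_rev[OF minor_trans[OF minor_rev minor_rev], of A B C D E F] by simp

lemma minor_append: "minor A B C D \<Longrightarrow> minor (A @ a) (B @ b) (C @ a) (D @ b)"
  unfolding minor_def by (metis append_assoc)

lemma suffix_of_longer: "u @ v = x @ y \<Longrightarrow> length v \<le> length y \<Longrightarrow> \<exists>z. y = z @ v"
  by (auto simp: append_eq_append_conv2)

text \<open>In the free group this is multiplication of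
  \<open>a (A a)^-1 (B b) b^-1 = A^-1 B\<close> and its analogue for \<open>C\<close>,
  \<open>D\<close>. With words one distinguishes whether the removed suffixes \<open>a\<close> and
  \<open>b\<close> reach beyond the common right factors \<open>s\<close> and
  \<open>t\<close>.\<close>

lemma minor_cancel:
  assumes "minor (A @ a) (B @ b) (C @ a) (D @ b)" shows "minor A B C D"
proof -
  obtain x y s t where 1: "A @ a = x @ s" "B @ b = x @ t" "C @ a = y @ s" "D @ b = y @ t"
    using assms unfolding minor_def by blast
  show ?thesis
  proof (cases "length a \<le> length s"; cases "length b \<le> length t")
    assume le: "length a \<le> length s" "length b \<le> length t"
    then obtain s' t' where "s = s' @ a" "t = t' @ b"
      using suffix_of_longer[OF 1(1)] suffix_of_longer[OF 1(2)] by auto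
    then show ?thesis using 1 minorI[of x s' t' y] by simp
  next
    assume le: "length a \<le> length s" "\<not> length b \<le> length t"
    then obtain s' b' where "s = s' @ a" "b = b' @ t"
      using suffix_of_longer[OF 1(1)] suffix_of_longer[OF 1(2)[symmetric]] by auto
    moreover from this 1 have "x = B @ b'" "y = D @ b'" by (metis append_assoc append_same_eq)+
    ultimately show ?thesis using 1 minorI[of B "b' @ s'" "[]" D] by simp
  next
    assume le: "\<not> length a \<le> length s" "length b \<le> length t"
    then obtain t' a' where "t = t' @ b" "a = a' @ s"
      using suffix_of_longer[OF 1(2)] suffix_of_longer[OF 1(1)[symmetric]] by auto
    moreover from this 1 have "x = A @ a'" "y = C @ a'" by auto
    ultimately show ?thesis using 1 minorI[of A "[]" "a' @ t'" C] by simp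
  next
    assume "\<not> length a \<le> length s" "\<not> length b \<le> length t"
    then obtain a' b' where "a = a' @ s" "b = b' @ t"
      using suffix_of_longer[OF 1(1)[symmetric]] suffix_of_longer[OF 1(2)[symmetric]] by auto
    then have xy: "x = A @ a'" "x = B @ b'" "y = C @ a'" "y = D @ b'" using 1 by auto
    then have "A @ a' = B @ b'" by simp
    then show ?thesis unfolding append_eq_append_conv2
    proof (elim exE disjE conjE)
      fix c assume "A = B @ c" "c @ a' = b'"
      then show ?thesis using xy minorI[of B c "[]" D] by auto
    next
      fix c assume "A @ c = B" "a' = c @ b'"
      then show ?thesis using xy minorI[of A "[]" c C] by auto
    qed
  qed
qed

text \<open>Moving the longest common prefix of \<open>s\<close> and \<open>t\<close> into
  \<open>x\<close> and \<open>y\<close> makes \<open>s^-1 t\<close> the reduced form of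
  \<open>A^-1 B\<close>.\<close>

lemma minor_reduced:
  assumes "minor A B C D"
  obtains x y s t where "A = x @ s" "B = x @ t" "C = y @ s" "D = y @ t"
    "s = [] \<or> t = [] \<or> hd s \<noteq> hd t"
proof -
  obtain x y s t where 1: "A = x @ s" "B = x @ t" "C = y @ s" "D = y @ t"
    using assms unfolding minor_def by blast
  obtain p s' t' where 2: "s = p @ s'" "t = p @ t'" "s' = [] \<or> t' = [] \<or> hd s' \<noteq> hd t'"
    using longest_common_prefix[of s t] by metis
  show ?thesis by (rule that[of "x @ p" s' t' "y @ p"]) (use 1 2 in auto)
qed

section \<open>Powers of words and uniqueness of roots\<close>

definition wpow :: "'a list \<Rightarrow> nat \<Rightarrow> 'a list" where
  "wpow w i = concat (replicate i w)"

lemma wpow_simps [simp]: "wpow w 0 = []" "wpow w (Suc i) = w @ wpow w i"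
  by (simp_all add: wpow_def)

lemma wpow_add: "wpow w (i + j) = wpow w i @ wpow w j"
  by (simp add: wpow_def replicate_add)

lemma wpow_Suc2: "wpow w (Suc i) = wpow w i @ w"
  using wpow_add[of w i 1] by simp

lemma length_wpow [simp]: "length (wpow w i) = i * length w"
  by (induction i) auto

lemma wpow_eq_imp_eq:
  assumes "wpow a d = wpow b d" "0 < d" shows "a = b"
proof -
  from assms have "d * length a = d * length b" by (metis length_wpow)
  with assms(2) have "length a = length b" by simp
  with assms show ?thesis by (cases d) auto
qed

lemma wpow_rotate: "wpow (u @ v) d @ u = u @ wpow (v @ u) d"
  by (induction d) auto

text \<open>Both \<open>a\<close> and \<open>t b t^-1\<close> are \<open>d\<close>-th roots of the
  same group element. On words, \<open>t\<close> loses a leading \<open>a\<close> as long as it is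
  longer; once \<open>a = t @ c\<close>, the power of \<open>b\<close> is a rotation of the power of
  \<open>a\<close>, so \<open>b = c @ t\<close>.\<close>

lemma root_conj:
  assumes "t @ wpow b d = wpow a d @ t" "0 < d"
  shows "t @ b = a @ t"
  using assms(1)
proof (induction t rule: length_induct)
  case (1 t)
  have len: "length b = length a"
    using arg_cong[OF "1.prems", of length] assms(2) by simp
  show ?case
  proof (cases "a = []")
    case True
    then show ?thesis using len by simp
  next
    case False
    obtain d' where d': "d = Suc d'" using assms(2) by (cases d) auto
    have "t @ wpow b d = a @ wpow a d' @ t" using "1.prems" d' by simp
    from iffD1[OF append_eq_append_conv2 this] show ?thesis
    proof (elim exE disjE conjE)
      fix t' assume t': "t = a @ t'" "t' @ wpow b d = wpow a d' @ t"
      from t' have "t' @ wpow b d = wpow a d @ t'"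
        by (metis append_assoc d' wpow_Suc2)
      moreover have "length t' < length t" using t' False by simp
      ultimately have "t' @ b = a @ t'" using "1.IH" by blast
      then show ?thesis using t' by simp
    next
      fix c assume c: "t @ c = a" "wpow b d = c @ wpow a d' @ t"
      have "t @ wpow b d = t @ wpow (c @ t) d"
        using "1.prems" wpow_rotate[of t c d] c(1) by simp
      then have "b = c @ t" using wpow_eq_imp_eq assms(2) by simp
      then show ?thesis using c(1) by auto
    qed
  qed
qed

text \<open>Put \<open>g = x^-1 x'\<close>. Cancelling the trailing \<open>i\<close> loops, the
  hypothesis says \<open>a^d g = g a'^d\<close>; uniqueness of roots gives
  \<open>a g = g a'\<close>, which is the claim.\<close>

lemma minor_root:
  assumes "minor (x @ wpow a i) (x' @ wpow a' i) (x @ wpow a (i + d)) (x' @ wpow a' (i + d))" "0 < d"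
  shows "minor x x' (x @ a) (x' @ a')"
proof -
  have "minor x x' (x @ wpow a d) (x' @ wpow a' d)"
    by (rule minor_cancel[of _ "wpow a i" _ "wpow a' i"])
      (use assms(1) in \<open>simp add: add.commute[of i] wpow_add\<close>)
  then obtain z w s t where 1: "x = z @ s" "x' = z @ t" "x @ wpow a d = w @ s" "x' @ wpow a' d = w @ t"
    and red: "s = [] \<or> t = [] \<or> hd s \<noteq> hd t"
    by (rule minor_reduced)
  have "length z \<le> length w" using arg_cong[OF 1(3), of length] 1(1) by simp
  then obtain v where v: "w = z @ v" "s @ wpow a d = v @ s"
  proof -
    have "z @ s @ wpow a d = w @ s" using 1(1,3) by simp
    then have "\<exists>v. w = z @ v" using \<open>length z \<le> length w\<close> by (auto simp: append_eq_append_conv2)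
    then show ?thesis using that \<open>z @ s @ wpow a d = w @ s\<close> by auto
  qed
  then have v': "t @ wpow a' d = v @ t" using 1 by simp
  have len: "length v = d * length a" "length v = d * length a'"
    using arg_cong[OF v(2), of length] arg_cong[OF v', of length] by auto
  then have laa: "length a = length a'" using assms(2) by auto
  consider "s = []" | "t = []" | "s \<noteq> []" "t \<noteq> []" "hd s \<noteq> hd t" using red by blast
  then show ?thesis
  proof cases
    case 1
    then have "t @ wpow a' d = wpow a d @ t" using v v' by simp
    then have "t @ a' = a @ t" using assms(2) by (rule root_conj)
    then show ?thesis using \<open>x = z @ s\<close> \<open>x' = z @ t\<close> 1 minorI[of z "[]" t "z @ a"] by simp
  next
    case 2
    then have "s @ wpow a d = wpow a' d @ s" using v v' by simp
    then have "s @ a = a' @ s" using assms(2) by (rule root_conj)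
    then show ?thesis using \<open>x = z @ s\<close> \<open>x' = z @ t\<close> 2 minorI[of z s "[]" "z @ a'"] by simp
  next
    case 3
    \<comment> \<open>\<open>v @ s\<close> starts with \<open>s\<close> and \<open>v @ t\<close>
      with \<open>t\<close>, so a nonempty \<open>v\<close> would give \<open>s\<close> and
      \<open>t\<close> the same first letter.\<close>
    then have "v = []" using v(2) v' by (metis append_Nil hd_append2)
    then show ?thesis using len assms(2) by simp
  qed
qed

section \<open>Runs of transducers\<close>

lemma nft_run_Nil_iff [simp]: "nft_run T p [] w q \<longleftrightarrow> w = [] \<and> p = q"
  by (auto elim: nft_run.cases intro: nft_run.nil)

lemma nft_run_Cons_iff:
  "nft_run T p (a # u) w q \<longleftrightarrow>
   (\<exists>r x y. (p, a, r, x) \<in> set (trans T) \<and> nft_run T r u y q \<and> w = x @ y)"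
  by (subst nft_run.simps) auto

lemma nft_run_append:
  "nft_run T p (u @ v) z r \<longleftrightarrow> (\<exists>q x y. nft_run T p u x q \<and> nft_run T q v y r \<and> z = x @ y)"
proof (induction u arbitrary: p z)
  case (Cons a u)
  show ?case unfolding append_Cons nft_run_Cons_iff Cons by (force simp flip: append_assoc)
qed simp

text \<open>The initial output is charged to the prefix and the final output to the suffix, so that
  at any cut the output is plainly the concatenation of an \<open>acc\<close> and a
  \<open>coacc\<close> part.\<close>

definition acc :: "nft \<Rightarrow> nat list \<Rightarrow> nat \<Rightarrow> nat list \<Rightarrow> bool" where
  "acc T u p x \<longleftrightarrow> (\<exists>q0 i w. (q0, i) \<in> set (iout T) \<and> nft_run T q0 u w p \<and> x = i @ w)"

definition coacc :: "nft \<Rightarrow> nat \<Rightarrow> nat list \<Rightarrow> nat list \<Rightarrow> bool" where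
  "coacc T p v y \<longleftrightarrow> (\<exists>qf t w. (qf, t) \<in> set (tout T) \<and> nft_run T p v w qf \<and> y = w @ t)"

lemma nft_rel_append:
  "nft_rel T (u @ v) z \<longleftrightarrow> (\<exists>p x y. acc T u p x \<and> coacc T p v y \<and> z = x @ y)"
proof
  assume "nft_rel T (u @ v) z"
  then obtain q0 i w qf t q x y where "(q0, i) \<in> set (iout T)" "(qf, t) \<in> set (tout T)"
    "nft_run T q0 u x q" "nft_run T q v y qf" "z = i @ (x @ y) @ t"
    unfolding nft_rel_def nft_run_append by blast
  then have "acc T u q (i @ x)" "coacc T q v (y @ t)" "z = (i @ x) @ (y @ t)"
    unfolding acc_def coacc_def by auto
  then show "\<exists>p x y. acc T u p x \<and> coacc T p v y \<and> z = x @ y" by blast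
next
  assume "\<exists>p x y. acc T u p x \<and> coacc T p v y \<and> z = x @ y"
  then obtain q0 i w qf t q x y where 1: "(q0, i) \<in> set (iout T)" "(qf, t) \<in> set (tout T)"
    "nft_run T q0 u x q" "nft_run T q v y qf" "z = i @ (x @ y) @ t"
    unfolding acc_def coacc_def by force
  then have "nft_run T q0 (u @ v) (x @ y) qf" unfolding nft_run_append by blast
  with 1 show "nft_rel T (u @ v) z" unfolding nft_rel_def by blast
qed

lemma acc_append:
  "acc T (u @ v) q z \<longleftrightarrow> (\<exists>p x w. acc T u p x \<and> nft_run T p v w q \<and> z = x @ w)"
  unfolding acc_def nft_run_append by (auto, (metis append_assoc)+)

lemma coacc_append:
  "coacc T p (u @ v) z \<longleftrightarrow> (\<exists>q w y. nft_run T p u w q \<and> coacc T q v y \<and> z = w @ y)"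
  unfolding coacc_def nft_run_append by (auto, (metis append_assoc)+)

lemma words_simps [simp]:
  "[] \<in> words k" "a # u \<in> words k \<longleftrightarrow> a < k \<and> u \<in> words k"
  "u @ v \<in> words k \<longleftrightarrow> u \<in> words k \<and> v \<in> words k"
  by (auto simp: words_def)

lemma words_rev [simp]: "rev u \<in> words k \<longleftrightarrow> u \<in> words k"
  by (simp add: words_def)

lemma wf_transD:
  assumes "wf_nft T" "(p, a, q, w) \<in> set (trans T)"
  shows "p < nstates T" "a < alph T" "q < nstates T" "w \<in> words (alph T)"
  using assms unfolding wf_nft_def words_def by auto

lemma nft_run_wf:
  assumes "nft_run T p u w q" "wf_nft T"
  shows "u \<in> words (alph T)" "w \<in> words (alph T)" "p < nstates T \<longleftrightarrow> q < nstates T"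
  using assms by (induction rule: nft_run.induct) (auto dest: wf_transD)

lemma acc_wf:
  assumes "wf_nft T" "acc T u p x"
  shows "u \<in> words (alph T)" "p < nstates T" "x \<in> words (alph T)"
proof -
  obtain q0 i w where 1: "(q0, i) \<in> set (iout T)" "nft_run T q0 u w p" "x = i @ w"
    using assms(2) unfolding acc_def by blast
  have "q0 < nstates T" "i \<in> words (alph T)"
    using assms(1) 1(1) unfolding wf_nft_def words_def by auto
  with 1 nft_run_wf[OF 1(2) assms(1)]
  show "u \<in> words (alph T)" "p < nstates T" "x \<in> words (alph T)" by auto
qed

lemma coacc_wf:
  assumes "wf_nft T" "coacc T p u x"
  shows "u \<in> words (alph T)" "p < nstates T" "x \<in> words (alph T)"
proof -
  obtain qf t w where 1: "(qf, t) \<in> set (tout T)" "nft_run T p u w qf" "x = w @ t"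
    using assms(2) unfolding coacc_def by blast
  have "qf < nstates T" "t \<in> words (alph T)"
    using assms(1) 1(1) unfolding wf_nft_def words_def by auto
  with 1 nft_run_wf[OF 1(2) assms(1)]
  show "u \<in> words (alph T)" "p < nstates T" "x \<in> words (alph T)" by auto
qed

lemma nft_rel_wf:
  assumes "wf_nft T" "nft_rel T u z"
  shows "u \<in> words (alph T)" "z \<in> words (alph T)"
  using assms nft_rel_append[of T u "[]" z] by (auto dest: acc_wf coacc_wf)

section \<open>Mirror images, which exchange prefixes and suffixes\<close>

definition mirror :: "nft \<Rightarrow> nft" where
  "mirror T = NFT (alph T) (nstates T) (map (\<lambda>(p, a, q, w). (q, a, p, rev w)) (trans T))
     (map (\<lambda>(q, w). (q, rev w)) (tout T)) (map (\<lambda>(q, w). (q, rev w)) (iout T))"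

lemma mirror_simps [simp]:
  "alph (mirror T) = alph T" "nstates (mirror T) = nstates T"
  by (simp_all add: mirror_def)

lemma mirror_sets:
  "(q, a, p, w) \<in> set (trans (mirror T)) \<longleftrightarrow> (p, a, q, rev w) \<in> set (trans T)"
  "(q, w) \<in> set (iout (mirror T)) \<longleftrightarrow> (q, rev w) \<in> set (tout T)"
  "(q, w) \<in> set (tout (mirror T)) \<longleftrightarrow> (q, rev w) \<in> set (iout T)"
  by (force simp: mirror_def)+

lemma mirror_mirror [simp]: "mirror (mirror T) = T"
  by (cases T) (simp add: mirror_def comp_def case_prod_beta)

lemma wf_mirror: "wf_nft T \<Longrightarrow> wf_nft (mirror T)"
proof -
  assume wf: "wf_nft T"
  have "distinct (map (\<lambda>(q, a, p, w). (q, a, p)) (map (\<lambda>(p, a, q, w). (q, a, p, rev w)) (trans T)))"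
  proof -
    have "map (\<lambda>(q, a, p, w). (q, a, p)) (map (\<lambda>(p, a, q, w). (q, a, p, rev w)) (trans T))
      = map (\<lambda>(p, a, q). (q, a, p)) (map (\<lambda>(p, a, q, w). (p, a, q)) (trans T))"
      by (simp split: prod.splits)
    moreover have "inj_on (\<lambda>(p, a, q). (q, a, p)) X" for X :: "(nat \<times> nat \<times> nat) set"
      by (auto simp: inj_on_def)
    ultimately show ?thesis using wf unfolding wf_nft_def by (simp only: distinct_map)
  qed
  moreover have "map fst (map (\<lambda>(q, w). (q, rev w)) l) = map fst l" for l :: "(nat \<times> nat list) list"
    by (simp add: case_prod_beta)
  ultimately show ?thesis using wf unfolding wf_nft_def
    by (auto simp: mirror_def comp_def case_prod_beta)
qed

lemma nft_run_mirror: "nft_run (mirror T) q (rev u) (rev w) p \<longleftrightarrow> nft_run T p u w q"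
proof -
  have "nft_run T p u w q \<Longrightarrow> nft_run (mirror T) q (rev u) (rev w) p" for T p u w q
  proof (induction rule: nft_run.induct)
    case (cons p a r x T u y q)
    have "nft_run (mirror T) r [a] (rev x) p"
      unfolding nft_run_Cons_iff using cons.hyps by (auto simp: mirror_sets)
    then show ?case using cons.IH by (auto simp: nft_run_append)
  qed (simp add: nft_run.nil)
  from this[of T p u w q] this[of "mirror T" q "rev u" "rev w" p] show ?thesis by auto
qed

lemma acc_mirror: "acc (mirror T) (rev u) p (rev x) \<longleftrightarrow> coacc T p u x"
proof
  assume "acc (mirror T) (rev u) p (rev x)"
  then obtain q0 i w where "(q0, rev i) \<in> set (tout T)" "nft_run (mirror T) q0 (rev u) w p" "rev x = i @ w"
    unfolding acc_def mirror_sets by blast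
  moreover from this have "x = rev w @ rev i" by (metis rev_append rev_rev_ident)
  ultimately show "coacc T p u x"
    unfolding coacc_def using nft_run_mirror[of T q0 u "rev w" p] by auto
next
  assume "coacc T p u x"
  then show "acc (mirror T) (rev u) p (rev x)"
    unfolding acc_def coacc_def mirror_sets
    by (metis nft_run_mirror rev_append rev_rev_ident)
qed

lemma coacc_mirror: "coacc (mirror T) p (rev u) (rev x) \<longleftrightarrow> acc T u p x"
  using acc_mirror[of "mirror T" "rev u" p "rev x"] by simp

lemma nft_rel_mirror: "nft_rel (mirror T) (rev u) (rev z) \<longleftrightarrow> nft_rel T u z"
proof -
  have "nft_rel T u z \<Longrightarrow> nft_rel (mirror T) (rev u) (rev z)" for T u z
    using nft_rel_append[of T u "[]" z] nft_rel_append[of "mirror T" "[]" "rev u" "rev z"]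
    by (metis acc_mirror append_self_conv coacc_mirror rev.simps(1) rev_append append_Nil)
  from this[of T u z] this[of "mirror T" "rev u" "rev z"] show ?thesis by auto
qed

lemma functional_mirror: "functional_nft T \<Longrightarrow> functional_nft (mirror T)"
  unfolding functional_nft_def
  by (metis nft_rel_mirror rev_rev_ident)

section \<open>Domain and values of the defined function\<close>

definition dm :: "nft \<Rightarrow> nat list set" where
  "dm T = {u. \<exists>z. nft_rel T u z}"

definition fn :: "nft \<Rightarrow> nat list \<Rightarrow> nat list" where
  "fn T u = (THE z. nft_rel T u z)"

lemma fn_eq: "functional_nft T \<Longrightarrow> nft_rel T u z \<Longrightarrow> fn T u = z"
  unfolding fn_def functional_nft_def by blast

lemma nft_rel_iff_fn: "functional_nft T \<Longrightarrow> nft_rel T u z \<longleftrightarrow> u \<in> dm T \<and> z = fn T u"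
  using fn_eq unfolding dm_def by blast

lemma dm_append: "u @ v \<in> dm T \<longleftrightarrow> (\<exists>p x y. acc T u p x \<and> coacc T p v y)"
  unfolding dm_def mem_Collect_eq nft_rel_append by blast

lemma fn_append: "functional_nft T \<Longrightarrow> acc T u p x \<Longrightarrow> coacc T p v y \<Longrightarrow> fn T (u @ v) = x @ y"
  by (rule fn_eq) (auto simp: nft_rel_append)

lemma dm_mirror: "rev u \<in> dm (mirror T) \<longleftrightarrow> u \<in> dm T"
  by (simp add: dm_def) (metis nft_rel_mirror rev_rev_ident)

lemma dm_mirror': "u @ v \<in> dm (mirror T) \<longleftrightarrow> rev v @ rev u \<in> dm T"
  using dm_mirror[of "rev v @ rev u" T] by simp

lemma fn_mirror:
  assumes "functional_nft T" "u \<in> dm T" shows "fn (mirror T) (rev u) = rev (fn T u)"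
  using assms by (meson fn_eq functional_mirror nft_rel_iff_fn nft_rel_mirror)

lemma fn_mirror':
  assumes "functional_nft T" "rev v @ rev u \<in> dm T"
  shows "fn (mirror T) (u @ v) = rev (fn T (rev v @ rev u))"
  using fn_mirror[OF assms] by simp

lemma dm_words: "wf_nft T \<Longrightarrow> u \<in> dm T \<Longrightarrow> u \<in> words (alph T)"
  unfolding dm_def using nft_rel_wf by blast

section \<open>Runs as explicit sequences of states and outputs\<close>

fun path :: "nft \<Rightarrow> nat \<Rightarrow> nat list \<Rightarrow> (nat \<times> nat list) list \<Rightarrow> bool" where
  "path T p [] rs \<longleftrightarrow> rs = []"
| "path T p (a # u) rs \<longleftrightarrow> (\<exists>r x rs'. rs = (r, x) # rs' \<and> (p, a, r, x) \<in> set (trans T) \<and> path T r u rs')"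

definition endst :: "nat \<Rightarrow> (nat \<times> nat list) list \<Rightarrow> nat" where
  "endst p rs = last (p # map fst rs)"

lemma endst_simps [simp]: "endst p [] = p" "endst p (z # rs) = endst (fst z) rs"
  by (auto simp: endst_def)

lemma endst_append: "endst p (rs @ rs') = endst (endst p rs) rs'"
  by (induction rs arbitrary: p) auto

lemma path_length: "path T p u rs \<Longrightarrow> length rs = length u"
  by (induction u arbitrary: p rs) auto

lemma path_append_iff:
  "path T p (u @ v) rs \<longleftrightarrow> (\<exists>rs1 rs2. rs = rs1 @ rs2 \<and> path T p u rs1 \<and> path T (endst p rs1) v rs2)"
proof (induction u arbitrary: p rs)
  case (Cons a u)
  show ?case
    by (auto simp: Cons) (metis append_Cons endst_simps(2) fst_conv, metis)
qed simp

lemma nft_run_iff_path: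
  "nft_run T p u w q \<longleftrightarrow> (\<exists>rs. path T p u rs \<and> q = endst p rs \<and> w = concat (map snd rs))"
proof (induction u arbitrary: p w)
  case (Cons a u)
  show ?case unfolding nft_run_Cons_iff Cons by (auto, force+)
qed auto

lemma path_split:
  assumes "path T p u rs" "j \<le> length u"
  shows "path T p (take j u) (take j rs) \<and> path T (endst p (take j rs)) (drop j u) (drop j rs)"
proof -
  have "path T p (take j u @ drop j u) rs" using assms by simp
  then obtain rs1 rs2 where "rs = rs1 @ rs2" "path T p (take j u) rs1" "path T (endst p rs1) (drop j u) rs2"
    unfolding path_append_iff by blast
  with path_length[of T p "take j u" rs1] assms(2) show ?thesis by auto
qed

lemma acc_path:
  assumes "acc T u p x"
  obtains q s where "q (length u) = p"
    "\<And>j. j \<le> length u \<Longrightarrow> acc T (take j u) (q j) (s 0 j)"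
    "\<And>i j. i \<le> j \<Longrightarrow> j \<le> length u \<Longrightarrow> nft_run T (q i) (take (j - i) (drop i u)) (s (Suc i) j) (q j)"
    "\<And>i j. i \<le> j \<Longrightarrow> j \<le> length u \<Longrightarrow> s 0 j = s 0 i @ s (Suc i) j" "s 0 (length u) = x"
proof -
  obtain q0 i0 rs where 1: "(q0, i0) \<in> set (iout T)" "path T q0 u rs" "p = endst q0 rs"
    "x = i0 @ concat (map snd rs)"
    using assms unfolding acc_def nft_run_iff_path by blast
  define q where "q j = endst q0 (take j rs)" for j
  define s where "s i j = (case i of 0 \<Rightarrow> i0 @ concat (map snd (take j rs))
    | Suc i \<Rightarrow> concat (map snd (take (j - i) (drop i rs))))" for i j
  note len = path_length[OF 1(2)]
  show ?thesis
  proof (rule that[of q s])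
    show "q (length u) = p" using 1 len by (simp add: q_def)
    show "s 0 (length u) = x" using 1 len by (simp add: s_def)
    show "acc T (take j u) (q j) (s 0 j)" if "j \<le> length u" for j
      unfolding acc_def nft_run_iff_path using path_split[OF 1(2) that] 1(1)
      by (auto simp: s_def q_def)
    fix i j assume ij: "i \<le> j" "j \<le> length u"
    have "take j rs = take i rs @ take (j - i) (drop i rs)"
      using ij by (metis le_add_diff_inverse take_add)
    then have tk: "take j rs = take i rs @ take (j - i) (drop i rs)" .
    then show "s 0 j = s 0 i @ s (Suc i) j" by (simp add: s_def)
    have "path T (q i) (drop i u) (drop i rs)"
      using path_split[OF 1(2), of i] ij by (simp add: q_def)
    then have "path T (q i) (take (j - i) (drop i u)) (take (j - i) (drop i rs))"
      using path_split[of T "q i" "drop i u" "drop i rs" "j - i"] ij by simp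
    moreover have "q j = endst (q i) (take (j - i) (drop i rs))"
      by (simp add: q_def tk endst_append)
    ultimately show "nft_run T (q i) (take (j - i) (drop i u)) (s (Suc i) j) (q j)"
      unfolding nft_run_iff_path s_def by auto
  qed
qed

section \<open>Compatible pairs of congruences\<close>

text \<open>If \<open>L\<close> and \<open>R\<close> are reflexive, \<open>u @ v\<close> in the
  domain forces the mixed words \<open>u @ v'\<close> and \<open>u' @ v\<close> into it, so
  \<open>fn\<close> is only evaluated where it is specified. Arbitrary relations are allowed so that
  restrictions to short words are covered as well.\<close>

definition compat :: "nft \<Rightarrow> (nat list \<times> nat list) set \<Rightarrow> (nat list \<times> nat list) set \<Rightarrow> bool" where
  "compat T L R \<longleftrightarrow> (\<forall>(u, u')\<in>L. \<forall>(v, v')\<in>R. u @ v \<in> dm T \<longrightarrow> u' @ v' \<in> dm T \<and>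
     minor (fn T (u @ v)) (fn T (u @ v')) (fn T (u' @ v)) (fn T (u' @ v')))"

lemma compatD:
  assumes "compat T L R" "(u, u') \<in> L" "(v, v') \<in> R" "u @ v \<in> dm T"
  shows "u' @ v' \<in> dm T"
    "minor (fn T (u @ v)) (fn T (u @ v')) (fn T (u' @ v)) (fn T (u' @ v'))"
  using assms unfolding compat_def by blast+

lemma compat_mono: "compat T L R \<Longrightarrow> L' \<subseteq> L \<Longrightarrow> R' \<subseteq> R \<Longrightarrow> compat T L' R'"
  unfolding compat_def by blast

lemma compat_cong: "nft_rel T = nft_rel T' \<Longrightarrow> compat T = compat T'"
  by (simp add: compat_def dm_def fn_def fun_eq_iff)

lemma tm_nft_run:
  assumes "wf_nft T" "tm T u = tm T u'" "nft_run T p u w q" "p < nstates T"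
  shows "\<exists>w'. nft_run T p u' w' q"
proof -
  have "(p, q) \<in> tm T u" 
    using assms(3,4) nft_run_wf(3)[OF assms(3,1)] by (auto simp: tm_def reach_def)
  then have "(p, q) \<in> tm T u'" using assms(2) by simp
  then show ?thesis unfolding tm_def reach_def by auto
qed

text \<open>Let the run on \<open>u @ v\<close> be in \<open>p\<close> at the cut. Then
  \<open>u'\<close> also leads to \<open>p\<close> and \<open>v'\<close> is also accepted from
  \<open>p\<close>, with outputs \<open>x'\<close> and \<open>y'\<close>; functionality makes the
  four values \<open>x @ y\<close>, \<open>x @ y'\<close>, \<open>x' @ y\<close>,
  \<open>x' @ y'\<close>.\<close>

lemma compat_tm:
  assumes "wf_nft T" "functional_nft T"
  shows "compat T {(u, u'). tm T u = tm T u'} {(u, u'). tm T u = tm T u'}"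
  unfolding compat_def
proof clarsimp
  fix u u' v v' assume tm: "tm T u = tm T u'" "tm T v = tm T v'" and "u @ v \<in> dm T"
  then obtain p x y where 1: "acc T u p x" "coacc T p v y" unfolding dm_append by blast
  obtain x' where 2: "acc T u' p x'"
  proof -
    from 1(1) obtain q0 i w where "(q0, i) \<in> set (iout T)" "nft_run T q0 u w p" unfolding acc_def by blast
    moreover from this have "q0 < nstates T" using assms(1) unfolding wf_nft_def by auto
    ultimately show ?thesis using that tm_nft_run[OF assms(1) tm(1)] unfolding acc_def by blast
  qed
  obtain y' where 3: "coacc T p v' y'"
    using 1(2) tm_nft_run[OF assms(1) tm(2)] acc_wf(2)[OF assms(1) 1(1)] unfolding coacc_def by blast
  show "u' @ v' \<in> dm T \<and> minor (fn T (u @ v)) (fn T (u @ v')) (fn T (u' @ v)) (fn T (u' @ v'))"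
    using 1 2 3 fn_append[OF assms(2)] minorI by (auto simp: dm_append)
qed

definition mirror_rel :: "(nat list \<times> nat list) set \<Rightarrow> (nat list \<times> nat list) set" where
  "mirror_rel R = {(u, v). (rev u, rev v) \<in> R}"

lemma mirror_rel_mirror_rel [simp]: "mirror_rel (mirror_rel R) = R"
  by (auto simp: mirror_rel_def)

text \<open>The reflexivity assumptions put all four words into the domain, where \<open>fn\<close>
  of the mirrored transducer is the reversed value.\<close>

lemma compat_mirror:
  assumes "functional_nft T" "compat T L R"
    and "\<And>u u'. (u, u') \<in> L \<Longrightarrow> (u, u) \<in> L" "\<And>v v'. (v, v') \<in> R \<Longrightarrow> (v, v) \<in> R"
  shows "compat (mirror T) (mirror_rel R) (mirror_rel L)"
  unfolding compat_def
proof (clarsimp simp: mirror_rel_def dm_mirror')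
  fix v v' u u'
  assume R: "(rev v, rev v') \<in> R" and L: "(rev u, rev u') \<in> L" and d: "rev u @ rev v \<in> dm T"
  have "(rev u, rev u) \<in> L" "(rev v, rev v) \<in> R" using assms(3,4) L R by blast+
  with compatD[OF assms(2)] R L d
  have "rev u' @ rev v' \<in> dm T" "rev u' @ rev v \<in> dm T" "rev u @ rev v' \<in> dm T"
    "minor (fn T (rev u @ rev v)) (fn T (rev u @ rev v')) (fn T (rev u' @ rev v)) (fn T (rev u' @ rev v'))"
    by blast+
  then show "rev u' @ rev v' \<in> dm T \<and> minor (fn (mirror T) (v @ u)) (fn (mirror T) (v @ u'))
     (fn (mirror T) (v' @ u)) (fn (mirror T) (v' @ u'))"
    using d by (simp add: fn_mirror'[OF assms(1)] minor_rev)
qed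

section \<open>Pumping\<close>

text \<open>The two runs in parallel visit \<open>length u + 1\<close> pairs of states, more than
  there are pairs, so some pair recurs.\<close>

lemma pair_loop:
  assumes wf: "wf_nft T" and "acc T u p x" "acc T u p' x'" and len: "nstates T * nstates T \<le> length u"
  obtains u1 u2 u3 q q' x1 a x3 x1' a' x3'
  where "u = u1 @ u2 @ u3" "u2 \<noteq> []"
    "acc T u1 q x1" "nft_run T q u2 a q" "nft_run T q u3 x3 p" "x = x1 @ a @ x3"
    "acc T u1 q' x1'" "nft_run T q' u2 a' q'" "nft_run T q' u3 x3' p'" "x' = x1' @ a' @ x3'"
proof -
  obtain q s where q: "q (length u) = p"
    "\<And>j. j \<le> length u \<Longrightarrow> acc T (take j u) (q j) (s 0 j)"
    "\<And>i j. i \<le> j \<Longrightarrow> j \<le> length u \<Longrightarrow> nft_run T (q i) (take (j - i) (drop i u)) (s (Suc i) j) (q j)"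
    "\<And>i j. i \<le> j \<Longrightarrow> j \<le> length u \<Longrightarrow> s 0 j = s 0 i @ s (Suc i) j" "s 0 (length u) = x"
    using acc_path[OF assms(2)] by metis
  obtain q' s' where q': "q' (length u) = p'"
    "\<And>j. j \<le> length u \<Longrightarrow> acc T (take j u) (q' j) (s' 0 j)"
    "\<And>i j. i \<le> j \<Longrightarrow> j \<le> length u \<Longrightarrow> nft_run T (q' i) (take (j - i) (drop i u)) (s' (Suc i) j) (q' j)"
    "\<And>i j. i \<le> j \<Longrightarrow> j \<le> length u \<Longrightarrow> s' 0 j = s' 0 i @ s' (Suc i) j" "s' 0 (length u) = x'"
    using acc_path[OF assms(3)] by metis
  let ?n = "nstates T"
  have "(\<lambda>j. (q j, q' j)) ` {..length u} \<subseteq> {..<?n} \<times> {..<?n}"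
    using acc_wf(2)[OF wf q(2)] acc_wf(2)[OF wf q'(2)] by auto
  then have "card ((\<lambda>j. (q j, q' j)) ` {..length u}) \<le> card ({..<?n} \<times> {..<?n})"
    by (intro card_mono) auto
  also have "\<dots> < card {..length u}" using len by simp
  finally have "\<not> inj_on (\<lambda>j. (q j, q' j)) {..length u}" by (rule pigeonhole)
  then obtain i j where "i \<le> length u" "j \<le> length u" "i \<noteq> j" "q i = q j" "q' i = q' j"
    by (auto simp: inj_on_def)
  then obtain i j where ij: "i < j" "j \<le> length u" "q i = q j" "q' i = q' j"
    by (metis linorder_neq_iff)
  have u: "u = take i u @ take (j - i) (drop i u) @ drop j u"
    using ij by (metis append_assoc append_take_drop_id le_add_diff_inverse less_imp_le take_add)
  show ?thesis
  proof (rule that[OF u, of "q i" "s 0 i" "s (Suc i) j" "s (Suc j) (length u)"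
        "q' i" "s' 0 i" "s' (Suc i) j" "s' (Suc j) (length u)"])
    show "take (j - i) (drop i u) \<noteq> []" using ij by simp
    show "x = s 0 i @ s (Suc i) j @ s (Suc j) (length u)"
      using q(4)[of j "length u"] q(4)[of i j] q(5) ij by simp
    show "x' = s' 0 i @ s' (Suc i) j @ s' (Suc j) (length u)"
      using q'(4)[of j "length u"] q'(4)[of i j] q'(5) ij by simp
  qed (use ij q(1) q(2)[of i] q(3)[of i j] q(3)[of j "length u"]
      q'(1) q'(2)[of i] q'(3)[of i j] q'(3)[of j "length u"] in auto)
qed

lemma nft_run_wpow: "nft_run T q u x q \<Longrightarrow> nft_run T q (wpow u i) (wpow x i) q"
  by (induction i) (auto simp: nft_run_append)

text \<open>
  Finite index of \<open>L\<close> makes two powers of the loop equivalent, so that some power of the loop preserves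
  the delay; roots in free groups are unique, hence so does the loop itself.
\<close>

lemma loop_keeps_delay:
  assumes wf: "wf_nft T" and fu: "functional_nft T"
    and L: "equiv (words (alph T)) L" "finite (words (alph T) // L)"
    and c: "compat T L R" and vv: "(v, v') \<in> R"
    and 1: "acc T u1 q x1" "nft_run T q u2 a q" "nft_run T q u3 x3 p" "coacc T p v y"
    and 2: "acc T u1 q' x1'" "nft_run T q' u2 a' q'" "nft_run T q' u3 x3' p'" "coacc T p' v' y'"
  shows "minor x1 x1' (x1 @ a) (x1' @ a')"
proof -
  define w where "w i = u1 @ wpow u2 i @ u3" for i
  have ac: "acc T (w i) p (x1 @ wpow a i @ x3)" "acc T (w i) p' (x1' @ wpow a' i @ x3')" for i
    unfolding w_def acc_append nft_run_append using nft_run_wpow 1 2 by blast+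
  have W: "w i \<in> words (alph T)" for i using acc_wf(1)[OF wf ac(1)] .
  have "(\<lambda>i. L `` {w i}) ` UNIV \<subseteq> words (alph T) // L" using W by (auto intro: quotientI)
  then have "finite (range (\<lambda>i. L `` {w i}))" using L(2) by (rule finite_subset)
  then have "\<not> inj (\<lambda>i. L `` {w i})" using finite_imageD infinite_UNIV_nat by blast
  then obtain i j where "i \<noteq> j" "L `` {w i} = L `` {w j}" by (auto simp: inj_on_def)
  then obtain i j where "i < j" "L `` {w i} = L `` {w j}" by (metis linorder_neq_iff)
  moreover obtain d where "j = i + d" "0 < d" using \<open>i < j\<close> less_imp_add_positive by blast
  ultimately have d: "0 < d" and Lw: "(w i, w (i + d)) \<in> L"
    using eq_equiv_class[OF _ L(1)] W by auto
  have "w i @ v \<in> dm T" using ac(1) 1(4) dm_append by blast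
  from compatD(2)[OF c Lw vv this]
  have "minor (x1 @ wpow a i @ x3 @ y) (x1' @ wpow a' i @ x3' @ y')
     (x1 @ wpow a (i + d) @ x3 @ y) (x1' @ wpow a' (i + d) @ x3' @ y')"
    using fn_append[OF fu ac(1) 1(4)] fn_append[OF fu ac(2) 2(4)] by simp
  then have "minor (x1 @ wpow a i) (x1' @ wpow a' i) (x1 @ wpow a (i + d)) (x1' @ wpow a' (i + d))"
    using minor_cancel[of "x1 @ wpow a i" "x3 @ y" "x1' @ wpow a' i" "x3' @ y'"
        "x1 @ wpow a (i + d)" "x1' @ wpow a' (i + d)"] by simp
  then show ?thesis using d by (rule minor_root)
qed

text \<open>By \<open>loop_keeps_delay\<close> the common loop of two long runs can be cut out
  without changing the delay. The resulting length bound involves neither \<open>L\<close> nor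
  \<open>R\<close>.\<close>

lemma short_delay:
  assumes wf: "wf_nft T" and fu: "functional_nft T"
    and L: "equiv (words (alph T)) L" "finite (words (alph T) // L)"
    and c: "compat T L R" and vv: "(v, v') \<in> R" and co: "coacc T p v y" "coacc T p' v' y'"
  shows "acc T u p x \<Longrightarrow> acc T u p' x' \<Longrightarrow> \<exists>w z z'. length w \<le> nstates T * nstates T
     \<and> acc T w p z \<and> acc T w p' z' \<and> minor x x' z z'"
proof (induction u arbitrary: x x' rule: length_induct)
  case (1 u)
  show ?case
  proof (cases "length u \<le> nstates T * nstates T")
    case True
    then show ?thesis using 1 minor_refl by blast
  next
    case False
    then have le: "nstates T * nstates T \<le> length u" by simp
    obtain u1 u2 u3 q q' x1 a x3 x1' a' x3' where u: "u = u1 @ u2 @ u3" "u2 \<noteq> []"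
      and 2: "acc T u1 q x1" "nft_run T q u2 a q" "nft_run T q u3 x3 p" "x = x1 @ a @ x3"
      and 3: "acc T u1 q' x1'" "nft_run T q' u2 a' q'" "nft_run T q' u3 x3' p'" "x' = x1' @ a' @ x3'"
      by (rule pair_loop[OF wf "1.prems" le])
    have "minor x1 x1' (x1 @ a) (x1' @ a')"
      by (rule loop_keeps_delay[OF wf fu L c vv 2(1-3) co(1) 3(1-3) co(2)])
    then have m: "minor x x' (x1 @ x3) (x1' @ x3')"
      using minor_append[OF minor_sym, of x1 x1' "x1 @ a" "x1' @ a'" x3 x3'] 2 3 by simp
    have "acc T (u1 @ u3) p (x1 @ x3)" "acc T (u1 @ u3) p' (x1' @ x3')"
      unfolding acc_append using 2 3 by blast+
    moreover have "length (u1 @ u3) < length u" using u by simp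
    ultimately obtain w z z' where "length w \<le> nstates T * nstates T" "acc T w p z" "acc T w p' z'"
      "minor (x1 @ x3) (x1' @ x3') z z'" using "1.IH" by blast
    then show ?thesis using minor_trans[OF m] by blast
  qed
qed

section \<open>The coarsest congruence on prefixes\<close>

text \<open>For an equivalence \<open>R\<close>: on each class of \<open>R\<close>, the rows of
  values of \<open>u\<close> and \<open>u'\<close> have the same support and differ by a constant
  left factor in the free group.\<close>

definition lcoarse :: "nft \<Rightarrow> (nat list \<times> nat list) set \<Rightarrow> (nat list \<times> nat list) set" where
  "lcoarse T R = {(u, u'). u \<in> words (alph T) \<and> u' \<in> words (alph T) \<and> (\<forall>(v, v')\<in>R.
     (u @ v \<in> dm T \<longleftrightarrow> u' @ v \<in> dm T) \<and> (u @ v \<in> dm T \<longrightarrow>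
     minor (fn T (u @ v)) (fn T (u @ v')) (fn T (u' @ v)) (fn T (u' @ v'))))}"

lemma lcoarseD:
  assumes "(u, u') \<in> lcoarse T R" "(v, v') \<in> R"
  shows "u @ v \<in> dm T \<longleftrightarrow> u' @ v \<in> dm T"
    "u @ v \<in> dm T \<Longrightarrow> minor (fn T (u @ v)) (fn T (u @ v')) (fn T (u' @ v)) (fn T (u' @ v'))"
  using assms unfolding lcoarse_def by auto

lemma equiv_lcoarse: "equiv (words (alph T)) (lcoarse T R)"
proof (rule equivI)
  show "sym (lcoarse T R)"
    unfolding sym_def lcoarse_def by (auto intro: minor_sym)
  show "Relation.trans (lcoarse T R)"
    unfolding Relation.trans_def lcoarse_def by (auto 0 4 intro: minor_trans)
qed (auto simp: lcoarse_def refl_on_def)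

text \<open>Testing \<open>u @ w\<close> against \<open>v\<close>, \<open>v'\<close> is testing
  \<open>u\<close> against \<open>w @ v\<close>, \<open>w @ v'\<close>; so closure of
  \<open>R\<close> under prepending becomes closure of \<open>lcoarse T R\<close> under
  appending.\<close>

lemma lcoarse_append:
  assumes "\<And>v v' w. (v, v') \<in> R \<Longrightarrow> w \<in> words (alph T) \<Longrightarrow> (w @ v, w @ v') \<in> R"
    and "(u, u') \<in> lcoarse T R" "w \<in> words (alph T)"
  shows "(u @ w, u' @ w) \<in> lcoarse T R"
proof -
  have "u \<in> words (alph T)" "u' \<in> words (alph T)" using assms(2) by (auto simp: lcoarse_def)
  then show ?thesis
    using lcoarseD[OF assms(2) assms(1)[OF _ assms(3)]] assms(3) by (auto simp: lcoarse_def)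
qed

text \<open>\<open>lcoarse\<close> compares domains only for a fixed suffix. Passing from
  \<open>u' @ v\<close> to \<open>u' @ v'\<close> uses that \<open>R\<close> is already compatible
  with some reflexive \<open>L\<close>.\<close>

lemma compat_lcoarse:
  assumes "compat T L R" "equiv (words (alph T)) L"
  shows "compat T (lcoarse T R) R"
proof -
  have "u' @ v' \<in> dm T" if "(u, u') \<in> lcoarse T R" "(v, v') \<in> R" "u @ v \<in> dm T" for u u' v v'
  proof (rule compatD(1)[OF assms(1) _ that(2)])
    show "(u', u') \<in> L" using that(1) assms(2) by (auto simp: lcoarse_def equiv_def refl_on_def)
  qed (use lcoarseD(1)[OF that(1,2)] that(3) in simp)
  then show ?thesis unfolding compat_def using lcoarseD(2) by blast
qed

lemma subset_lcoarse:
  assumes "compat T L R" "equiv (words (alph T)) L" "equiv (words (alph T)) R"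
  shows "L \<subseteq> lcoarse T R"
proof clarify
  fix u u' assume uu: "(u, u') \<in> L"
  then have "(u', u) \<in> L" using assms(2) by (auto simp: equiv_def dest: symD)
  moreover have "(v, v) \<in> R" if "(v, v') \<in> R" for v v'
    using that assms(3) by (auto simp: equiv_def refl_on_def)
  ultimately have "u @ v \<in> dm T \<longleftrightarrow> u' @ v \<in> dm T" if "(v, v') \<in> R" for v v'
    using compatD(1)[OF assms(1)] uu that by blast
  then show "(u, u') \<in> lcoarse T R"
    unfolding lcoarse_def using uu assms(2) compatD(2)[OF assms(1) uu] by (auto simp: equiv_def)
qed

text \<open>\<open>g\<close> may be finer than \<open>r\<close>: equal values imply equivalence, but
  a class may have several values. Each class is therefore recovered from any one of them.\<close>

lemma card_quotient_le:
  assumes eq: "equiv A r" and G: "g ` A \<subseteq> G" "finite G"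
    and g: "\<And>u u'. u \<in> A \<Longrightarrow> u' \<in> A \<Longrightarrow> g u = g u' \<Longrightarrow> (u, u') \<in> r"
  shows "finite (A // r)" "card (A // r) \<le> card G"
proof -
  have fin: "finite (g ` A)" using G finite_subset by blast
  have sub: "A // r \<subseteq> (\<lambda>c. r `` {inv_into A g c}) ` (g ` A)"
  proof
    fix X assume "X \<in> A // r"
    then obtain u where u: "u \<in> A" "X = r `` {u}" by (rule quotientE)
    then have "(inv_into A g (g u), u) \<in> r"
      by (intro g) (auto intro: inv_into_into f_inv_into_f)
    then show "X \<in> (\<lambda>c. r `` {inv_into A g c}) ` (g ` A)"
      using u equiv_class_eq[OF eq] by blast
  qed
  show "finite (A // r)" using finite_subset[OF sub] fin by simp
  have "card (A // r) \<le> card ((\<lambda>c. r `` {inv_into A g c}) ` (g ` A))"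
    using card_mono[OF _ sub] fin by simp
  also have "\<dots> \<le> card (g ` A)" using card_image_le[OF fin] .
  also have "\<dots> \<le> card G" using card_mono[OF G(2,1)] .
  finally show "card (A // r) \<le> card G" .
qed

definition short :: "nat \<Rightarrow> nat \<Rightarrow> nat list set" where
  "short k B = {w \<in> words k. length w \<le> B}"

lemma finite_short: "finite (short k B)"
  unfolding short_def words_def by (rule finite_subset[OF _ finite_lists_length_le[of "{..<k}" B]]) auto

text \<open>
  A class of \<^term>\<open>lcoarse T R\<close> is determined by the set of states reached and, for each pair of
  states, a short word with the same delay.
\<close>

definition lbound :: "nft \<Rightarrow> nat" where
  "lbound T = 2 ^ nstates T * card (short (alph T) (nstates T * nstates T)) ^ (nstates T * nstates T)"

lemma lbound_mirror [simp]: "lbound (mirror T) = lbound T"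
  by (simp add: lbound_def)

lemma acc_unique:
  assumes "functional_nft T" "acc T u p x" "acc T u p x'" "coacc T p v y"
  shows "x = x'"
  using fn_append[OF assms(1,2,4)] fn_append[OF assms(1,3,4)] by simp

lemma lcoarse_index:
  assumes wf: "wf_nft T" and fu: "functional_nft T"
    and L: "equiv (words (alph T)) L" "finite (words (alph T) // L)" and c: "compat T L R"
  shows "finite (words (alph T) // lcoarse T R)" "card (words (alph T) // lcoarse T R) \<le> lbound T"
proof -
  let ?n = "nstates T" and ?W = "words (alph T)"
  let ?S = "short (alph T) (?n * ?n)"
  define valid where "valid u p p' w \<longleftrightarrow> w \<in> ?S \<and> (\<exists>x x' z z'. acc T u p x \<and> acc T u p' x'
    \<and> acc T w p z \<and> acc T w p' z' \<and> minor x x' z z')" for u p p' w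
  \<comment> \<open>\<open>pick u\<close> chooses from the valid words alone, so equal picks for
    \<open>u\<close> and \<open>u'\<close> yield one short word with the delay of both. The default
    \<open>[]\<close> serves pairs of states without a valid word.\<close>
  define pick where "pick u = restrict (\<lambda>(p, p').
    if \<exists>w. valid u p p' w then SOME w. valid u p p' w else []) ({..<?n} \<times> {..<?n})" for u
  define g where "g u = ({p. \<exists>x. acc T u p x}, pick u)" for u
  define G where "G = Pow {..<?n} \<times> (({..<?n} \<times> {..<?n}) \<rightarrow>\<^sub>E ?S)"
  have "[] \<in> ?S" by (simp add: short_def)
  moreover have "(SOME w. valid u p p' w) \<in> ?S" if "\<exists>w. valid u p p' w" for u p p'
    using someI_ex[OF that] by (simp only: valid_def)
  ultimately have "pick u \<in> ({..<?n} \<times> {..<?n}) \<rightarrow>\<^sub>E ?S" for u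
    unfolding pick_def by auto
  then have gG: "g ` ?W \<subseteq> G"
    unfolding g_def G_def using acc_wf(2)[OF wf] by auto
  have fG: "finite G" unfolding G_def by (intro finite_cartesian_product finite_PiE finite_short) auto
  have card: "card G = lbound T"
    unfolding G_def lbound_def using finite_short
    by (simp add: card_cartesian_product card_Pow card_PiE)
  have key: "(u, u') \<in> lcoarse T R" if W: "u \<in> ?W" "u' \<in> ?W" and guu: "g u = g u'" for u u'
  proof -
    have ac: "(\<exists>x. acc T u p x) \<longleftrightarrow> (\<exists>x. acc T u' p x)" for p using guu by (auto simp: g_def)
    have pick: "pick u = pick u'" using guu by (simp add: g_def)
    have "minor (fn T (u @ v)) (fn T (u @ v')) (fn T (u' @ v)) (fn T (u' @ v'))"
      if vv: "(v, v') \<in> R" and d: "u @ v \<in> dm T" for v v'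
    proof -
      have "u @ v' \<in> dm T"
        using compatD(1)[OF c _ vv d, of u] W L(1) by (auto simp: equiv_def refl_on_def)
      with d obtain p x y p' x' y' where 1: "acc T u p x" "coacc T p v y" "acc T u p' x'" "coacc T p' v' y'"
        unfolding dm_append by blast
      obtain z z' where 2: "acc T u' p z" "acc T u' p' z'" using ac 1 by blast
      have pp: "(p, p') \<in> {..<?n} \<times> {..<?n}" using 1 acc_wf(2)[OF wf] by auto
      have ex: "\<exists>w. valid u p p' w" if "acc T u p x" "acc T u p' x'" for u x x'
        using short_delay[OF wf fu L c vv 1(2,4) that] acc_wf(1)[OF wf] that
        unfolding valid_def short_def by blast
      define w where "w = pick u (p, p')"
      have "valid u p p' w" using someI_ex[OF ex[OF 1(1,3)]] ex[OF 1(1,3)] pp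
        unfolding w_def pick_def by simp
      moreover have "valid u' p p' w" using someI_ex[OF ex[OF 2]] ex[OF 2] pp
        unfolding w_def pick unfolding pick_def by simp
      \<comment> \<open>\<open>p\<close> and \<open>p'\<close> accept \<open>v\<close> and
        \<open>v'\<close>, so by \<open>acc_unique\<close> the outputs hidden in the two instances
        of \<open>valid\<close> coincide on \<open>w\<close>, \<open>u\<close> and
        \<open>u'\<close>.\<close>
      ultimately obtain a a' where 3: "minor x x' a a'" "minor z z' a a'"
        unfolding valid_def using acc_unique[OF fu _ _ 1(2)] acc_unique[OF fu _ _ 1(4)] 1 2 by metis
      have "minor x x' z z'" using minor_trans[OF 3(1) minor_sym[OF 3(2)]] .
      then show ?thesis
        by (simp add: fn_append[OF fu 1(1,2)] fn_append[OF fu 1(3,4)] fn_append[OF fu 2(1) 1(2)]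
            fn_append[OF fu 2(2) 1(4)] minor_append)
    qed
    moreover have "u @ v \<in> dm T \<longleftrightarrow> u' @ v \<in> dm T" for v unfolding dm_append using ac by blast
    ultimately show ?thesis using W unfolding lcoarse_def by blast
  qed
  note q = card_quotient_le[OF equiv_lcoarse gG fG]
  show "finite (?W // lcoarse T R)" by (rule q(1)) (rule key)
  show "card (?W // lcoarse T R) \<le> lbound T" unfolding card[symmetric] by (rule q(2)) (rule key)
qed

section \<open>A compatible congruence of bounded index\<close>

definition congruence_on :: "nat list set \<Rightarrow> (nat list \<times> nat list) set \<Rightarrow> bool" where
  "congruence_on W E \<longleftrightarrow> equiv W E \<and> (\<forall>(u, u')\<in>E. \<forall>x\<in>W. (x @ u, x @ u') \<in> E \<and> (u @ x, u' @ x) \<in> E)"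

lemma equiv_mirror_rel: "equiv (words k) R \<Longrightarrow> equiv (words k) (mirror_rel R)"
proof -
  assume R: "equiv (words k) R"
  show ?thesis
  proof (rule equivI)
    have "u \<in> words k" if "(rev u, v) \<in> R \<or> (v, rev u) \<in> R" for u v
      using R that words_rev unfolding equiv_def by blast
    then show "mirror_rel R \<subseteq> words k \<times> words k" by (auto simp: mirror_rel_def)
    show "refl_on (words k) (mirror_rel R)" using R by (simp add: mirror_rel_def equiv_def refl_on_def)
    show "sym (mirror_rel R)" using R unfolding equiv_def mirror_rel_def by (auto intro!: symI dest: symD)
    show "Relation.trans (mirror_rel R)"
      using R unfolding equiv_def mirror_rel_def by (auto intro!: transI dest: transD)
  qed
qed

lemma card_quotient_mirror_rel:
  assumes "equiv (words k) R" "finite (words k // R)"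
  shows "finite (words k // mirror_rel R)" "card (words k // mirror_rel R) \<le> card (words k // R)"
proof -
  have 1: "(\<lambda>u. R `` {rev u}) ` words k \<subseteq> words k // R" by (auto intro: quotientI)
  have 2: "(u, u') \<in> mirror_rel R" if "u \<in> words k" "u' \<in> words k" "R `` {rev u} = R `` {rev u'}" for u u'
    using eq_equiv_class[OF that(3) assms(1)] that(2) by (simp add: mirror_rel_def)
  note q = card_quotient_le[OF equiv_mirror_rel[OF assms(1)] 1 assms(2)]
  show "finite (words k // mirror_rel R)" by (rule q(1)) (rule 2)
  show "card (words k // mirror_rel R) \<le> card (words k // R)" by (rule q(2)) (rule 2)
qed

lemma bounded_congruence:
  assumes wf: "wf_nft T" and fu: "functional_nft T"
    and E0: "congruence_on (words (alph T)) E0" "finite (words (alph T) // E0)" and c: "compat T E0 E0"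
  obtains E where "congruence_on (words (alph T)) E" "E0 \<subseteq> E" "compat T E E"
    "finite (words (alph T) // E)" "card (words (alph T) // E) \<le> lbound T ^ (2 * lbound T)"
proof -
  let ?W = "words (alph T)"
  have eE0: "equiv ?W E0" using E0 by (simp add: congruence_on_def)
  have rE: "(u, u) \<in> R" if "equiv ?W R" "(u, u') \<in> R" for R u u'
    using that by (auto simp: equiv_def refl_on_def)
  define L where "L = lcoarse T E0"
  \<comment> \<open>The right side is coarsened against the already coarsened \<open>L\<close>, so
    that the final pair \<open>L\<close>, \<open>R\<close> is compatible as a pair.\<close>
  define Rm where "Rm = lcoarse (mirror T) (mirror_rel L)"
  define R where "R = mirror_rel Rm"
  have eL: "equiv ?W L" unfolding L_def by (rule equiv_lcoarse)
  have eRm: "equiv ?W Rm" unfolding Rm_def using equiv_lcoarse[of "mirror T"] by simp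
  have eR: "equiv ?W R" unfolding R_def by (rule equiv_mirror_rel[OF eRm])
  have emE0: "equiv ?W (mirror_rel E0)" and emL: "equiv ?W (mirror_rel L)"
    using equiv_mirror_rel eE0 eL by auto
  have L_cong: "(u @ w, u' @ w) \<in> L" if "(u, u') \<in> L" "w \<in> ?W" for u u' w
    using lcoarse_append[of E0 T] E0 that unfolding L_def congruence_on_def by blast
  have "(w @ v, w @ v') \<in> mirror_rel L" if "(v, v') \<in> mirror_rel L" "w \<in> ?W" for v v' w
    using L_cong that by (simp add: mirror_rel_def)
  then have Rm_cong: "(u @ w, u' @ w) \<in> Rm" if "(u, u') \<in> Rm" "w \<in> ?W" for u u' w
    using lcoarse_append[of "mirror_rel L" "mirror T"] that unfolding Rm_def by simp
  have R_cong: "(w @ v, w @ v') \<in> R" if "(v, v') \<in> R" "w \<in> ?W" for v v' w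
    using Rm_cong that by (simp add: R_def mirror_rel_def)
  have cL: "compat T L E0" unfolding L_def by (rule compat_lcoarse[OF c eE0])
  have cm: "compat (mirror T) (mirror_rel E0) (mirror_rel L)"
    by (rule compat_mirror[OF fu cL rE[OF eL] rE[OF eE0]])
  have cRm: "compat (mirror T) Rm (mirror_rel L)"
    unfolding Rm_def by (rule compat_lcoarse[OF cm]) (simp add: emE0)
  have cLR: "compat T L R"
    using compat_mirror[OF functional_mirror[OF fu] cRm rE[OF eRm] rE[OF emL]] by (simp add: R_def)
  have subL: "E0 \<subseteq> L" unfolding L_def by (rule subset_lcoarse[OF c eE0 eE0])
  have "mirror_rel E0 \<subseteq> Rm" unfolding Rm_def by (rule subset_lcoarse[OF cm]) (simp_all add: emE0 emL)
  then have subR: "E0 \<subseteq> R" unfolding R_def mirror_rel_def by fastforce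
  have nL: "finite (?W // L)" "card (?W // L) \<le> lbound T"
    using lcoarse_index[OF wf fu eE0 E0(2) c] by (auto simp: L_def)
  \<comment> \<open>\<open>E0\<close>, mirrored, supplies the finite-index partner that the pumping
    argument requires; its index does not enter the bound, and \<open>lbound\<close> is invariant
    under mirroring.\<close>
  have "finite (?W // Rm)" "card (?W // Rm) \<le> lbound T"
    using lcoarse_index[OF wf_mirror[OF wf] functional_mirror[OF fu], of "mirror_rel E0" "mirror_rel L"]
      card_quotient_mirror_rel[OF eE0 E0(2)] emE0 cm by (auto simp: Rm_def)
  then have nR: "finite (?W // R)" "card (?W // R) \<le> lbound T"
    using card_quotient_mirror_rel[OF eRm] by (auto simp: R_def)
  \<comment> \<open>The largest congruence contained in both \<open>L\<close> and
    \<open>R\<close>.\<close>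
  define E where "E = {(u, u'). u \<in> ?W \<and> u' \<in> ?W \<and> (\<forall>x\<in>?W. (x @ u, x @ u') \<in> L) \<and> (\<forall>x\<in>?W. (u @ x, u' @ x) \<in> R)}"
  have eE: "equiv ?W E"
  proof (rule equivI)
    show "refl_on ?W E" using eL eR by (auto simp: E_def refl_on_def equiv_def)
    show "sym E" using eL eR unfolding sym_def E_def by (auto simp: equiv_def dest: symD)
    show "Relation.trans E" using eL eR unfolding Relation.trans_def E_def
      by (auto simp: equiv_def dest: transD)
  qed (auto simp: E_def)
  have Ec: "(x @ u, x @ u') \<in> E \<and> (u @ x, u' @ x) \<in> E" if "(u, u') \<in> E" "x \<in> ?W" for u u' x
  proof -
    have W: "u \<in> ?W" "u' \<in> ?W" and EL: "\<And>x. x \<in> ?W \<Longrightarrow> (x @ u, x @ u') \<in> L"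
      and ER: "\<And>x. x \<in> ?W \<Longrightarrow> (u @ x, u' @ x) \<in> R" using that by (auto simp: E_def)
    have "(y @ x @ u, y @ x @ u') \<in> L" "((x @ u) @ y, (x @ u') @ y) \<in> R"
      "(y @ u @ x, y @ u' @ x) \<in> L" "((u @ x) @ y, (u' @ x) @ y) \<in> R" if "y \<in> ?W" for y
      using EL[of "y @ x"] R_cong[OF ER[OF that] \<open>x \<in> ?W\<close>] L_cong[OF EL[OF that] \<open>x \<in> ?W\<close>]
        ER[of "x @ y"] that \<open>x \<in> ?W\<close> by simp_all
    then show ?thesis using W that(2) unfolding E_def by simp
  qed
  have sub: "E0 \<subseteq> E"
  proof clarify
    fix u u' assume uu: "(u, u') \<in> E0"
    then have "u \<in> ?W" "u' \<in> ?W" using eE0 by (auto simp: equiv_def)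
    moreover have "(x @ u, x @ u') \<in> L" "(u @ x, u' @ x) \<in> R" if "x \<in> ?W" for x
      using E0(1) uu that subL subR unfolding congruence_on_def by blast+
    ultimately show "(u, u') \<in> E" unfolding E_def by simp
  qed
  have "(u, u') \<in> L \<and> (u, u') \<in> R" if "(u, u') \<in> E" for u u'
  proof -
    from that have "([] @ u, [] @ u') \<in> L" "(u @ [], u' @ []) \<in> R"
      unfolding E_def using words_simps(1) by blast+
    then show ?thesis by simp
  qed
  then have "E \<subseteq> L" "E \<subseteq> R" by auto
  then have cE: "compat T E E" by (rule compat_mono[OF cLR])
  let ?b = "lbound T"
  let ?rep = "\<lambda>c :: nat list set. SOME x. x \<in> c"
  have rep: "?rep c \<in> c" "?rep c \<in> ?W" if "c \<in> ?W // Q" "equiv ?W Q" for c Q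
  proof -
    from that have "c \<noteq> {}" "c \<subseteq> ?W" by (auto elim!: quotientE simp: equiv_def refl_on_def)
    then show "?rep c \<in> c" "?rep c \<in> ?W" using some_in_eq by blast+
  qed
  \<comment> \<open>A word acts on classes of \<open>L\<close> by appending and on classes of
    \<open>R\<close> by prepending; \<open>L_cong\<close> and \<open>R_cong\<close> make the choice
    of representatives harmless.\<close>
  define g where "g u = (restrict (\<lambda>c. L `` {?rep c @ u}) (?W // L), restrict (\<lambda>c. R `` {u @ ?rep c}) (?W // R))" for u
  define G where "G = ((?W // L) \<rightarrow>\<^sub>E (?W // L)) \<times> ((?W // R) \<rightarrow>\<^sub>E (?W // R))"
  have gG: "g ` ?W \<subseteq> G" unfolding g_def G_def using rep(2)[OF _ eL] rep(2)[OF _ eR]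
    by (auto intro!: quotientI)
  have fG: "finite G" unfolding G_def by (intro finite_cartesian_product finite_PiE nL nR)
  have key: "(u, u') \<in> E" if W: "u \<in> ?W" "u' \<in> ?W" and guu: "g u = g u'" for u u'
  proof -
    have "(x @ u, x @ u') \<in> L" if x: "x \<in> ?W" for x
    proof -
      let ?c = "L `` {x}"
      have c: "?c \<in> ?W // L" using x by (rule quotientI)
      from guu have "fst (g u) ?c = fst (g u') ?c" by simp
      then have "L `` {?rep ?c @ u} = L `` {?rep ?c @ u'}" by (simp only: g_def fst_conv restrict_apply' c)
      then have "(?rep ?c @ u, ?rep ?c @ u') \<in> L"
        by (rule eq_equiv_class[OF _ eL]) (use rep(2)[OF c eL] W in simp)
      moreover have "(x, ?rep ?c) \<in> L" using rep(1)[OF c eL] by simp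
      then have "(x @ u, ?rep ?c @ u) \<in> L" "(x @ u', ?rep ?c @ u') \<in> L" using L_cong W by blast+
      ultimately show ?thesis using eL unfolding equiv_def by (meson symD transD)
    qed
    moreover have "(u @ x, u' @ x) \<in> R" if x: "x \<in> ?W" for x
    proof -
      let ?c = "R `` {x}"
      have c: "?c \<in> ?W // R" using x by (rule quotientI)
      from guu have "snd (g u) ?c = snd (g u') ?c" by simp
      then have "R `` {u @ ?rep ?c} = R `` {u' @ ?rep ?c}" by (simp only: g_def snd_conv restrict_apply' c)
      then have "(u @ ?rep ?c, u' @ ?rep ?c) \<in> R"
        by (rule eq_equiv_class[OF _ eR]) (use rep(2)[OF c eR] W in simp)
      moreover have "(x, ?rep ?c) \<in> R" using rep(1)[OF c eR] by simp
      then have "(u @ x, u @ ?rep ?c) \<in> R" "(u' @ x, u' @ ?rep ?c) \<in> R" using R_cong W by blast+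
      ultimately show ?thesis using eR unfolding equiv_def by (meson symD transD)
    qed
    ultimately show ?thesis using W unfolding E_def by simp
  qed
  have pow: "m ^ m \<le> ?b ^ ?b" if "m \<le> ?b" for m
  proof (cases "?b = 0")
    case False
    then have "m ^ m \<le> ?b ^ m" "?b ^ m \<le> ?b ^ ?b" using that by (auto intro: power_mono power_increasing)
    then show ?thesis by linarith
  qed (use that in simp)
  have "card G \<le> ?b ^ ?b * ?b ^ ?b"
    unfolding G_def using nL nR pow by (simp add: card_cartesian_product card_PiE mult_le_mono)
  also have "\<dots> = ?b ^ (2 * ?b)" by (simp add: mult_2 power_add)
  finally have cG: "card G \<le> ?b ^ (2 * ?b)" .
  show ?thesis
  proof (rule that[of E])
    show "congruence_on ?W E" unfolding congruence_on_def using eE Ec by blast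
    note q = card_quotient_le[OF eE gG fG]
    show "finite (?W // E)" by (rule q(1)) (rule key)
    have "card (?W // E) \<le> card G" by (rule q(2)) (rule key)
    then show "card (?W // E) \<le> ?b ^ (2 * ?b)" using cG by simp
  qed (use sub cE in auto)
qed

section \<open>Quotient monoids\<close>

definition hom_on :: "nat list set \<Rightarrow> fmon \<Rightarrow> (nat list \<Rightarrow> nat) \<Rightarrow> bool" where
  "hom_on W M \<phi> \<longleftrightarrow> \<phi> ` W \<subseteq> {..<fsize M} \<and> \<phi> [] = funit M
     \<and> (\<forall>u\<in>W. \<forall>v\<in>W. \<phi> (u @ v) = fmul M (\<phi> u) (\<phi> v))"

lemma funit_eq: "is_unit M e \<Longrightarrow> funit M = e"
  unfolding funit_def by (rule some_equality) (auto simp: is_unit_def)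

text \<open>Every element of \<open>M\<close> is some \<open>\<phi> u\<close>, on which
  \<open>\<phi> []\<close> acts neutrally because \<open>[] @ u = u = u @ []\<close>.\<close>

lemma onto_hom:
  assumes "\<phi> ` words k = {..<fsize M}" "\<And>u v. u \<in> words k \<Longrightarrow> v \<in> words k \<Longrightarrow> \<phi> (u @ v) = fmul M (\<phi> u) (\<phi> v)"
  shows "hom_on (words k) M \<phi>" "is_unit M (\<phi> [])"
proof -
  have "\<phi> [] < fsize M" using assms(1) words_simps(1) by blast
  moreover have "fmul M (\<phi> []) a = a \<and> fmul M a (\<phi> []) = a" if "a < fsize M" for a
  proof -
    from that have "a \<in> \<phi> ` words k" by (simp add: assms(1))
    then obtain u where "u \<in> words k" "a = \<phi> u" by blast
    then show ?thesis using assms(2)[of "[]" u, symmetric] assms(2)[of u "[]", symmetric] by simp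
  qed
  ultimately show "is_unit M (\<phi> [])" by (simp add: is_unit_def)
  then show "hom_on (words k) M \<phi>" unfolding hom_on_def using assms funit_eq by auto
qed

lemma quotient_fmon:
  assumes E: "congruence_on (words k) E" and fin: "finite (words k // E)"
  obtains M \<phi> where "wf_fmon M" "fsize M = card (words k // E)" "\<phi> ` words k = {..<fsize M}"
    "hom_on (words k) M \<phi>" "\<forall>u\<in>words k. \<forall>v\<in>words k. \<phi> u = \<phi> v \<longleftrightarrow> (u, v) \<in> E"
proof -
  let ?W = "words k"
  define m where "m = card (?W // E)"
  have eq: "equiv ?W E" using E by (simp add: congruence_on_def)
  obtain h where h: "bij_betw h (?W // E) {0..<m}"
    unfolding m_def using ex_bij_betw_finite_nat[OF fin] by blast
  define \<phi> where "\<phi> u = h (E `` {u})" for u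
  have im: "\<phi> ` ?W = {..<m}"
  proof -
    have "\<phi> ` ?W = h ` (?W // E)" unfolding \<phi>_def quotient_def by auto
    then show ?thesis using h by (simp add: bij_betw_def lessThan_atLeast0)
  qed
  have ker: "\<phi> u = \<phi> v \<longleftrightarrow> (u, v) \<in> E" if "u \<in> ?W" "v \<in> ?W" for u v
  proof -
    have "\<phi> u = \<phi> v \<longleftrightarrow> E `` {u} = E `` {v}"
      unfolding \<phi>_def using inj_on_eq_iff[OF bij_betw_imp_inj_on[OF h]] that by (simp add: quotientI)
    then show ?thesis using eq_equiv_class_iff[OF eq that] by simp
  qed
  define rep where "rep = inv_into ?W \<phi>"
  have rep: "rep i \<in> ?W" "\<phi> (rep i) = i" if "i < m" for i
    using that im unfolding rep_def by (auto intro: inv_into_into f_inv_into_f)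
  define M :: fmon where "M = (m, map (\<lambda>i. map (\<lambda>j. \<phi> (rep i @ rep j)) [0..<m]) [0..<m])"
  have size: "fsize M = m" by (simp add: M_def fsize_def)
  have mul: "fmul M i j = \<phi> (rep i @ rep j)" if "i < m" "j < m" for i j
    using that by (simp add: M_def fmul_def)
  have hom: "\<phi> (u @ v) = fmul M (\<phi> u) (\<phi> v)" if "u \<in> ?W" "v \<in> ?W" for u v
  proof -
    have m: "\<phi> u < m" "\<phi> v < m" using im that by auto
    have "(u, rep (\<phi> u)) \<in> E" "(v, rep (\<phi> v)) \<in> E" 
      using ker[of u "rep (\<phi> u)"] ker[of v "rep (\<phi> v)"] rep m that by simp_all
    then have "(u @ v, rep (\<phi> u) @ v) \<in> E" "(rep (\<phi> u) @ v, rep (\<phi> u) @ rep (\<phi> v)) \<in> E"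
      using E that rep(1)[OF m(1)] unfolding congruence_on_def by blast+
    then have "(u @ v, rep (\<phi> u) @ rep (\<phi> v)) \<in> E" using eq unfolding equiv_def by (meson transD)
    then show ?thesis using ker mul m rep that by simp
  qed
  have "wf_fmon M"
    unfolding wf_fmon_def
  proof (intro conjI allI impI)
    show "\<exists>e. is_unit M e" using onto_hom(2)[of \<phi> k M] im hom size by auto
    show "\<forall>r\<in>set (snd M). length r = fsize M \<and> (\<forall>x\<in>set r. x < fsize M)"
      using im rep by (auto simp: M_def fsize_def)
    fix a b c assume "a < fsize M \<and> b < fsize M \<and> c < fsize M"
    then obtain u v w where "u \<in> ?W" "v \<in> ?W" "w \<in> ?W" "a = \<phi> u" "b = \<phi> v" "c = \<phi> w"
      unfolding size using rep by metis
    then show "fmul M (fmul M a b) c = fmul M a (fmul M b c)"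
      using hom[of "u @ v" w] hom[of u "v @ w"] hom[of u v] hom[of v w] by simp
  qed (simp add: M_def fsize_def)
  then show ?thesis
    using that[of M \<phi>] onto_hom(1)[of \<phi> k M] im ker hom size m_def by auto
qed

text \<open>The homomorphism theorem: a coarser kernel makes \<open>M\<close> an image of
  \<open>M0\<close>.\<close>

lemma variety_quotient:
  assumes V: "monoid_variety V" "M0 \<in> V" and 0: "\<phi>0 ` words k = {..<fsize M0}" "hom_on (words k) M0 \<phi>0"
    and M: "wf_fmon M" "\<phi> ` words k = {..<fsize M}" "hom_on (words k) M \<phi>"
    and ker: "\<And>u v. u \<in> words k \<Longrightarrow> v \<in> words k \<Longrightarrow> \<phi>0 u = \<phi>0 v \<Longrightarrow> \<phi> u = \<phi> v"
  shows "M \<in> V"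
proof -
  define f where "f c = \<phi> (inv_into (words k) \<phi>0 c)" for c
  have f: "f (\<phi>0 u) = \<phi> u" if "u \<in> words k" for u
    unfolding f_def using that by (intro ker) (auto intro: inv_into_into f_inv_into_f)
  have ex: "\<exists>u\<in>words k. a = \<phi>0 u" if "a < fsize M0" for a
  proof -
    from that have "a \<in> \<phi>0 ` words k" by (simp add: 0(1))
    then show ?thesis by blast
  qed
  have "fmon_hom M0 M f"
    unfolding fmon_hom_def
  proof (intro conjI allI impI)
    show "f a < fsize M" if a: "a < fsize M0" for a
    proof -
      obtain u where "u \<in> words k" "a = \<phi>0 u" using ex[OF a] by blast
      then show ?thesis using f M(2) by auto
    qed
    show "f (fmul M0 a b) = fmul M (f a) (f b)" if ab: "a < fsize M0 \<and> b < fsize M0" for a b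
    proof -
      obtain u v where uv: "u \<in> words k" "a = \<phi>0 u" "v \<in> words k" "b = \<phi>0 v"
        using ab ex by blast
      then have "f (\<phi>0 (u @ v)) = \<phi> (u @ v)" by (intro f) simp
      then show ?thesis using f[OF uv(1)] f[OF uv(3)] uv 0(2) M(3) by (simp add: hom_on_def)
    qed
    show "f (funit M0) = funit M" using f[of "[]"] 0(2) M(3) by (simp add: hom_on_def)
  qed
  moreover have "f ` {..<fsize M0} = {..<fsize M}"
    using f by (auto simp: 0(1)[symmetric] M(2)[symmetric] image_iff)
  ultimately show ?thesis using V M(1) unfolding monoid_variety_def by blast
qed

lemma variety_sub:
  assumes V: "monoid_variety V" "M0 \<in> V" and 0: "hom_on (words k) M0 \<phi>0"
    and M: "wf_fmon M" "\<phi> ` words k = {..<fsize M}" "hom_on (words k) M \<phi>"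
    and ker: "\<And>u v. u \<in> words k \<Longrightarrow> v \<in> words k \<Longrightarrow> \<phi> u = \<phi> v \<longleftrightarrow> \<phi>0 u = \<phi>0 v"
  shows "M \<in> V"
proof -
  define f where "f c = \<phi>0 (inv_into (words k) \<phi> c)" for c
  have f: "f (\<phi> u) = \<phi>0 u" if "u \<in> words k" for u
    unfolding f_def using that by (subst ker[symmetric]) (auto intro: inv_into_into f_inv_into_f)
  have ex: "\<exists>u\<in>words k. a = \<phi> u" if "a < fsize M" for a
  proof -
    from that have "a \<in> \<phi> ` words k" by (simp add: M(2))
    then show ?thesis by blast
  qed
  have "fmon_hom M M0 f"
    unfolding fmon_hom_def
  proof (intro conjI allI impI)
    show "f a < fsize M0" if "a < fsize M" for a
      using ex[OF that] f 0 by (auto simp: hom_on_def)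
    show "f (fmul M a b) = fmul M0 (f a) (f b)" if ab: "a < fsize M \<and> b < fsize M" for a b
    proof -
      obtain u v where uv: "u \<in> words k" "a = \<phi> u" "v \<in> words k" "b = \<phi> v"
        using ab ex by blast
      then have "f (\<phi> (u @ v)) = \<phi>0 (u @ v)" by (intro f) simp
      then show ?thesis using f[OF uv(1)] f[OF uv(3)] uv 0 M(3) by (simp add: hom_on_def)
    qed
    show "f (funit M) = funit M0" using f[of "[]"] 0 M(3) by (simp add: hom_on_def)
  qed
  moreover have "inj_on f {..<fsize M}"
    using f ker by (auto simp: M(2)[symmetric] inj_on_def)
  ultimately show ?thesis using V M(1) unfolding monoid_variety_def by blast
qed

section \<open>From compatible congruences to bimachines\<close>

text \<open>The condition on \<open>s\<close> and \<open>t\<close> makes \<open>x\<close> the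
  longest common prefix of the two words.\<close>

lemma prefix_of_branching:
  "prefix p (x @ s) \<Longrightarrow> prefix p (x @ t) \<Longrightarrow> s = [] \<or> t = [] \<or> hd s \<noteq> hd t \<Longrightarrow> prefix p x"
  unfolding prefix_append by (auto simp: prefix_def hd_append split: if_splits)

lemma acc_run_nft_run:
  assumes "acc_run T u qs" "i \<le> length u"
  shows "\<exists>w. nft_run T (hd qs) (take i u) w (qs ! i)" "\<exists>w. nft_run T (qs ! i) (drop i u) w (last qs)"
proof -
  have len: "length qs = Suc (length u)" using assms(1) by (simp add: acc_run_def)
  then have ne: "qs \<noteq> []" by auto
  have step: "\<exists>w. nft_run T (qs ! j) [u ! j] w (qs ! Suc j)" if "j < length u" for j
    using that assms(1) unfolding acc_run_def nft_run_Cons_iff by fastforce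
  have "\<exists>w. nft_run T (qs ! 0) (take j u) w (qs ! j)" if "j \<le> length u" for j
    using that
  proof (induction j)
    case (Suc j)
    then show ?case using step[of j] by (auto simp: take_Suc_conv_app_nth nft_run_append)
  qed auto
  then show "\<exists>w. nft_run T (hd qs) (take i u) w (qs ! i)" using assms(2) ne by (simp add: hd_conv_nth)
  have "\<exists>w. nft_run T (qs ! (length u - j)) (drop (length u - j) u) w (qs ! length u)" if "j \<le> length u" for j
    using that
  proof (induction j)
    case (Suc j)
    let ?i = "length u - Suc j"
    have i: "Suc ?i = length u - j" "?i < length u" using Suc.prems by auto
    then have "drop ?i u = [u ! ?i] @ drop (length u - j) u" 
      using Cons_nth_drop_Suc[OF i(2)] by simp
    moreover obtain w1 where "nft_run T (qs ! (length u - j)) (drop (length u - j) u) w1 (qs ! length u)"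
      using Suc by auto
    moreover obtain w2 where "nft_run T (qs ! ?i) [u ! ?i] w2 (qs ! (length u - j))"
      using step[OF i(2)] i(1) by auto
    ultimately have "nft_run T (qs ! ?i) (drop ?i u) (w2 @ w1) (qs ! length u)"
      using nft_run_append by metis
    then show ?case by blast
  qed auto
  from this[of "length u - i"] show "\<exists>w. nft_run T (qs ! i) (drop i u) w (last qs)"
    using assms(2) len ne by (simp add: last_conv_nth)
qed

locale recognized =
  fixes T :: nft and M :: fmon and \<phi> :: "nat list \<Rightarrow> nat" and W
  defines "W \<equiv> words (alph T)"
  assumes wf: "wf_nft T" and fu: "functional_nft T" and wfM: "wf_fmon M"
    and onto: "\<phi> ` W = {..<fsize M}"
    and hom: "u \<in> W \<Longrightarrow> v \<in> W \<Longrightarrow> \<phi> (u @ v) = fmul M (\<phi> u) (\<phi> v)"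
    and compat: "compat T {(u, u'). u \<in> W \<and> u' \<in> W \<and> \<phi> u = \<phi> u'} {(u, u'). u \<in> W \<and> u' \<in> W \<and> \<phi> u = \<phi> u'}"
begin

lemma W_simps [simp]: "[] \<in> W" "a # u \<in> W \<longleftrightarrow> a < alph T \<and> u \<in> W" "u @ v \<in> W \<longleftrightarrow> u \<in> W \<and> v \<in> W"
  by (simp_all add: W_def)

lemma phi_less [simp]: "u \<in> W \<Longrightarrow> \<phi> u < fsize M"
  using onto by auto

lemma ex_word: assumes "c < fsize M" obtains u where "u \<in> W" "\<phi> u = c"
proof -
  from assms have "c \<in> \<phi> ` W" by (simp add: onto)
  then show ?thesis using that by blast
qed

lemma phi_saturated:
  assumes "u @ v \<in> dm T" "u' \<in> W" "v' \<in> W" "\<phi> u = \<phi> u'" "\<phi> v = \<phi> v'"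
  shows "u' @ v' \<in> dm T" "minor (fn T (u @ v)) (fn T (u @ v')) (fn T (u' @ v)) (fn T (u' @ v'))"
proof -
  have "u @ v \<in> W" using dm_words[OF wf assms(1)] by (simp add: W_def)
  then show "u' @ v' \<in> dm T" "minor (fn T (u @ v)) (fn T (u @ v')) (fn T (u' @ v)) (fn T (u' @ v'))"
    using compatD[OF compat, of u u' v v'] assms by auto
qed

section \<open>Longest common prefixes of the possible outputs\<close>

definition outs :: "nat list \<Rightarrow> nat \<Rightarrow> nat list set" where
  "outs u r = {fn T (u @ v) | v. v \<in> W \<and> \<phi> v = r \<and> u @ v \<in> dm T}"

text \<open>The longest output that is certain once \<open>u\<close> has been read and the remaining
  suffix is known to evaluate to \<open>r\<close>.\<close>

definition lam :: "nat list \<Rightarrow> nat \<Rightarrow> nat list" where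
  "lam u r = Longest_common_prefix (outs u r)"

lemma lam_prefix: "v \<in> W \<Longrightarrow> u @ v \<in> dm T \<Longrightarrow> prefix (lam u (\<phi> v)) (fn T (u @ v))"
  unfolding lam_def outs_def by (rule Longest_common_prefix_prefix) blast

text \<open>Rank one lets the rows of \<open>u\<close> and \<open>u'\<close> differ by a left factor
  only, and the longest common prefix absorbs it. What follows the prefix then depends on the class
  of \<open>u\<close> alone; \<open>tail_eq\<close> gets this by using both directions.\<close>

lemma tail_suffix:
  assumes uv: "u \<in> W" "u' \<in> W" "\<phi> u = \<phi> u'" "v \<in> W" "u @ v \<in> dm T"
  shows "suffix (drop (length (lam u (\<phi> v))) (fn T (u @ v))) (drop (length (lam u' (\<phi> v))) (fn T (u' @ v)))"
proof -
  define P where "P = lam u (\<phi> v)"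
  obtain s where s: "fn T (u @ v) = P @ s" using lam_prefix[OF uv(4,5)] unfolding P_def prefix_def by blast
  \<comment> \<open>A second suffix whose output leaves that of \<open>v\<close> right after
    \<open>P\<close>: if \<open>s\<close> starts with \<open>a\<close>, some output of the row does
    not extend \<open>P @ [a]\<close>, as \<open>P\<close> is longest.\<close>
  obtain v' t where v': "v' \<in> W" "\<phi> v' = \<phi> v" "u @ v' \<in> dm T" "fn T (u @ v') = P @ t"
    "s = [] \<or> t = [] \<or> hd s \<noteq> hd t"
  proof (cases s)
    case Nil
    then show ?thesis using that[of v s] uv s by simp
  next
    case (Cons a s')
    have "\<not> (\<forall>z\<in>outs u (\<phi> v). prefix (P @ [a]) z)"
    proof
      assume "\<forall>z\<in>outs u (\<phi> v). prefix (P @ [a]) z"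
      moreover have "outs u (\<phi> v) \<noteq> {}" using uv unfolding outs_def by blast
      ultimately have "length (P @ [a]) \<le> length P"
        unfolding P_def lam_def by (intro Longest_common_prefix_longest)
      then show False by simp
    qed
    then obtain v' where v': "v' \<in> W" "\<phi> v' = \<phi> v" "u @ v' \<in> dm T" "\<not> prefix (P @ [a]) (fn T (u @ v'))"
      unfolding outs_def by blast
    then obtain t where "fn T (u @ v') = P @ t"
      using lam_prefix[of v' u] unfolding P_def prefix_def by metis
    then show ?thesis using that[of v' t] v' Cons by (cases t) auto
  qed
  have uv': "u' @ v \<in> dm T" "u' @ v' \<in> dm T"
    using phi_saturated(1)[OF uv(5)] uv v' by auto
  from phi_saturated(2)[OF uv(5,2) v'(1) uv(3) v'(2)[symmetric]]
  obtain x y s0 t0 where m: "P @ s = x @ s0" "P @ t = x @ t0" "fn T (u' @ v) = y @ s0" "fn T (u' @ v') = y @ t0"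
    unfolding minor_def s v'(4) by blast
  \<comment> \<open>The factorization may cut too early but never beyond the branching point
    \<open>P\<close>; shifting the cut by \<open>c\<close> aligns it with \<open>P\<close>.\<close>
  have "prefix x P" by (rule prefix_of_branching[OF _ _ v'(5)]) (simp_all add: m)
  then obtain c where "P = x @ c" by (auto simp: prefix_def)
  then have yc: "fn T (u' @ v) = (y @ c) @ s" "fn T (u' @ v') = (y @ c) @ t" using m by auto
  have "prefix (lam u' (\<phi> v)) (y @ c)"
  proof (rule prefix_of_branching[OF _ _ v'(5)])
    show "prefix (lam u' (\<phi> v)) ((y @ c) @ s)" using lam_prefix[OF uv(4) uv'(1)] yc(1) by simp
    show "prefix (lam u' (\<phi> v)) ((y @ c) @ t)" using lam_prefix[OF v'(1) uv'(2)] v'(2) yc(2) by simp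
  qed
  then obtain d where "y @ c = lam u' (\<phi> v) @ d" by (auto simp: prefix_def)
  then have "drop (length (lam u' (\<phi> v))) (fn T (u' @ v)) = d @ s" using yc(1) by simp
  then show ?thesis unfolding s P_def[symmetric] by (simp add: suffix_def)
qed

lemma tail_eq:
  assumes "u \<in> W" "u' \<in> W" "\<phi> u = \<phi> u'" "v \<in> W" "u @ v \<in> dm T"
  shows "drop (length (lam u (\<phi> v))) (fn T (u @ v)) = drop (length (lam u' (\<phi> v))) (fn T (u' @ v))"
  using tail_suffix[OF assms] tail_suffix[OF assms(2,1) assms(3)[symmetric] assms(4)]
    phi_saturated(1)[OF assms(5,2,4,3)] by (simp add: suffix_order.eq_iff)

definition rep :: "nat \<Rightarrow> nat list" where
  "rep = inv_into W \<phi>"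

lemma rep: "c < fsize M \<Longrightarrow> rep c \<in> W" "c < fsize M \<Longrightarrow> \<phi> (rep c) = c"
  unfolding rep_def by (auto simp: onto intro: inv_into_into f_inv_into_f)

definition live :: "nat \<Rightarrow> nat \<Rightarrow> bool" where
  "live l r \<longleftrightarrow> (\<exists>u\<in>W. \<exists>v\<in>W. \<phi> u = l \<and> \<phi> v = r \<and> u @ v \<in> dm T)"

lemma live_iff: "u \<in> W \<Longrightarrow> v \<in> W \<Longrightarrow> live (\<phi> u) (\<phi> v) \<longleftrightarrow> u @ v \<in> dm T"
  unfolding live_def using phi_saturated(1) by metis

text \<open>Transitions that are not live lie on no successful run but are kept, so that the
  transition monoid stays isomorphic to \<open>M\<close>. The prefix of an empty set of outputs is
  unspecified, hence the default \<open>[]\<close>, which keeps outputs inside the alphabet.\<close>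

definition step_out :: "nat \<Rightarrow> nat \<Rightarrow> nat \<Rightarrow> nat list" where
  "step_out l a r = (let r' = fmul M (\<phi> [a]) r in
     if live l r' then drop (length (lam (rep l) r')) (lam (rep l @ [a]) r) else [])"

lemma lam_words:
  assumes "v \<in> W" "u @ v \<in> dm T" shows "lam u (\<phi> v) \<in> W"
proof -
  have "fn T (u @ v) \<in> W"
    using nft_rel_wf(2)[OF wf] nft_rel_iff_fn[OF fu] assms(2) W_def by blast
  moreover obtain s where "fn T (u @ v) = lam u (\<phi> v) @ s" using lam_prefix[OF assms] by (auto simp: prefix_def)
  ultimately show ?thesis using W_simps(3) by metis
qed

lemma drop_W: "u \<in> W \<Longrightarrow> drop i u \<in> W"
  unfolding W_def words_def by (auto dest: in_set_dropD)

text \<open>The outputs compatible with \<open>u @ [a]\<close> and value \<open>\<phi> v\<close> are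
  among those compatible with \<open>u\<close> and value \<open>\<phi> (a # v)\<close>; fewer words
  have a longer common prefix.\<close>

lemma lam_mono:
  assumes "a < alph T" "v \<in> W" "u @ [a] @ v \<in> dm T"
  shows "prefix (lam u (\<phi> (a # v))) (lam (u @ [a]) (\<phi> v))"
  unfolding lam_def
proof (rule Longest_common_prefix_max_prefix)
  show "outs (u @ [a]) (\<phi> v) \<noteq> {}" unfolding outs_def using assms by auto
  show "\<forall>z\<in>outs (u @ [a]) (\<phi> v). prefix (Longest_common_prefix (outs u (\<phi> (a # v)))) z"
  proof
    fix z assume "z \<in> outs (u @ [a]) (\<phi> v)"
    then obtain v' where v': "v' \<in> W" "\<phi> v' = \<phi> v" "u @ a # v' \<in> dm T" "z = fn T (u @ a # v')"
      unfolding outs_def by auto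
    have "\<phi> (a # v') = \<phi> (a # v)" using hom[of "[a]" v'] hom[of "[a]" v] v' assms by simp
    then have "z \<in> outs u (\<phi> (a # v))" unfolding outs_def using v' assms(1) by force
    then show "prefix (Longest_common_prefix (outs u (\<phi> (a # v)))) z" by (rule Longest_common_prefix_prefix)
  qed
qed

text \<open>The increment of \<open>lam\<close> is the difference of two tails of the same value,
  and by \<open>tail_eq\<close> both tails are unchanged when \<open>u\<close> is replaced by the
  representative of its class.\<close>

lemma lam_step:
  assumes u: "u \<in> W" and a: "a < alph T" and v: "v \<in> W" and d: "u @ [a] @ v \<in> dm T"
  shows "lam (u @ [a]) (\<phi> v) = lam u (\<phi> (a # v)) @ step_out (\<phi> u) a (\<phi> v)"
proof -
  let ?u = "rep (\<phi> u)"
  have u': "?u \<in> W" "\<phi> ?u = \<phi> u" using rep u by auto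
  have av: "fmul M (\<phi> [a]) (\<phi> v) = \<phi> (a # v)" using hom[of "[a]" v] a v by simp
  have d': "?u @ [a] @ v \<in> dm T" using phi_saturated(1)[OF d u'(1), of "[a] @ v"] u' a v by simp
  have ua: "\<phi> (u @ [a]) = \<phi> (?u @ [a])" using hom u u' a by simp
  have lv: "live (\<phi> u) (\<phi> (a # v))" using live_iff[of u "a # v"] u a v d by simp
  have so: "lam (?u @ [a]) (\<phi> v) = lam ?u (\<phi> (a # v)) @ step_out (\<phi> u) a (\<phi> v)"
    unfolding step_out_def Let_def av using lv lam_mono[OF a v d'] by (auto simp: prefix_def)
  have pre: "\<exists>s1. fn T (u @ [a] @ v) = lam (u @ [a]) (\<phi> v) @ s1"
    "\<exists>s2. fn T (u @ [a] @ v) = lam u (\<phi> (a # v)) @ s2" if "u @ [a] @ v \<in> dm T" for u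
    using lam_prefix[of v "u @ [a]"] lam_prefix[of "a # v" u] v a that by (simp_all add: prefix_def)
  obtain s1 s2 where 1: "fn T (u @ [a] @ v) = lam (u @ [a]) (\<phi> v) @ s1" "fn T (u @ [a] @ v) = lam u (\<phi> (a # v)) @ s2"
    using pre[OF d] by blast
  obtain s1' s2' where 2: "fn T (?u @ [a] @ v) = lam (?u @ [a]) (\<phi> v) @ s1'" "fn T (?u @ [a] @ v) = lam ?u (\<phi> (a # v)) @ s2'"
    using pre[OF d'] by blast
  have "s1 = s1'" using tail_eq[of "u @ [a]" "?u @ [a]" v] 1(1) 2(1) u u' a v d ua by simp
  moreover have "s2 = s2'" using tail_eq[of u ?u "a # v"] 1(2) 2(2) u u' a v d by simp
  moreover have "s2' = step_out (\<phi> u) a (\<phi> v) @ s1'" using 2 so by simp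
  ultimately show ?thesis using 1 by simp
qed

definition final_out :: "nat \<Rightarrow> nat list" where
  "final_out l = (if live l (\<phi> []) then drop (length (lam (rep l) (\<phi> []))) (fn T (rep l)) else [])"

lemma final_out:
  assumes "u \<in> dm T" shows "fn T u = lam u (\<phi> []) @ final_out (\<phi> u)"
proof -
  have u: "u \<in> W" using dm_words[OF wf assms] by (simp add: W_def)
  let ?u = "rep (\<phi> u)"
  have u': "?u \<in> W" "\<phi> ?u = \<phi> u" using rep u by auto
  have "live (\<phi> u) (\<phi> [])" using live_iff[of u "[]"] u assms by simp
  then have "final_out (\<phi> u) = drop (length (lam u (\<phi> []))) (fn T u)"
    using tail_eq[of u ?u "[]"] u u' assms by (simp add: final_out_def)
  then show ?thesis using lam_prefix[of "[]" u] assms by (auto simp: prefix_def)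
qed

section \<open>The bimachine and its runs\<close>

text \<open>
  In state \<^term>\<open>st l r\<close> the prefix read so far evaluates to \<^term>\<open>l\<close> and the remaining suffix is
  guessed to evaluate to \<^term>\<open>r\<close>.
\<close>

definition st :: "nat \<Rightarrow> nat \<Rightarrow> nat" where
  "st l r = l * fsize M + r"

lemma st_eq_iff:
  assumes "r < fsize M" "r' < fsize M" shows "st l r = st l' r' \<longleftrightarrow> l = l' \<and> r = r'"
proof
  assume eq: "st l r = st l' r'"
  have "st l r div fsize M = l" "st l r mod fsize M = r" "st l' r' div fsize M = l'" "st l' r' mod fsize M = r'"
    using assms by (simp_all add: st_def)
  then show "l = l' \<and> r = r'" using eq by metis
qed simp

lemma st_less: assumes "l < fsize M" "r < fsize M" shows "st l r < fsize M * fsize M"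
proof -
  have "st l r < Suc l * fsize M" using assms(2) by (simp add: st_def)
  also have "\<dots> \<le> fsize M * fsize M" using assms(1) by (intro mult_le_mono1) simp
  finally show ?thesis .
qed

lemma mul_less [simp]: assumes "a < fsize M" "b < fsize M" shows "fmul M a b < fsize M"
proof -
  obtain u where "u \<in> W" "\<phi> u = a" using ex_word[OF assms(1)] .
  moreover obtain v where "v \<in> W" "\<phi> v = b" using ex_word[OF assms(2)] .
  ultimately show ?thesis using hom[of u v] phi_less[of "u @ v"] by simp
qed

lemma mul_assoc:
  "a < fsize M \<Longrightarrow> b < fsize M \<Longrightarrow> c < fsize M \<Longrightarrow> fmul M (fmul M a b) c = fmul M a (fmul M b c)"
  using wfM unfolding wf_fmon_def by blast

lemma unit: "a < fsize M \<Longrightarrow> fmul M (\<phi> []) a = a" "a < fsize M \<Longrightarrow> fmul M a (\<phi> []) = a"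
  using onto_hom(2)[of \<phi> "alph T" M] onto hom unfolding W_def is_unit_def by auto

text \<open>Indexed by the suffix value \<open>r\<close> after the letter: the first component is
  computed forwards, the second backwards, so the source carries the product with
  \<open>\<phi> [a]\<close>.\<close>

definition trans_set :: "(nat \<times> nat \<times> nat \<times> nat list) set" where
  "trans_set = (\<lambda>(l, a, r). (st l (fmul M (\<phi> [a]) r), a, st (fmul M l (\<phi> [a])) r, step_out l a r))
     ` ({..<fsize M} \<times> {..<alph T} \<times> {..<fsize M})"

text \<open>Membership in the domain is decided by the initial guess, which must be live; a final
  state only checks that the guess has been used up.\<close>

definition bimachine :: nft where
  "bimachine = NFT (alph T) (fsize M * fsize M) (SOME ts. set ts = trans_set \<and> distinct ts)
     (map (\<lambda>r. (st (\<phi> []) r, lam [] r)) (filter (live (\<phi> [])) [0..<fsize M]))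
     (map (\<lambda>l. (st l (\<phi> []), final_out l)) [0..<fsize M])"

lemma bimachine_simps:
  "alph bimachine = alph T" "nstates bimachine = fsize M * fsize M"
  "set (trans bimachine) = trans_set" "distinct (trans bimachine)"
proof -
  have "finite trans_set" unfolding trans_set_def by simp
  then have "\<exists>ts. set ts = trans_set \<and> distinct ts" by (rule finite_distinct_list)
  from someI_ex[OF this] show "set (trans bimachine) = trans_set" "distinct (trans bimachine)"
    by (simp_all add: bimachine_def)
qed (simp_all add: bimachine_def)

lemma in_trans:
  "(p, a, q, w) \<in> set (trans bimachine) \<longleftrightarrow> (\<exists>l<fsize M. \<exists>r<fsize M. a < alph T
     \<and> p = st l (fmul M (\<phi> [a]) r) \<and> q = st (fmul M l (\<phi> [a])) r \<and> w = step_out l a r)"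
  unfolding bimachine_simps trans_set_def by (auto simp: image_iff) 

lemma in_iout:
  "(p, w) \<in> set (iout bimachine) \<longleftrightarrow> (\<exists>r<fsize M. live (\<phi> []) r \<and> p = st (\<phi> []) r \<and> w = lam [] r)"
  by (auto simp: bimachine_def)

lemma in_tout:
  "(p, w) \<in> set (tout bimachine) \<longleftrightarrow> (\<exists>l<fsize M. p = st l (\<phi> []) \<and> w = final_out l)"
  by (auto simp: bimachine_def)

lemma wf_bimachine: "wf_nft bimachine"
  unfolding wf_nft_def
proof (intro conjI)
  have W: "w \<in> W \<Longrightarrow> set w \<subseteq> {..<alph T}" for w by (simp add: W_def words_def)
  have so: "set (step_out l a r) \<subseteq> {..<alph T}" if "l < fsize M" "r < fsize M" "a < alph T" for l a r
  proof (cases "live l (fmul M (\<phi> [a]) r)")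
    case True
    obtain v where v: "v \<in> W" "\<phi> v = r" using ex_word[OF \<open>r < fsize M\<close>] .
    then have r: "fmul M (\<phi> [a]) r = \<phi> (a # v)" using hom[of "[a]" v] that by simp
    from True have "rep l @ a # v \<in> dm T" using live_iff[of "rep l" "a # v"] rep that v r by simp
    then have "lam (rep l @ [a]) r \<in> W" using lam_words[of v "rep l @ [a]"] v by simp
    then show ?thesis unfolding step_out_def Let_def using W drop_W by auto
  qed (simp add: step_out_def)
  show "\<forall>(p, a, q, w)\<in>set (trans bimachine). p < nstates bimachine \<and> a < alph bimachine \<and>
      q < nstates bimachine \<and> set w \<subseteq> {..<alph bimachine}"
    by (auto simp: bimachine_simps(1,2) in_trans intro!: st_less dest: so[THEN subsetD])
  have "inj_on (\<lambda>(p, a, q, w). (p, a, q)) trans_set"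
    unfolding trans_set_def by (rule inj_onI) (auto simp: st_eq_iff)
  then show "distinct (map (\<lambda>(p, a, q, w). (p, a, q)) (trans bimachine))"
    by (simp add: distinct_map bimachine_simps)
  have lo: "set (lam [] r) \<subseteq> {..<alph T}" if "live (\<phi> []) r" for r
  proof -
    from \<open>live (\<phi> []) r\<close> obtain v where v: "v \<in> W" "\<phi> v = r" unfolding live_def by blast
    then show ?thesis using that live_iff[of "[]" v] lam_words[of v "[]"] W by auto
  qed
  show "\<forall>(q, w)\<in>set (iout bimachine). q < nstates bimachine \<and> set w \<subseteq> {..<alph bimachine}"
    by (auto simp: bimachine_simps(1,2) in_iout intro!: st_less dest: lo[THEN subsetD])
  have fo: "set (final_out l) \<subseteq> {..<alph T}" if "l < fsize M" for l
  proof (cases "live l (\<phi> [])")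
    case True
    then have "rep l \<in> dm T" using live_iff[of "rep l" "[]"] rep that by simp
    then have "fn T (rep l) \<in> W" using nft_rel_wf(2)[OF wf] nft_rel_iff_fn[OF fu] W_def by blast
    then show ?thesis unfolding final_out_def using drop_W W by auto
  qed (simp add: final_out_def)
  show "\<forall>(q, w)\<in>set (tout bimachine). q < nstates bimachine \<and> set w \<subseteq> {..<alph bimachine}"
    by (auto simp: bimachine_simps(1,2) in_tout intro!: st_less dest: fo[THEN subsetD])
  show "distinct (map fst (iout bimachine))" "distinct (map fst (tout bimachine))"
    by (auto simp: bimachine_def comp_def distinct_map inj_on_def st_eq_iff)
qed

lemma run_bimachineD:
  "nft_run bimachine p u w q \<Longrightarrow> p = st l r \<Longrightarrow> l < fsize M \<Longrightarrow> r < fsize M \<Longrightarrow>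
   \<exists>r'<fsize M. u \<in> W \<and> q = st (fmul M l (\<phi> u)) r' \<and> r = fmul M (\<phi> u) r'"
proof (induction u arbitrary: p w l r)
  case Nil
  then show ?case by (auto simp: unit)
next
  case (Cons a u)
  then obtain p' x y where 1: "(p, a, p', x) \<in> set (trans bimachine)" "nft_run bimachine p' u y q"
    unfolding nft_run_Cons_iff by blast
  then obtain l' r1 where 2: "l' < fsize M" "r1 < fsize M" "a < alph T" "p = st l' (fmul M (\<phi> [a]) r1)"
    "p' = st (fmul M l' (\<phi> [a])) r1" unfolding in_trans by blast
  then have l': "l' = l" "r = fmul M (\<phi> [a]) r1" using Cons.prems st_eq_iff by auto
  obtain r' where 3: "r' < fsize M" "u \<in> W" "q = st (fmul M (fmul M l (\<phi> [a])) (\<phi> u)) r'" "r1 = fmul M (\<phi> u) r'"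
    using Cons.IH[OF 1(2) 2(5)] 2 l' by auto
  then show ?case using 2 l' hom[of "[a]" u] mul_assoc by auto
qed

lemma run_bimachineI:
  assumes "l < fsize M" "r < fsize M" "u \<in> W"
  shows "\<exists>w. nft_run bimachine (st l (fmul M (\<phi> u) r)) u w (st (fmul M l (\<phi> u)) r)"
  using assms
proof (induction u arbitrary: l)
  case Nil
  then show ?case by (auto simp: unit)
next
  case (Cons a u)
  then have au: "a < alph T" "u \<in> W" by auto
  then have "(st l (fmul M (\<phi> [a]) (fmul M (\<phi> u) r)), a, st (fmul M l (\<phi> [a])) (fmul M (\<phi> u) r),
     step_out l a (fmul M (\<phi> u) r)) \<in> set (trans bimachine)"
    unfolding in_trans using Cons.prems
    by (intro exI[of _ l] conjI exI[of _ "fmul M (\<phi> u) r"] refl) auto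
  moreover obtain w where "nft_run bimachine (st (fmul M l (\<phi> [a])) (fmul M (\<phi> u) r)) u w
     (st (fmul M (fmul M l (\<phi> [a])) (\<phi> u)) r)" using Cons.IH[of "fmul M l (\<phi> [a])"] Cons.prems by auto
  ultimately have "nft_run bimachine (st l (fmul M (\<phi> [a]) (fmul M (\<phi> u) r))) (a # u)
     (step_out l a (fmul M (\<phi> u) r) @ w) (st (fmul M (fmul M l (\<phi> [a])) (\<phi> u)) r)"
    by (rule nft_run.cons)
  moreover have "\<phi> (a # u) = fmul M (\<phi> [a]) (\<phi> u)" using hom[of "[a]" u] au by simp
  ultimately show ?case using Cons.prems(1,2) au mul_assoc by auto
qed

text \<open>By \<open>lam_step\<close> the outputs along the run are successive increments of
  \<open>lam\<close>, so they telescope.\<close>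

lemma run_bimachine_out:
  assumes "nft_run bimachine (st (\<phi> u) (\<phi> v)) v w (st (\<phi> (u @ v)) (\<phi> []))" "u \<in> W" "u @ v \<in> dm T"
  shows "lam u (\<phi> v) @ w = lam (u @ v) (\<phi> [])"
  using assms
proof (induction v arbitrary: u w)
  case (Cons a v)
  have "u @ a # v \<in> W" using dm_words[OF wf Cons.prems(3)] by (simp add: W_def)
  then have W: "a < alph T" "v \<in> W" by auto
  have hav: "\<phi> (a # v) = fmul M (\<phi> [a]) (\<phi> v)" using hom[of "[a]" v] W by simp
  obtain p' x y where 1: "(st (\<phi> u) (\<phi> (a # v)), a, p', x) \<in> set (trans bimachine)"
    "nft_run bimachine p' v y (st (\<phi> (u @ a # v)) (\<phi> []))" "w = x @ y"
    using Cons.prems(1) unfolding nft_run_Cons_iff by blast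
  then obtain l r where 2: "l < fsize M" "r < fsize M" "st (\<phi> u) (\<phi> (a # v)) = st l (fmul M (\<phi> [a]) r)"
    "p' = st (fmul M l (\<phi> [a])) r" "x = step_out l a r" unfolding in_trans by blast
  have l: "l = \<phi> u" using 2(3) st_eq_iff[of "\<phi> (a # v)" "fmul M (\<phi> [a]) r"] 2 W by auto
  obtain r' where "r' < fsize M" "st (\<phi> (u @ a # v)) (\<phi> []) = st (fmul M (fmul M l (\<phi> [a])) (\<phi> v)) r'" "r = fmul M (\<phi> v) r'"
    using run_bimachineD[OF 1(2) 2(4)] 2 W Cons.prems l by auto
  then have r: "r = \<phi> v" using st_eq_iff[of "\<phi> []" r'] W unit by auto
  have p': "p' = st (\<phi> (u @ [a])) (\<phi> v)" using 2(4) l r hom[of u "[a]"] Cons.prems W by simp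
  have "lam (u @ [a]) (\<phi> v) @ y = lam ((u @ [a]) @ v) (\<phi> [])"
    by (rule Cons.IH) (use 1(2) p' Cons.prems W in simp_all)
  then show ?case using lam_step[of u a v] Cons.prems W 1 2 l r by simp
qed simp

lemma rel_bimachine: "nft_rel bimachine = nft_rel T"
proof (intro ext iffI)
  have out: "lam [] (\<phi> u) @ w @ final_out (\<phi> u) = fn T u"
    if "nft_run bimachine (st (\<phi> []) (\<phi> u)) u w (st (\<phi> u) (\<phi> []))" "u \<in> dm T" for u w
    using run_bimachine_out[of "[]" u w] that final_out by simp
  fix u z
  {
    assume "nft_rel bimachine u z"
    then obtain p x w q y where 1: "(p, x) \<in> set (iout bimachine)" "(q, y) \<in> set (tout bimachine)"
      "nft_run bimachine p u w q" "z = x @ w @ y" unfolding nft_rel_def by blast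
    then obtain r l where 2: "r < fsize M" "live (\<phi> []) r" "p = st (\<phi> []) r" "x = lam [] r"
      "l < fsize M" "q = st l (\<phi> [])" "y = final_out l" unfolding in_iout in_tout by blast
    obtain r' where 3: "r' < fsize M" "u \<in> W" "q = st (fmul M (\<phi> []) (\<phi> u)) r'" "r = fmul M (\<phi> u) r'"
      using run_bimachineD[OF 1(3) 2(3)] 2 by auto
    then have 4: "l = \<phi> u" "r = \<phi> u" using 2(6) st_eq_iff[of "\<phi> []" r'] unit by auto
    then have "u \<in> dm T" using 2(2) live_iff[of "[]" u] 3 by simp
    then show "nft_rel T u z" using out[of u w] 1 2 4 nft_rel_iff_fn[OF fu] by simp
  next
    assume "nft_rel T u z"
    then have d: "u \<in> dm T" "z = fn T u" using nft_rel_iff_fn[OF fu] by auto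
    have u: "u \<in> W" using dm_words[OF wf d(1)] by (simp add: W_def)
    obtain w where w: "nft_run bimachine (st (\<phi> []) (\<phi> u)) u w (st (\<phi> u) (\<phi> []))"
      using run_bimachineI[of "\<phi> []" "\<phi> []" u] u unit by auto
    have "(st (\<phi> []) (\<phi> u), lam [] (\<phi> u)) \<in> set (iout bimachine)"
      unfolding in_iout using u d live_iff[of "[]" u] by (intro exI[of _ "\<phi> u"]) auto
    moreover have "(st (\<phi> u) (\<phi> []), final_out (\<phi> u)) \<in> set (tout bimachine)"
      unfolding in_tout using u by (intro exI[of _ "\<phi> u"]) auto
    ultimately show "nft_rel bimachine u z"
      unfolding nft_rel_def using w out[OF w d(1)] d by metis
  }
qed

text \<open>The state at position \<open>i\<close> is forced: its first component by the initial
  state and \<open>take i u\<close>, its second by the final state and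
  \<open>drop i u\<close>.\<close>

lemma unambiguous_bimachine: "unambiguous_nft bimachine"
  unfolding unambiguous_nft_def
proof (intro allI impI)
  have det: "qs ! i = st (\<phi> (take i u)) (\<phi> (drop i u))"
    if a: "acc_run bimachine u qs" and i: "i \<le> length u" for u qs i
  proof -
    obtain r where r: "r < fsize M" "hd qs = st (\<phi> []) r"
      using a unfolding acc_run_def by (auto simp: in_iout)
    obtain l where l: "l < fsize M" "last qs = st l (\<phi> [])"
      using a unfolding acc_run_def by (auto simp: in_tout)
    obtain r' where r': "r' < fsize M" "take i u \<in> W" "qs ! i = st (fmul M (\<phi> []) (\<phi> (take i u))) r'"
      using acc_run_nft_run(1)[OF a i] run_bimachineD[OF _ r(2)] r by (metis W_simps(1) phi_less)
    then have qi: "qs ! i = st (\<phi> (take i u)) r'" using unit by simp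
    obtain r'' where r'': "r'' < fsize M" "drop i u \<in> W"
      "last qs = st (fmul M (\<phi> (take i u)) (\<phi> (drop i u))) r''" "r' = fmul M (\<phi> (drop i u)) r''"
      using acc_run_nft_run(2)[OF a i] run_bimachineD[OF _ qi] r' by (metis phi_less)
    then have "r'' = \<phi> []" using l st_eq_iff[of "\<phi> []" r''] by simp
    then show ?thesis using qi r'' unit by simp
  qed
  fix u qs qs' assume a: "acc_run bimachine u qs" "acc_run bimachine u qs'"
  show "qs = qs'"
  proof (rule nth_equalityI)
    show "length qs = length qs'" using a by (simp add: acc_run_def)
    fix i assume "i < length qs"
    then show "qs ! i = qs' ! i" using det[OF a(1)] det[OF a(2)] a(1) by (simp add: acc_run_def)
  qed
qed

lemma tm_bimachine:
  assumes "u \<in> W"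
  shows "tm bimachine u = {(st l (fmul M (\<phi> u) r), st (fmul M l (\<phi> u)) r) | l r. l < fsize M \<and> r < fsize M}"
proof (intro set_eqI iffI)
  fix z assume "z \<in> tm bimachine u"
  then obtain p w q where z: "z = (p, q)" "p < fsize M * fsize M" "nft_run bimachine p u w q"
    unfolding tm_def reach_def by (auto simp: bimachine_simps)
  have "p = st (p div fsize M) (p mod fsize M)" by (simp add: st_def)
  moreover have "p div fsize M < fsize M" using z(2) by (simp add: less_mult_imp_div_less)
  moreover have "p mod fsize M < fsize M" using z(2) by (metis mod_less_divisor mult_0 neq0_conv not_less_zero)
  ultimately show "z \<in> {(st l (fmul M (\<phi> u) r), st (fmul M l (\<phi> u)) r) | l r. l < fsize M \<and> r < fsize M}"
    using run_bimachineD[OF z(3)] z(1) by force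
next
  fix z assume "z \<in> {(st l (fmul M (\<phi> u) r), st (fmul M l (\<phi> u)) r) | l r. l < fsize M \<and> r < fsize M}"
  then show "z \<in> tm bimachine u"
    using run_bimachineI assms by (auto simp: tm_def reach_def bimachine_simps intro!: st_less)
qed

lemma V_bimachine: "M \<in> V \<Longrightarrow> V_nft V bimachine"
  unfolding V_nft_def
proof (intro bexI exI conjI ballI)
  show "\<phi> ` words (alph bimachine) = {..<fsize M}" using onto by (simp add: bimachine_simps W_def)
  fix u v assume "u \<in> words (alph bimachine)" "v \<in> words (alph bimachine)"
  then have uv: "u \<in> W" "v \<in> W" by (simp_all add: bimachine_simps W_def)
  then show "\<phi> (u @ v) = fmul M (\<phi> u) (\<phi> v)" by (rule hom)
  have "\<phi> u = \<phi> v" if tm: "tm bimachine u = tm bimachine v"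
  proof -
    \<comment> \<open>A pair of states from which \<open>\<phi> u\<close> can be read off: as it
      also lies in the relation of \<open>v\<close>, its target gives \<open>r = \<phi> []\<close>
      and its source then \<open>\<phi> u = \<phi> v\<close>.\<close>
    have "(st (\<phi> []) (\<phi> u), st (\<phi> u) (\<phi> [])) \<in> tm bimachine u"
      unfolding tm_bimachine[OF uv(1)] using unit[of "\<phi> u"] uv
      by (intro CollectI exI[of _ "\<phi> []"]) simp
    then obtain l r where "l < fsize M" "r < fsize M" "st (\<phi> []) (\<phi> u) = st l (fmul M (\<phi> v) r)"
      "st (\<phi> u) (\<phi> []) = st (fmul M l (\<phi> v)) r"
      unfolding tm tm_bimachine[OF uv(2)] by blast
    then have "r = \<phi> []" "\<phi> u = fmul M (\<phi> v) r"
      using st_eq_iff[of "\<phi> []" r] st_eq_iff[of "\<phi> u" "fmul M (\<phi> v) r"] uv by auto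
    then show ?thesis using unit(2)[of "\<phi> v"] uv by simp
  qed
  moreover have "tm bimachine u = tm bimachine v" if "\<phi> u = \<phi> v"
    unfolding tm_bimachine[OF uv(1)] tm_bimachine[OF uv(2)] that ..
  ultimately show "\<phi> u = \<phi> v \<longleftrightarrow> tm bimachine u = tm bimachine v" by blast
qed

lemma definable: "M \<in> V \<Longrightarrow> unamb_V_definable V T"
  unfolding unamb_V_definable_def
  using wf_bimachine unambiguous_bimachine V_bimachine rel_bimachine bimachine_simps(1) by blast

end

section \<open>Testing compatibility on short words\<close>

text \<open>\<open>g\<close> behaves like the state of a deterministic automaton with at most
  \<open>card G\<close> states; the factor between two visits of one state can be removed.\<close>

lemma shorten:
  assumes G: "g ` words k \<subseteq> G" "finite G"
    and step: "\<And>u u' a. u \<in> words k \<Longrightarrow> u' \<in> words k \<Longrightarrow> a < k \<Longrightarrow> g u = g u' \<Longrightarrow> g (u @ [a]) = g (u' @ [a])"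
  shows "u \<in> words k \<Longrightarrow> \<exists>w\<in>words k. length w < card G \<and> g w = g u"
proof (induction u rule: length_induct)
  case (1 u)
  have app: "g (u @ w) = g (u' @ w)" if "u \<in> words k" "u' \<in> words k" "g u = g u'" "w \<in> words k" for u u' w
    using that(4)
  proof (induction w rule: rev_induct)
    case (snoc a w)
    then show ?case using step[of "u @ w" "u' @ w" a] that by simp
  qed (use that in simp)
  show ?case
  proof (cases "length u < card G")
    case True
    then show ?thesis using 1 by blast
  next
    case False
    have W: "take j u \<in> words k" "drop j u \<in> words k" for j
      using "1.prems" by (auto simp: words_def dest: in_set_takeD in_set_dropD)
    have "card ((\<lambda>j. g (take j u)) ` {..length u}) \<le> card G"
      using G W by (intro card_mono) auto
    also have "\<dots> < card {..length u}" using False by simp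
    finally have "\<not> inj_on (\<lambda>j. g (take j u)) {..length u}" by (rule pigeonhole)
    then obtain i j where "i \<le> length u" "j \<le> length u" "i \<noteq> j" "g (take i u) = g (take j u)"
      by (auto simp: inj_on_def)
    then obtain i j where ij: "i < j" "j \<le> length u" "g (take i u) = g (take j u)"
      by (metis linorder_neq_iff)
    have "g (take i u @ drop j u) = g u" using app[OF W(1) W(1) ij(3) W(2)[of j]] by simp
    moreover have "length (take i u @ drop j u) < length u" "take i u @ drop j u \<in> words k" using ij W by auto
    ultimately show ?thesis using "1.IH" by metis
  qed
qed

text \<open>The subset construction, paired with the value of \<open>cl\<close>, is the automaton
  for \<open>shorten\<close>.\<close>

lemma shorten_acc:
  assumes wf: "wf_nft T" and cl: "cl ` words (alph T) \<subseteq> {..<m}"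
    and step: "\<And>u u' a. u \<in> words (alph T) \<Longrightarrow> u' \<in> words (alph T) \<Longrightarrow> a < alph T \<Longrightarrow> cl u = cl u' \<Longrightarrow>
      cl (u @ [a]) = cl (u' @ [a])"
    and u: "u \<in> words (alph T)"
  obtains w where "w \<in> words (alph T)" "length w < 2 ^ nstates T * m" "cl w = cl u"
    "\<forall>p. (\<exists>x. acc T w p x) \<longleftrightarrow> (\<exists>x. acc T u p x)"
proof -
  define g where "g u = ({p. \<exists>x. acc T u p x}, cl u)" for u
  define G where "G = Pow {..<nstates T} \<times> {..<m}"
  have "g ` words (alph T) \<subseteq> G" using cl acc_wf(2)[OF wf] unfolding g_def G_def by auto
  moreover have "finite G" unfolding G_def by simp
  moreover have "g (u @ [a]) = g (u' @ [a])"
    if "u \<in> words (alph T)" "u' \<in> words (alph T)" "a < alph T" "g u = g u'" for u u' a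
  proof -
    have "(\<exists>x. acc T u p x) \<longleftrightarrow> (\<exists>x. acc T u' p x)" for p using that(4) by (auto simp: g_def)
    then have "(\<exists>x. acc T (u @ w) p x) \<longleftrightarrow> (\<exists>x. acc T (u' @ w) p x)" for w p
      unfolding acc_append by metis
    then show ?thesis using step[OF that(1-3)] that(4) by (simp add: g_def)
  qed
  ultimately have "\<exists>w\<in>words (alph T). length w < card G \<and> g w = g u" using u by (rule shorten)
  moreover have "card G = 2 ^ nstates T * m" by (simp add: G_def card_cartesian_product card_Pow)
  ultimately obtain w where w: "w \<in> words (alph T)" "length w < 2 ^ nstates T * m" "g w = g u" by auto
  then have "cl w = cl u" "{p. \<exists>x. acc T w p x} = {p. \<exists>x. acc T u p x}" by (simp_all add: g_def)
  then have "(\<exists>x. acc T w p x) \<longleftrightarrow> (\<exists>x. acc T u p x)" for p by blast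
  then show ?thesis using that[of w] w \<open>cl w = cl u\<close> by blast
qed

text \<open>Separate maps \<open>cl\<close> and \<open>cr\<close> make the setting symmetric, so
  that its mirror image is again an instance. Shortened words are strictly shorter than the bound
  while \<open>S\<close> admits equality; the induction in \<open>delay\<close> needs this room for
  one more letter.\<close>

locale two_sides =
  fixes T :: nft and cl cr :: "nat list \<Rightarrow> nat" and m :: nat and W S
  defines "W \<equiv> words (alph T)" and "S \<equiv> short (alph T) (2 ^ nstates T * m)"
  assumes wf: "wf_nft T" and fu: "functional_nft T"
    and cl: "u \<in> W \<Longrightarrow> cl u < m" and cr: "u \<in> W \<Longrightarrow> cr u < m"
    and cl_step: "u \<in> W \<Longrightarrow> u' \<in> W \<Longrightarrow> a < alph T \<Longrightarrow> cl u = cl u' \<Longrightarrow> cl (u @ [a]) = cl (u' @ [a])"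
    and cr_step: "u \<in> W \<Longrightarrow> u' \<in> W \<Longrightarrow> a < alph T \<Longrightarrow> cr u = cr u' \<Longrightarrow> cr (a # u) = cr (a # u')"
    and short: "compat T {(u, u'). u \<in> S \<and> u' \<in> S \<and> cl u = cl u'} {(v, v'). v \<in> S \<and> v' \<in> S \<and> cr v = cr v'}"
begin

lemma two_sides_mirror: "two_sides (mirror T) (cr \<circ> rev) (cl \<circ> rev) m"
proof -
  have sr: "rev u \<in> S \<longleftrightarrow> u \<in> S" for u by (simp add: S_def short_def)
  have "compat (mirror T) (mirror_rel {(v, v'). v \<in> S \<and> v' \<in> S \<and> cr v = cr v'})
    (mirror_rel {(u, u'). u \<in> S \<and> u' \<in> S \<and> cl u = cl u'})"
    by (rule compat_mirror[OF fu short]) auto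
  then have "compat (mirror T) {(v, v'). v \<in> S \<and> v' \<in> S \<and> (cr \<circ> rev) v = (cr \<circ> rev) v'}
    {(u, u'). u \<in> S \<and> u' \<in> S \<and> (cl \<circ> rev) u = (cl \<circ> rev) u'}"
    by (simp add: mirror_rel_def sr)
  then show ?thesis
    using wf_mirror[OF wf] functional_mirror[OF fu] cl cr cl_step cr_step
    unfolding two_sides_def by (simp add: W_def S_def)
qed

lemma shorten_left:
  assumes "u \<in> W"
  obtains w where "w \<in> W" "length w < 2 ^ nstates T * m" "cl w = cl u" "\<forall>p. (\<exists>x. acc T w p x) \<longleftrightarrow> (\<exists>x. acc T u p x)"
proof -
  have "cl ` words (alph T) \<subseteq> {..<m}" using cl unfolding W_def by auto
  from shorten_acc[OF wf this cl_step assms[unfolded W_def], unfolded W_def]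
  obtain w where "w \<in> words (alph T)" "length w < 2 ^ nstates T * m" "cl w = cl u"
    "\<forall>p. (\<exists>x. acc T w p x) \<longleftrightarrow> (\<exists>x. acc T u p x)" by blast
  then show ?thesis by (intro that[of w]) (simp_all add: W_def)
qed

lemma short_of_less: "w \<in> W \<Longrightarrow> length w < 2 ^ nstates T * m \<Longrightarrow> w \<in> S"
  by (simp add: W_def S_def short_def)

lemma shorten_right:
  assumes "v \<in> W"
  obtains w where "w \<in> W" "length w < 2 ^ nstates T * m" "cr w = cr v" "\<forall>p. (\<exists>x. coacc T p w x) \<longleftrightarrow> (\<exists>x. coacc T p v x)"
proof -
  interpret mir: two_sides "mirror T" "cr \<circ> rev" "cl \<circ> rev" m "words (alph (mirror T))"
    "short (alph (mirror T)) (2 ^ nstates (mirror T) * m)"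
    by (rule two_sides_mirror)
  obtain w where w: "w \<in> words (alph T)" "length w < 2 ^ nstates T * m" "cr (rev w) = cr v"
    "\<forall>p. (\<exists>x. acc (mirror T) w p x) \<longleftrightarrow> (\<exists>x. acc (mirror T) (rev v) p x)"
    using mir.shorten_left[of "rev v"] assms by (auto simp: W_def)
  have "(\<exists>x. acc (mirror T) (rev u) p x) \<longleftrightarrow> (\<exists>x. coacc T p u x)" for u p
    using acc_mirror[of T u p] by (metis rev_rev_ident)
  then show ?thesis using that[of "rev w"] w by (simp add: W_def) (metis rev_rev_ident)
qed

lemma dm_short:
  assumes "\<forall>p. (\<exists>x. acc T w p x) \<longleftrightarrow> (\<exists>x. acc T u p x)" "\<forall>p. (\<exists>x. coacc T p w' x) \<longleftrightarrow> (\<exists>x. coacc T p v x)"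
  shows "w @ w' \<in> dm T \<longleftrightarrow> u @ v \<in> dm T"
  unfolding dm_append using assms by blast

lemma saturated:
  assumes W: "u \<in> W" "u' \<in> W" "v \<in> W" "v' \<in> W" and eq: "cl u = cl u'" "cr v = cr v'" and d: "u @ v \<in> dm T"
  shows "u' @ v' \<in> dm T"
proof -
  obtain w where w: "w \<in> W" "length w < 2 ^ nstates T * m" "cl w = cl u" "\<forall>p. (\<exists>x. acc T w p x) \<longleftrightarrow> (\<exists>x. acc T u p x)"
    by (rule shorten_left[OF W(1)])
  obtain w' where w': "w' \<in> W" "length w' < 2 ^ nstates T * m" "cl w' = cl u'" "\<forall>p. (\<exists>x. acc T w' p x) \<longleftrightarrow> (\<exists>x. acc T u' p x)"
    by (rule shorten_left[OF W(2)])
  obtain z where z: "z \<in> W" "length z < 2 ^ nstates T * m" "cr z = cr v" "\<forall>p. (\<exists>x. coacc T p z x) \<longleftrightarrow> (\<exists>x. coacc T p v x)"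
    by (rule shorten_right[OF W(3)])
  obtain z' where z': "z' \<in> W" "length z' < 2 ^ nstates T * m" "cr z' = cr v'" "\<forall>p. (\<exists>x. coacc T p z' x) \<longleftrightarrow> (\<exists>x. coacc T p v' x)"
    by (rule shorten_right[OF W(4)])
  have "w @ z \<in> dm T" using dm_short[OF w(4) z(4)] d by simp
  then have "w' @ z' \<in> dm T"
    using compatD(1)[OF short, of w w' z z'] w w' z z' eq short_of_less by simp
  then show ?thesis using dm_short[OF w'(4) z'(4)] by simp
qed

text \<open>The delay of \<open>p\<close> and \<open>p'\<close> is carried along \<open>u\<close>
  letter by letter. If a short \<open>w0\<close> has the delay of \<open>u\<close>, then
  \<open>w0 @ [a]\<close> has that of \<open>u @ [a]\<close>, and being in \<open>S\<close> it can
  be compared directly with any other short word of its class.\<close>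

lemma delay:
  assumes "u \<in> W" "acc T u p x" "acc T u p' x'" "w \<in> W" "length w < 2 ^ nstates T * m" "cl w = cl u"
    "acc T w p z" "acc T w p' z'" "coacc T p v y" "coacc T p' v' y'" "cr v = cr v'"
  shows "minor x x' z z'"
  using assms
proof (induction u arbitrary: p x p' x' w z z' v y v' y' rule: rev_induct)
  case Nil
  obtain r where r: "r \<in> W" "length r < 2 ^ nstates T * m" "cr r = cr v" "\<forall>p. (\<exists>x. coacc T p r x) \<longleftrightarrow> (\<exists>x. coacc T p v x)"
    using shorten_right[of v] coacc_wf[OF wf Nil.prems(9)] W_def by metis
  obtain r' where r': "r' \<in> W" "length r' < 2 ^ nstates T * m" "cr r' = cr v'" "\<forall>p. (\<exists>x. coacc T p r' x) \<longleftrightarrow> (\<exists>x. coacc T p v' x)"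
    using shorten_right[of v'] coacc_wf[OF wf Nil.prems(10)] W_def by metis
  obtain b b' where b: "coacc T p r b" "coacc T p' r' b'" using r r' Nil.prems by blast
  have d: "[] @ r \<in> dm T" unfolding dm_append using Nil.prems b by blast
  have "[] \<in> S" by (simp add: S_def short_def)
  with compatD(2)[OF short, of "[]" w r r'] short_of_less r r' Nil.prems d
  have "minor (fn T ([] @ r)) (fn T ([] @ r')) (fn T (w @ r)) (fn T (w @ r'))" by simp
  then show ?case
    using minor_cancel fn_append[OF fu Nil.prems(2) b(1)] fn_append[OF fu Nil.prems(3) b(2)]
      fn_append[OF fu Nil.prems(7) b(1)] fn_append[OF fu Nil.prems(8) b(2)] by metis
next
  case (snoc a u)
  obtain r where r: "r \<in> W" "length r < 2 ^ nstates T * m" "cr r = cr v" "\<forall>p. (\<exists>x. coacc T p r x) \<longleftrightarrow> (\<exists>x. coacc T p v x)"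
    using shorten_right[of v] coacc_wf[OF wf snoc.prems(9)] W_def by metis
  obtain r' where r': "r' \<in> W" "length r' < 2 ^ nstates T * m" "cr r' = cr v'" "\<forall>p. (\<exists>x. coacc T p r' x) \<longleftrightarrow> (\<exists>x. coacc T p v' x)"
    using shorten_right[of v'] coacc_wf[OF wf snoc.prems(10)] W_def by metis
  obtain b b' where b: "coacc T p r b" "coacc T p' r' b'" using r r' snoc.prems by blast
  have ua: "u \<in> W" "a < alph T" using snoc.prems(1) by (auto simp: W_def)
  obtain q s t where q: "acc T u q s" "nft_run T q [a] t p" "x = s @ t"
    using snoc.prems(2) unfolding acc_append by blast
  obtain q' s' t' where q': "acc T u q' s'" "nft_run T q' [a] t' p'" "x' = s' @ t'"
    using snoc.prems(3) unfolding acc_append by blast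
  obtain w0 where w0: "w0 \<in> W" "length w0 < 2 ^ nstates T * m" "cl w0 = cl u" "\<forall>p. (\<exists>x. acc T w0 p x) \<longleftrightarrow> (\<exists>x. acc T u p x)"
    by (rule shorten_left[OF ua(1)])
  obtain c c' where c: "acc T w0 q c" "acc T w0 q' c'" using w0(4) q q' by blast
  have co: "coacc T q ([a] @ r) (t @ b)" "coacc T q' ([a] @ r') (t' @ b')"
    unfolding coacc_append using q q' b by blast+
  have "cr ([a] @ r) = cr ([a] @ r')" using cr_step[OF r(1) r'(1) ua(2)] r r' snoc.prems(11) by simp
  from snoc.IH[OF ua(1) q(1) q'(1) w0(1-3) c co this] have "minor s s' c c'" .
  then have 1: "minor x x' (c @ t) (c' @ t')" unfolding q(3) q'(3) by (rule minor_append)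
  have ac: "acc T (w0 @ [a]) p (c @ t)" "acc T (w0 @ [a]) p' (c' @ t')"
    unfolding acc_append using c q q' by blast+
  \<comment> \<open>\<open>length w0\<close> is strictly below the bound, so one letter may be
    added.\<close>
  have "w0 @ [a] \<in> S" using w0 ua by (simp add: S_def short_def W_def)
  moreover have "cl (w0 @ [a]) = cl w" using cl_step[OF w0(1) ua w0(3)] snoc.prems(6) by simp
  moreover have "(w0 @ [a]) @ r \<in> dm T" unfolding dm_append using ac b by blast
  ultimately have "minor (fn T ((w0 @ [a]) @ r)) (fn T ((w0 @ [a]) @ r')) (fn T (w @ r)) (fn T (w @ r'))"
    using compatD(2)[OF short, of "w0 @ [a]" w r r'] short_of_less r r' snoc.prems(4,5,11) by simp
  then have "minor (c @ t) (c' @ t') z z'"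
    using minor_cancel fn_append[OF fu ac(1) b(1)] fn_append[OF fu ac(2) b(2)]
      fn_append[OF fu snoc.prems(7) b(1)] fn_append[OF fu snoc.prems(8) b(2)] by metis
  with 1 show ?case by (rule minor_trans)
qed

lemma one_side:
  assumes "u \<in> W" "u @ v \<in> dm T" "u @ v' \<in> dm T" "cr v = cr v'"
    "w \<in> W" "length w < 2 ^ nstates T * m" "cl w = cl u" "\<forall>p. (\<exists>x. acc T w p x) \<longleftrightarrow> (\<exists>x. acc T u p x)"
  shows "minor (fn T (u @ v)) (fn T (u @ v')) (fn T (w @ v)) (fn T (w @ v'))"
proof -
  obtain p x y p' x' y' where 1: "acc T u p x" "coacc T p v y" "acc T u p' x'" "coacc T p' v' y'"
    using assms(2,3) unfolding dm_append by blast
  obtain z z' where 2: "acc T w p z" "acc T w p' z'" using 1 assms(8) by blast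
  have "minor x x' z z'" by (rule delay[OF assms(1) 1(1,3) assms(5-7) 2 1(2,4) assms(4)])
  from minor_append[OF this, of y y'] show ?thesis
    by (simp add: fn_append[OF fu 1(1,2)] fn_append[OF fu 1(3,4)] fn_append[OF fu 2(1) 1(2)] fn_append[OF fu 2(2) 1(4)])
qed

text \<open>This is \<open>one_side\<close> for the mirrored transducer, where the roles of prefixes
  and suffixes are exchanged.\<close>

lemma other_side:
  assumes "v \<in> W" "u @ v \<in> dm T" "u' @ v \<in> dm T" "u @ w \<in> dm T" "u' @ w \<in> dm T" "cl u = cl u'"
    "w \<in> W" "length w < 2 ^ nstates T * m" "cr w = cr v" "\<forall>p. (\<exists>x. coacc T p w x) \<longleftrightarrow> (\<exists>x. coacc T p v x)"
  shows "minor (fn T (u @ v)) (fn T (u @ w)) (fn T (u' @ v)) (fn T (u' @ w))"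
proof -
  interpret mir: two_sides "mirror T" "cr \<circ> rev" "cl \<circ> rev" m "words (alph (mirror T))"
    "short (alph (mirror T)) (2 ^ nstates (mirror T) * m)"
    by (rule two_sides_mirror)
  have "(\<exists>x. acc (mirror T) (rev u) p x) \<longleftrightarrow> (\<exists>x. coacc T p u x)" for u p
    using acc_mirror[of T u p] by (metis rev_rev_ident)
  then have "minor (fn (mirror T) (rev v @ rev u)) (fn (mirror T) (rev v @ rev u'))
     (fn (mirror T) (rev w @ rev u)) (fn (mirror T) (rev w @ rev u'))"
    using assms by (intro mir.one_side) (simp_all add: W_def dm_mirror')
  then have "minor (rev (fn T (u @ v))) (rev (fn T (u' @ v))) (rev (fn T (u @ w))) (rev (fn T (u' @ w)))"
    using fn_mirror'[OF fu] assms(2-5) by simp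
  from minor_rev[OF this] show ?thesis by simp
qed

lemma compat_all: "compat T {(u, u'). u \<in> W \<and> u' \<in> W \<and> cl u = cl u'} {(v, v'). v \<in> W \<and> v' \<in> W \<and> cr v = cr v'}"
  unfolding compat_def
proof (intro ballI, clarify)
  fix u u' v v' assume W: "u \<in> W" "u' \<in> W" "v \<in> W" "v' \<in> W" and eq: "cl u = cl u'" "cr v = cr v'"
    and d: "u @ v \<in> dm T"
  obtain w where w: "w \<in> W" "length w < 2 ^ nstates T * m" "cl w = cl u" "\<forall>p. (\<exists>x. acc T w p x) \<longleftrightarrow> (\<exists>x. acc T u p x)"
    by (rule shorten_left[OF W(1)])
  obtain w' where w': "w' \<in> W" "length w' < 2 ^ nstates T * m" "cl w' = cl u'" "\<forall>p. (\<exists>x. acc T w' p x) \<longleftrightarrow> (\<exists>x. acc T u' p x)"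
    by (rule shorten_left[OF W(2)])
  obtain z where z: "z \<in> W" "length z < 2 ^ nstates T * m" "cr z = cr v" "\<forall>p. (\<exists>x. coacc T p z x) \<longleftrightarrow> (\<exists>x. coacc T p v x)"
    by (rule shorten_right[OF W(3)])
  obtain z' where z': "z' \<in> W" "length z' < 2 ^ nstates T * m" "cr z' = cr v'" "\<forall>p. (\<exists>x. coacc T p z' x) \<longleftrightarrow> (\<exists>x. coacc T p v' x)"
    by (rule shorten_right[OF W(4)])
  have all: "a @ b \<in> dm T" if "a \<in> {u, u', w, w'}" "b \<in> {v, v', z, z'}" for a b
    by (rule saturated[OF W(1) _ W(3) _ _ _ d]) (use that W w w' z z' eq in auto)
  have 1: "minor (fn T (u @ v)) (fn T (u @ v')) (fn T (w @ v)) (fn T (w @ v'))"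
    by (rule one_side[OF W(1) _ _ eq(2) w]) (simp_all add: all)
  have 2: "minor (fn T (u' @ v)) (fn T (u' @ v')) (fn T (w' @ v)) (fn T (w' @ v'))"
    by (rule one_side[OF W(2) _ _ eq(2) w']) (simp_all add: all)
  have ww: "cl w = cl w'" using w w' eq by simp
  have 3: "minor (fn T (w @ v)) (fn T (w @ z)) (fn T (w' @ v)) (fn T (w' @ z))"
    by (rule other_side[OF W(3) _ _ _ _ ww z]) (simp_all add: all)
  have 4: "minor (fn T (w @ v')) (fn T (w @ z')) (fn T (w' @ v')) (fn T (w' @ z'))"
    by (rule other_side[OF W(4) _ _ _ _ ww z']) (simp_all add: all)
  \<comment> \<open>The core case of four short words. Facts \<open>3\<close> and \<open>4\<close>
    replace the columns \<open>z\<close>, \<open>z'\<close> by \<open>v\<close>, \<open>v'\<close>,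
    and then \<open>1\<close> and \<open>2\<close> replace the rows \<open>w\<close>,
    \<open>w'\<close> by \<open>u\<close>, \<open>u'\<close>.\<close>
  have "minor (fn T (w @ z)) (fn T (w @ z')) (fn T (w' @ z)) (fn T (w' @ z'))"
    using compatD(2)[OF short, of w w' z z'] w w' z z' eq short_of_less all by simp
  with 3 have "minor (fn T (w @ v)) (fn T (w @ z')) (fn T (w' @ v)) (fn T (w' @ z'))" by (rule minor_compose)
  then have "minor (fn T (w @ v)) (fn T (w @ v')) (fn T (w' @ v)) (fn T (w' @ v'))"
    using minor_swap[OF 4] by (rule minor_compose)
  then show "u' @ v' \<in> dm T \<and> minor (fn T (u @ v)) (fn T (u @ v')) (fn T (u' @ v)) (fn T (u' @ v'))"
    using minor_trans[OF minor_trans[OF 1] minor_sym[OF 2]] all by simp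
qed

end

section \<open>Codes of monoids and transducers\<close>

lemma map_code_nat [simp]: "map code xs = (xs :: nat list)"
  by (induction xs) (simp_all add: code_nat_def)

lemma code_nat_list: "(code :: nat list \<Rightarrow> nat) = list_encode"
  by (simp add: fun_eq_iff code_list_def)

lemma enc_fmon_eq_code: "enc_fmon M = code M"
  by (simp add: enc_fmon_def code_prod_def code_nat_def code_list_def[of "snd M"] code_nat_list)

lemma list_encode_inj: "list_encode xs = list_encode ys \<Longrightarrow> xs = ys"
  by (simp add: list_encode_eq)

instantiation nft :: coded
begin
definition code_nft :: "nft \<Rightarrow> nat" where "code_nft T = enc_nft T"
instance
proof
  fix T T' :: nft assume "code T = code T'"
  then have eq: "enc_nft T = enc_nft T'" by (simp add: code_nft_def)
  have "map (\<lambda>(p, a, q, w). list_encode [p, a, q, list_encode w]) (trans T)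
    = map (\<lambda>(p, a, q, w). list_encode [p, a, q, list_encode w]) (trans T')"
    "map (\<lambda>(q, w). prod_encode (q, list_encode w)) (iout T) = map (\<lambda>(q, w). prod_encode (q, list_encode w)) (iout T')"
    "map (\<lambda>(q, w). prod_encode (q, list_encode w)) (tout T) = map (\<lambda>(q, w). prod_encode (q, list_encode w)) (tout T')"
    and ks: "alph T = alph T'" "nstates T = nstates T'"
    using eq unfolding enc_nft_def by (simp_all add: list_encode_eq del: list_encode.simps)
  moreover have "inj (\<lambda>(p :: nat, a, q, w). list_encode [p, a, q, list_encode w])"
    "inj (\<lambda>(q :: nat, w). prod_encode (q, list_encode w))"
    by (auto simp: inj_on_def dest: list_encode_inj simp del: list_encode.simps) 
  ultimately have "trans T = trans T'" "iout T = iout T'" "tout T = tout T'"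
    by (blast dest: map_injective)+
  with ks show "T = T'" by (cases T; cases T') simp
qed
end

lemma computable_list_decode [computable_intros]: "computable f \<Longrightarrow> computable (\<lambda>x. list_decode (f x))"
  by (rule computable_lift1[OF rec1_id]) (auto simp: code_list_def code_nat_def)

lemma computable_prod_decode [computable_intros]: "computable f \<Longrightarrow> computable (\<lambda>x. prod_decode (f x))"
  by (rule computable_lift1[OF rec1_id]) (auto simp: code_prod_def code_nat_def)

text \<open>The code of a transducer is by definition the code of this list, so the identity program
  unpacks it.\<close>

lemma computable_enc_list: "computable (\<lambda>T. [alph T, nstates T,
      list_encode (map (\<lambda>(p,a,q,w). list_encode [p, a, q, list_encode w]) (trans T)),
      list_encode (map (\<lambda>(q,w). prod_encode (q, list_encode w)) (iout T)),
      list_encode (map (\<lambda>(q,w). prod_encode (q, list_encode w)) (tout T))])"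
  by (rule computableI[OF rec1_id]) (simp add: code_nft_def enc_nft_def code_list_def code_nat_def)

lemma computable_alph: "computable alph"
  using computable_hd[OF computable_enc_list] by simp

lemma computable_nstates: "computable nstates"
  using computable_hd[OF computable_tl[OF computable_enc_list]] by simp

lemma computable_trans: "computable trans"
proof -
  have "computable (\<lambda>T. list_encode (map (\<lambda>(p,a,q,w). list_encode [p, a, q, list_encode w]) (trans T)))"
    using computable_hd[OF computable_tl[OF computable_tl[OF computable_enc_list]]] by simp
  then have "computable (\<lambda>T. map (\<lambda>l. (hd l, hd (tl l), hd (tl (tl l)), list_decode (hd (tl (tl (tl l))))))
     (map list_decode (list_decode (list_encode (map (\<lambda>(p,a,q,w). list_encode [p, a, q, list_encode w]) (trans T))))))"
    by (intro computable_intros)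
  then show ?thesis by (simp add: comp_def case_prod_beta del: list_encode.simps)
qed

lemma computable_iout: "computable iout" and computable_tout: "computable tout"
proof -
  have c: "computable (\<lambda>T. list_encode (map (\<lambda>(q,w). prod_encode (q, list_encode w)) (iout T)))"
    "computable (\<lambda>T. list_encode (map (\<lambda>(q,w). prod_encode (q, list_encode w)) (tout T)))"
    using computable_hd[OF computable_tl[OF computable_tl[OF computable_tl[OF computable_enc_list]]]]
      computable_hd[OF computable_tl[OF computable_tl[OF computable_tl[OF computable_tl[OF computable_enc_list]]]]]
    by simp_all
  have "computable (\<lambda>T. map (\<lambda>z. (fst (prod_decode z), list_decode (snd (prod_decode z))))
     (list_decode (list_encode (map (\<lambda>(q,w). prod_encode (q, list_encode w)) (iout T)))))"
    by (intro computable_intros c)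
  moreover have "computable (\<lambda>T. map (\<lambda>z. (fst (prod_decode z), list_decode (snd (prod_decode z))))
     (list_decode (list_encode (map (\<lambda>(q,w). prod_encode (q, list_encode w)) (tout T)))))"
    by (intro computable_intros c)
  ultimately show "computable iout" "computable tout" by (simp_all add: comp_def case_prod_beta)
qed

lemmas [computable_intros] = computable_alph[THEN computable_app] computable_nstates[THEN computable_app]
  computable_trans[THEN computable_app] computable_iout[THEN computable_app] computable_tout[THEN computable_app]

section \<open>The decision procedure\<close>

text \<open>A transducer consuming a letter per transition has finitely many runs on a word, so all
  reached states with their outputs can be listed.\<close>

definition accl :: "nft \<Rightarrow> nat list \<Rightarrow> (nat \<times> nat list) list" where
  "accl T u = foldl (\<lambda>c a. concat (map (\<lambda>z. map (\<lambda>t. (fst (snd (snd t)), snd z @ snd (snd (snd t))))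
     (filter (\<lambda>t. fst t = fst z \<and> fst (snd t) = a) (trans T))) c)) (iout T) u"

definition outl :: "nft \<Rightarrow> nat list \<Rightarrow> nat list list" where
  "outl T u = concat (map (\<lambda>z. map (\<lambda>t. snd z @ snd t) (filter (\<lambda>t. fst t = fst z) (tout T))) (accl T u))"

lemma set_accl: "set (accl T u) = {(p, x). acc T u p x}"
proof (induction u rule: rev_induct)
  case Nil
  then show ?case by (auto simp: accl_def acc_def)
next
  case (snoc a u)
  have "accl T (u @ [a]) = concat (map (\<lambda>z. map (\<lambda>t. (fst (snd (snd t)), snd z @ snd (snd (snd t))))
     (filter (\<lambda>t. fst t = fst z \<and> fst (snd t) = a) (trans T))) (accl T u))"
    by (simp add: accl_def)
  then have "set (accl T (u @ [a])) = {(q, x @ w) | p q x w. acc T u p x \<and> (p, a, q, w) \<in> set (trans T)}"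
    by (auto simp: snoc image_iff) force+
  also have "\<dots> = {(p, x). acc T (u @ [a]) p x}"
    unfolding acc_append nft_run_Cons_iff by auto
  finally show ?case .
qed

lemma set_outl: "set (outl T u) = {z. nft_rel T u z}"
proof -
  have "set (outl T u) = {x @ y | p x y. acc T u p x \<and> (p, y) \<in> set (tout T)}"
    by (auto simp: outl_def set_accl image_iff) force+
  also have "\<dots> = {z. nft_rel T (u @ []) z}"
    unfolding nft_rel_append coacc_def by auto
  finally show ?thesis by simp
qed

lemma outl_dm: "outl T u \<noteq> [] \<longleftrightarrow> u \<in> dm T"
proof -
  have "outl T u \<noteq> [] \<longleftrightarrow> set (outl T u) \<noteq> {}" by simp
  then show ?thesis unfolding set_outl dm_def by simp
qed

lemma outl_fn: "functional_nft T \<Longrightarrow> u \<in> dm T \<Longrightarrow> set (outl T u) = {fn T u}"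
  unfolding set_outl using nft_rel_iff_fn by auto

definition minorb :: "nat list \<Rightarrow> nat list \<Rightarrow> nat list \<Rightarrow> nat list \<Rightarrow> bool" where
  "minorb A B C D \<longleftrightarrow> (\<exists>i\<in>set [0..<Suc (length A)]. \<exists>j\<in>set [0..<Suc (length C)].
     take i A = take i B \<and> take j C = take j D \<and> drop i A = drop j C \<and> drop i B = drop j D)"

lemma minorb: "minorb A B C D \<longleftrightarrow> minor A B C D"
proof
  assume "minorb A B C D"
  then obtain i j where "take i A = take i B" "take j C = take j D" "drop i A = drop j C" "drop i B = drop j D"
    unfolding minorb_def by blast
  then show "minor A B C D"
    using minorI[of "take i A" "drop i A" "drop i B" "take j C"] by (metis append_take_drop_id)
next
  assume "minor A B C D"
  then obtain x y s t where "A = x @ s" "B = x @ t" "C = y @ s" "D = y @ t" unfolding minor_def by blast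
  then show "minorb A B C D" unfolding minorb_def
    by (intro bexI[of _ "length x"] bexI[of _ "length y"]) auto
qed

definition wordl :: "nat \<Rightarrow> nat \<Rightarrow> nat list list" where
  "wordl k B = concat (map (\<lambda>i. List.n_lists i [0..<k]) [0..<Suc B])"

lemma set_wordl: "set (wordl k B) = short k B"
  by (auto simp: wordl_def short_def words_def set_n_lists subset_iff less_Suc_eq_le)

text \<open>
  The value of \<^term>\<open>[] ! n\<close> is unspecified and may depend on \<^term>\<open>n\<close> in a non-computable way,
  whereas \<^term>\<open>hd []\<close> is a fixed constant.
\<close>

definition mulb :: "fmon \<Rightarrow> nat \<Rightarrow> nat \<Rightarrow> nat" where
  "mulb M a b = hd (drop b (hd (drop a (snd M))))"

definition shapeb :: "fmon \<Rightarrow> bool" where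
  "shapeb M \<longleftrightarrow> length (snd M) = fst M \<and> (\<forall>r\<in>set (snd M). length r = fst M \<and> (\<forall>x\<in>set r. x < fst M))"

definition unitb :: "fmon \<Rightarrow> nat \<Rightarrow> bool" where
  "unitb M e \<longleftrightarrow> (\<forall>a\<in>set [0..<fst M]. mulb M e a = a \<and> mulb M a e = a)"

definition wfb :: "fmon \<Rightarrow> bool" where
  "wfb M \<longleftrightarrow> shapeb M \<and> (\<forall>a\<in>set [0..<fst M]. \<forall>b\<in>set [0..<fst M]. \<forall>c\<in>set [0..<fst M].
     mulb M (mulb M a b) c = mulb M a (mulb M b c)) \<and> (\<exists>e\<in>set [0..<fst M]. unitb M e)"

lemma shapeb_mul:
  assumes "shapeb M" "a < fst M" "b < fst M"
  shows "mulb M a b = fmul M a b" "fmul M a b < fst M"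
proof -
  have a: "a < length (snd M)" using assms by (simp add: shapeb_def)
  then have "snd M ! a \<in> set (snd M)" by simp
  then have "length (snd M ! a) = fst M" "\<forall>x\<in>set (snd M ! a). x < fst M" using assms(1) by (auto simp: shapeb_def)
  then show "mulb M a b = fmul M a b" "fmul M a b < fst M"
    using a assms(3) by (simp_all add: mulb_def fmul_def hd_drop_conv_nth)
qed

lemma unitb: "shapeb M \<Longrightarrow> e < fst M \<Longrightarrow> unitb M e \<longleftrightarrow> is_unit M e"
  by (auto simp: unitb_def is_unit_def fsize_def shapeb_mul)

lemma wfb: "wfb M \<longleftrightarrow> wf_fmon M"
proof -
  have "wf_fmon M \<Longrightarrow> shapeb M" by (simp add: wf_fmon_def shapeb_def fsize_def)
  moreover have "wfb M \<longleftrightarrow> wf_fmon M" if s: "shapeb M"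
  proof -
    have "(\<exists>e\<in>set [0..<fst M]. unitb M e) \<longleftrightarrow> (\<exists>e. is_unit M e)"
      using unitb[OF s] by (auto simp: is_unit_def fsize_def)
    moreover have "mulb M (mulb M a b) c = mulb M a (mulb M b c) \<longleftrightarrow> fmul M (fmul M a b) c = fmul M a (fmul M b c)"
      if "a < fst M" "b < fst M" "c < fst M" for a b c
      using that shapeb_mul[OF s] by simp
    ultimately show ?thesis using s unfolding wfb_def wf_fmon_def fsize_def by (auto simp: shapeb_def)
  qed
  ultimately show ?thesis using wfb_def by blast
qed

text \<open>The algorithm for membership in the variety may diverge on tables that are not monoids.\<close>

definition norm_fmon :: "fmon \<Rightarrow> fmon" where
  "norm_fmon M = (if wfb M then M else trivial_fmon)"

definition evb :: "fmon \<Rightarrow> nat list \<Rightarrow> nat \<Rightarrow> nat list \<Rightarrow> nat" where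
  "evb M h e u = foldl (\<lambda>c a. mulb M c (hd (drop a h))) e u"

text \<open>\<open>outl\<close> may repeat an output. For a functional transducer all entries agree,
  so quantifying over the entries tests the single value.\<close>

definition compatb :: "nft \<Rightarrow> fmon \<Rightarrow> nat list \<Rightarrow> nat \<Rightarrow> nat list list \<Rightarrow> bool" where
  "compatb T M h e S \<longleftrightarrow> (\<forall>u\<in>set S. \<forall>u'\<in>set S. \<forall>v\<in>set S. \<forall>v'\<in>set S.
     evb M h e u = evb M h e u' \<and> evb M h e v = evb M h e v' \<and> outl T (u @ v) \<noteq> [] \<longrightarrow>
     outl T (u' @ v') \<noteq> [] \<and> (\<forall>A\<in>set (outl T (u @ v)). \<forall>B\<in>set (outl T (u @ v')).
     \<forall>C\<in>set (outl T (u' @ v)). \<forall>D\<in>set (outl T (u' @ v')). minorb A B C D))"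

lemma compatb:
  fixes M h e
  assumes fu: "functional_nft T"
  defines "K \<equiv> \<lambda>S. {(u, u'). u \<in> set S \<and> u' \<in> set S \<and> evb M h e u = evb M h e u'}"
  shows "compatb T M h e S \<longleftrightarrow> compat T (K S) (K S)"
proof -
  let ?P = "\<lambda>u u' v v'. u' @ v' \<in> dm T \<and> minor (fn T (u @ v)) (fn T (u @ v')) (fn T (u' @ v)) (fn T (u' @ v'))"
  let ?Q = "\<lambda>u u' v v'. outl T (u' @ v') \<noteq> [] \<and> (\<forall>A\<in>set (outl T (u @ v)). \<forall>B\<in>set (outl T (u @ v')).
     \<forall>C\<in>set (outl T (u' @ v)). \<forall>D\<in>set (outl T (u' @ v')). minorb A B C D)"
  have eq: "?P u u' v v' \<longleftrightarrow> ?Q u u' v v'" if "u @ v \<in> dm T" "u @ v' \<in> dm T" "u' @ v \<in> dm T" for u u' v v'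
    using that outl_fn[OF fu] by (auto simp: outl_dm minorb)
  show ?thesis
  proof
    assume c: "compatb T M h e S"
    show "compat T (K S) (K S)"
      unfolding compat_def
    proof clarify
      fix u u' v v' assume K: "(u, u') \<in> K S" "(v, v') \<in> K S" and d: "u @ v \<in> dm T"
      have Q: "?Q a a' b b'" if "(a, a') \<in> K S" "(b, b') \<in> K S" "a @ b \<in> dm T" for a a' b b'
        using c that unfolding compatb_def K_def outl_dm[symmetric] by blast
      have "(u, u) \<in> K S" "(v, v) \<in> K S" using K by (auto simp: K_def)
      then have "u @ v' \<in> dm T" "u' @ v \<in> dm T" using Q K d outl_dm by blast+
      then show "?P u u' v v'" using eq[OF d] Q[OF K d] by blast
    qed
  next
    assume c: "compat T (K S) (K S)"
    show "compatb T M h e S"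
      unfolding compatb_def
    proof (intro ballI impI)
      fix u u' v v' assume S: "u \<in> set S" "u' \<in> set S" "v \<in> set S" "v' \<in> set S"
        and "evb M h e u = evb M h e u' \<and> evb M h e v = evb M h e v' \<and> outl T (u @ v) \<noteq> []"
      then have K: "(u, u') \<in> K S" "(v, v') \<in> K S" "(u, u) \<in> K S" "(v, v) \<in> K S" and d: "u @ v \<in> dm T"
        by (simp_all add: K_def outl_dm)
      have "u @ v' \<in> dm T" "u' @ v \<in> dm T" using compatD(1)[OF c] K d by blast+
      then show "?Q u u' v v'" using eq[OF d] compatD[OF c K(1,2) d] by blast
    qed
  qed
qed

text \<open>A computable upper estimate of the bound from \<open>bounded_congruence\<close>: the
  list length replaces the cardinality in \<open>lbound\<close>.\<close>

definition size_bound :: "nft \<Rightarrow> nat" where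
  "size_bound T = (let n = nstates T; b = 2 ^ n * length (wordl (alph T) (n * n)) ^ (n * n) in b ^ (2 * b))"

lemma size_bound: "lbound T ^ (2 * lbound T) \<le> size_bound T"
proof -
  define b where "b = 2 ^ nstates T * length (wordl (alph T) (nstates T * nstates T)) ^ (nstates T * nstates T)"
  have "card (short (alph T) (nstates T * nstates T)) \<le> length (wordl (alph T) (nstates T * nstates T))"
    using card_length set_wordl by metis
  then have le: "lbound T \<le> b" unfolding lbound_def b_def by (intro mult_le_mono2 power_mono) auto
  have "lbound T ^ (2 * lbound T) \<le> b ^ (2 * b)"
  proof (cases "b = 0")
    case False
    have "lbound T ^ (2 * lbound T) \<le> b ^ (2 * lbound T)" using le by (intro power_mono) auto
    also have "\<dots> \<le> b ^ (2 * b)" using le False by (intro power_increasing) auto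
    finally show ?thesis .
  qed (use le in simp)
  then show ?thesis by (simp add: size_bound_def b_def Let_def)
qed

definition decide :: "(fmon \<Rightarrow> bool) \<Rightarrow> nft \<Rightarrow> bool" where
  "decide inV T \<longleftrightarrow> (\<exists>m\<in>set [0..<Suc (size_bound T)]. \<exists>tab\<in>set (List.n_lists m (List.n_lists m [0..<m])).
     wfb (m, tab) \<and> inV (m, tab) \<and> (\<exists>e\<in>set [0..<m]. unitb (m, tab) e \<and>
       (\<exists>h\<in>set (List.n_lists (alph T) [0..<m]).
          compatb T (m, tab) h e (wordl (alph T) (2 ^ nstates T * m)))))"

lemma decide_sound:
  assumes V: "monoid_variety V" and wf: "wf_nft T" and fu: "functional_nft T"
    and inV: "\<And>M. wf_fmon M \<Longrightarrow> inV M \<longleftrightarrow> M \<in> V" and d: "decide inV T"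
  shows "unamb_V_definable V T"
proof -
  let ?k = "alph T"
  let ?W = "words ?k"
  obtain m tab e h where M: "wfb (m, tab)" "inV (m, tab)" and e: "e < m" "unitb (m, tab) e"
    and "h \<in> set (List.n_lists ?k [0..<m])"
    and c: "compatb T (m, tab) h e (wordl ?k (2 ^ nstates T * m))"
    using d unfolding decide_def by (metis atLeastLessThan_iff set_upt)
  then have h: "length h = ?k" "set h \<subseteq> {..<m}" by (auto simp: set_n_lists)
  define M where "M = (m, tab)"
  have wfM: "wf_fmon M" using M(1) wfb M_def by simp
  have size: "fsize M = m" "fst M = m" by (simp_all add: M_def fsize_def)
  have MV: "M \<in> V" using inV[OF wfM] M(2) M_def by simp
  have sh: "shapeb M" using M(1) by (simp add: wfb_def M_def)
  have un: "is_unit M e" using unitb[OF sh] e by (simp add: M_def size)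
  have assoc: "fmul M (fmul M a b) c = fmul M a (fmul M b c)" if "a < m" "b < m" "c < m" for a b c
    using wfM that unfolding wf_fmon_def size by blast
  define \<phi> where "\<phi> = evb M h e"
  have letter: "hd (drop a h) < m" if "a < ?k" for a
    using that h by (auto simp: hd_drop_conv_nth subset_iff)
  have phi_Nil: "\<phi> [] = e" by (simp add: \<phi>_def evb_def)
  have phi_less: "\<phi> u < m" and phi_snoc': "a < ?k \<Longrightarrow> \<phi> (u @ [a]) = fmul M (\<phi> u) (hd (drop a h))"
    if "u \<in> ?W" for u a
  proof -
    have *: "\<phi> (u @ [a]) = mulb M (\<phi> u) (hd (drop a h))" for u a by (simp add: \<phi>_def evb_def)
    show less: "\<phi> u < m" using that
    proof (induction u rule: rev_induct)
      case (snoc a u)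
      then show ?case using * shapeb_mul[OF sh] letter by (simp add: size)
    qed (use phi_Nil e in simp)
    then show "a < ?k \<Longrightarrow> \<phi> (u @ [a]) = fmul M (\<phi> u) (hd (drop a h))"
      using * shapeb_mul[OF sh] letter by (simp add: size)
  qed
  have hom: "\<phi> (u @ v) = fmul M (\<phi> u) (\<phi> v)" if u: "u \<in> ?W" and "v \<in> ?W" for u v
    using that(2)
  proof (induction v rule: rev_induct)
    case Nil
    then show ?case using un phi_less[OF u] phi_Nil by (simp add: is_unit_def size)
  next
    case (snoc a v)
    then show ?case using phi_snoc'[of "u @ v" a] phi_snoc'[of v a] phi_less u letter assoc by simp
  qed
  have hom0: "hom_on ?W M \<phi>"
    unfolding hom_on_def using phi_less hom phi_Nil funit_eq[OF un] by (auto simp: size)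
  define E where "E = {(u, u'). u \<in> ?W \<and> u' \<in> ?W \<and> \<phi> u = \<phi> u'}"
  have "two_sides T \<phi> \<phi> m"
  proof
    fix u u' a assume uu: "u \<in> ?W" "u' \<in> ?W" "a < ?k" "\<phi> u = \<phi> u'"
    then show "\<phi> (u @ [a]) = \<phi> (u' @ [a])" using hom[of u "[a]"] hom[of u' "[a]"] by simp
    show "\<phi> (a # u) = \<phi> (a # u')" using hom[of "[a]" u] hom[of "[a]" u'] uu by simp
  next
    let ?S = "short ?k (2 ^ nstates T * m)"
    show "compat T {(u, u'). u \<in> ?S \<and> u' \<in> ?S \<and> \<phi> u = \<phi> u'} {(u, u'). u \<in> ?S \<and> u' \<in> ?S \<and> \<phi> u = \<phi> u'}"
      using c unfolding compatb[OF fu] set_wordl by (simp add: \<phi>_def M_def)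
  qed (use wf fu phi_less in auto)
  then have comp: "compat T E E" unfolding E_def by (rule two_sides.compat_all)
  have eqE: "equiv ?W E"
    by (rule equivI) (auto simp: E_def refl_on_def sym_def Relation.trans_def)
  then have cong: "congruence_on ?W E"
    unfolding congruence_on_def by (auto simp: E_def hom)
  have "finite (?W // E)"
    by (rule card_quotient_le(1)[OF eqE, of \<phi> "{..<m}"]) (auto simp: E_def phi_less)
  obtain N \<psi> where N: "wf_fmon N" "fsize N = card (?W // E)" "\<psi> ` ?W = {..<fsize N}" "hom_on ?W N \<psi>"
    "\<forall>u\<in>?W. \<forall>v\<in>?W. \<psi> u = \<psi> v \<longleftrightarrow> (u, v) \<in> E"
    by (rule quotient_fmon[OF cong \<open>finite (?W // E)\<close>])
  \<comment> \<open>The morphism may miss elements of \<open>M\<close>; the quotient by its kernel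
    embeds into \<open>M\<close>.\<close>
  have "N \<in> V"
    by (rule variety_sub[OF V MV hom0 N(1,3,4)]) (simp add: N(5) E_def)
  moreover have "recognized T N \<psi>"
  proof
    have "{(u, u'). u \<in> ?W \<and> u' \<in> ?W \<and> \<psi> u = \<psi> u'} = E" using N(5) by (auto simp: E_def)
    then show "compat T {(u, u'). u \<in> ?W \<and> u' \<in> ?W \<and> \<psi> u = \<psi> u'} {(u, u'). u \<in> ?W \<and> u' \<in> ?W \<and> \<psi> u = \<psi> u'}"
      using comp by simp
  qed (use wf fu N in \<open>auto simp: hom_on_def\<close>)
  ultimately show ?thesis by (rule recognized.definable[rotated])
qed

lemma decide_complete:
  assumes V: "monoid_variety V" and wf: "wf_nft T" and fu: "functional_nft T"
    and inV: "\<And>M. wf_fmon M \<Longrightarrow> inV M \<longleftrightarrow> M \<in> V" and d: "unamb_V_definable V T"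
  shows "decide inV T"
proof -
  let ?k = "alph T"
  let ?W = "words ?k"
  obtain T' M0 \<phi>0 where T': "wf_nft T'" "alph T' = ?k" "nft_rel T' = nft_rel T" and M0: "M0 \<in> V"
    and \<phi>0: "\<phi>0 ` ?W = {..<fsize M0}" "\<And>u v. u \<in> ?W \<Longrightarrow> v \<in> ?W \<Longrightarrow> \<phi>0 u = \<phi>0 v \<longleftrightarrow> tm T' u = tm T' v"
      "\<And>u v. u \<in> ?W \<Longrightarrow> v \<in> ?W \<Longrightarrow> \<phi>0 (u @ v) = fmul M0 (\<phi>0 u) (\<phi>0 v)"
    using d unfolding unamb_V_definable_def V_nft_def by metis
  have fu': "functional_nft T'" using fu T'(3) by (simp add: functional_nft_def)
  define E0 where "E0 = {(u, u'). u \<in> ?W \<and> u' \<in> ?W \<and> \<phi>0 u = \<phi>0 u'}"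
  \<comment> \<open>Compatibility depends only on the defined function, so what the transition
    monoid of \<open>T'\<close> yields can be transferred to \<open>T\<close>.\<close>
  have "compat T' E0 E0"
    by (rule compat_mono[OF compat_tm[OF T'(1) fu']]) (auto simp: E0_def \<phi>0(2))
  then have c0: "compat T E0 E0" using compat_cong[OF T'(3)] by simp
  have eqE: "equiv ?W E0"
    by (rule equivI) (auto simp: E0_def refl_on_def sym_def Relation.trans_def)
  then have cong: "congruence_on ?W E0"
    unfolding congruence_on_def by (auto simp: E0_def \<phi>0(3))
  have "finite (?W // E0)"
    by (rule card_quotient_le(1)[OF eqE, of \<phi>0 "{..<fsize M0}"]) (auto simp: E0_def \<phi>0(1))
  from bounded_congruence[OF wf fu cong this c0] obtain E where E: "congruence_on ?W E" "E0 \<subseteq> E" "compat T E E"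
    "finite (?W // E)" "card (?W // E) \<le> lbound T ^ (2 * lbound T)" .
  obtain M \<phi> where M: "wf_fmon M" "fsize M = card (?W // E)" "\<phi> ` ?W = {..<fsize M}"
    "hom_on ?W M \<phi>" and ker': "\<forall>u\<in>?W. \<forall>v\<in>?W. \<phi> u = \<phi> v \<longleftrightarrow> (u, v) \<in> E"
    by (rule quotient_fmon[OF E(1,4)])
  then have ker: "\<phi> u = \<phi> v \<longleftrightarrow> (u, v) \<in> E" if "u \<in> ?W" "v \<in> ?W" for u v using that by blast
  \<comment> \<open>\<open>E\<close> is coarser than the kernel of the morphism onto
    \<open>M0\<close>, so \<open>M\<close> is a quotient of \<open>M0\<close>, now of bounded
    size.\<close>
  have MV: "M \<in> V"
    by (rule variety_quotient[OF V M0 \<phi>0(1) onto_hom(1)[OF \<phi>0(1,3)] M(1,3,4)])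
      (use E(2) ker in \<open>auto simp: E0_def\<close>)
  obtain m tab where Mm: "M = (m, tab)" by (cases M)
  have size: "fsize M = m" "fst M = m" by (simp_all add: Mm fsize_def)
  have "wfb M" using M(1) wfb by simp
  then have sh: "shapeb M" by (simp add: wfb_def)
  have "m \<le> size_bound T" using M(2) E(5) size_bound[of T] size by simp
  then have 1: "m \<in> set [0..<Suc (size_bound T)]" by (simp only: set_upt atLeastLessThan_iff less_Suc_eq_le le0 simp_thms)
  have 2: "tab \<in> set (List.n_lists m (List.n_lists m [0..<m]))"
    using sh by (auto simp: shapeb_def Mm set_n_lists)
  have 3: "wfb (m, tab)" "inV (m, tab)" using wfb M(1) inV[OF M(1)] MV Mm by auto
  have e: "\<phi> [] < m" "is_unit M (\<phi> [])"
    using onto_hom(2)[OF M(3)] M(4) by (auto simp: hom_on_def is_unit_def size)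
  have 4: "\<phi> [] \<in> set [0..<m]" "unitb (m, tab) (\<phi> [])"
    using e unitb[OF sh, of "\<phi> []"] by (simp_all add: Mm)
  define h where "h = map (\<lambda>a. \<phi> [a]) [0..<?k]"
  have hom: "\<phi> (u @ v) = fmul M (\<phi> u) (\<phi> v)" if "u \<in> ?W" "v \<in> ?W" for u v
    using M(4) that by (auto simp: hom_on_def)
  have less: "\<phi> u < m" if "u \<in> ?W" for u using M(4) that by (auto simp: hom_on_def size)
  have 5: "h \<in> set (List.n_lists ?k [0..<m])"
    using less by (auto simp: set_n_lists h_def)
  have ev: "evb M h (\<phi> []) u = \<phi> u" if "u \<in> ?W" for u
    using that
  proof (induction u rule: rev_induct)
    case (snoc a u)
    then have "evb M h (\<phi> []) (u @ [a]) = mulb M (\<phi> u) (\<phi> [a])"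
      by (simp add: evb_def h_def hd_drop_conv_nth)
    also have "\<dots> = \<phi> (u @ [a])"
      using shapeb_mul[OF sh] hom less snoc.prems by (simp add: size)
    finally show ?case .
  qed (simp add: evb_def)
  have "compatb T M h (\<phi> []) (wordl ?k B)" for B
    unfolding compatb[OF fu] set_wordl
    by (rule compat_mono[OF E(3)]) (auto simp: short_def ev ker)
  then have 6: "compatb T (m, tab) h (\<phi> []) (wordl ?k (2 ^ nstates T * m))" by (simp add: Mm)
  show ?thesis unfolding decide_def using 1 2 3 4 5 6 by blast
qed

section \<open>Computability of the decision procedure\<close>

lemma computable_accl [computable_intros]:
  assumes "computable f" "computable g" shows "computable (\<lambda>x. accl (f x) (g x))"
  unfolding accl_def
  by (intro computable_foldl computable_intros assms computable_app[OF assms(1)])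

lemma computable_outl [computable_intros]:
  assumes "computable f" "computable g" shows "computable (\<lambda>x. outl (f x) (g x))"
  unfolding outl_def by (intro computable_intros assms computable_app[OF assms(1)])

lemma computable_minorb [computable_intros]:
  assumes "computable f" "computable g" "computable h" "computable k"
  shows "computable (\<lambda>x. minorb (f x) (g x) (h x) (k x))"
  unfolding minorb_def
  by (intro computable_intros assms assms[THEN computable_app])

lemma computable_wordl [computable_intros]:
  assumes "computable f" "computable g" shows "computable (\<lambda>x. wordl (f x) (g x))"
  unfolding wordl_def by (intro computable_intros assms computable_app[OF assms(1)])

lemma computable_mulb [computable_intros]:
  assumes "computable f" "computable g" "computable h" shows "computable (\<lambda>x. mulb (f x) (g x) (h x))"
  unfolding mulb_def by (intro computable_intros assms)

lemma computable_unitb [computable_intros]: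
  assumes "computable f" "computable g" shows "computable (\<lambda>x. unitb (f x) (g x))"
  unfolding unitb_def by (intro computable_intros assms assms[THEN computable_app])

lemma computable_wfb [computable_intros]: "computable wfb"
  unfolding wfb_def[abs_def] shapeb_def by (intro computable_intros)

lemma computable_evb [computable_intros]:
  assumes "computable f" "computable g" "computable h" "computable k"
  shows "computable (\<lambda>x. evb (f x) (g x) (h x) (k x))"
  unfolding evb_def
  by (intro computable_foldl computable_intros assms assms[THEN computable_app])

lemma computable_compatb [computable_intros]:
  assumes "computable f" "computable g" "computable h" "computable k" "computable l"
  shows "computable (\<lambda>x. compatb (f x) (g x) (h x) (k x) (l x))"
  unfolding compatb_def
  by (intro computable_intros assms assms[THEN computable_app])

lemma computable_size_bound: "computable size_bound"
  unfolding size_bound_def[abs_def] Let_def by (intro computable_intros)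

lemma computable_decide:
  assumes "computable inV" shows "computable (decide inV)"
  unfolding decide_def[abs_def]
  by (intro computable_intros computable_app[OF computable_size_bound] computable_app[OF computable_wfb]
      computable_app[OF assms])

lemma computable_member:
  assumes V: "monoid_variety V" and p: "decides_on p enc_fmon wf_fmon (\<lambda>M. M \<in> V)"
  shows "computable (\<lambda>M. norm_fmon M \<in> V)"
proof -
  have "\<forall>M\<in>V. wf_fmon M" using V unfolding monoid_variety_def by (rule conjunct1)
  moreover have "trivial_fmon \<in> V" using V unfolding monoid_variety_def by (elim conjE)
  ultimately have "wf_fmon trivial_fmon" by (rule bspec)
  then have "wf_fmon (norm_fmon M)" for M by (simp add: norm_fmon_def wfb)
  then have p': "rec_eval p [code (norm_fmon M)] (code (norm_fmon M \<in> V))" for M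
    using p unfolding decides_on_def enc_fmon_eq_code code_bool_def by blast
  have "computable norm_fmon"
    unfolding norm_fmon_def[abs_def] by (intro computable_If computable_wfb computable_intros)
  then obtain q where "\<And>M. rec_eval q [code M] (code (norm_fmon M))" unfolding computable_def by blast
  then have "rec_eval (Cnf p [q]) [code M] (code (norm_fmon M \<in> V))" for M
    using p' by (rule rec_eval_comp1)
  then show ?thesis unfolding computable_def by blast
qed

theorem mainTheorem17:
  fixes V :: "fmon set"
  assumes "monoid_variety V"
    and "\<exists>p. decides_on p enc_fmon wf_fmon (\<lambda>M. M \<in> V)"
  shows "\<exists>p. decides_on p enc_nft (\<lambda>T. wf_nft T \<and> functional_nft T) (unamb_V_definable V)"
proof -
  define inV where "inV M \<longleftrightarrow> norm_fmon M \<in> V" for M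
  have "computable inV" unfolding inV_def[abs_def] using computable_member assms by blast
  then have "computable (decide inV)" by (rule computable_decide)
  then obtain p where p: "\<And>T. rec_eval p [code T] (code (decide inV T))" unfolding computable_def by blast
  \<comment> \<open>\<open>decide\<close> tests \<open>wfb\<close> alongside \<open>inV\<close>, and
    on tables that pass this test \<open>norm_fmon\<close> changes nothing.\<close>
  have inV: "inV M \<longleftrightarrow> M \<in> V" if "wf_fmon M" for M using that by (simp add: inV_def norm_fmon_def wfb)
  have "decide inV T \<longleftrightarrow> unamb_V_definable V T" if "wf_nft T" "functional_nft T" for T
    using decide_sound[OF assms(1) that inV] decide_complete[OF assms(1) that inV] by blast
  then have "decides_on p enc_nft (\<lambda>T. wf_nft T \<and> functional_nft T) (unamb_V_definable V)"
    unfolding decides_on_def using p by (metis code_bool_def code_nft_def)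
  then show ?thesis by blast
qed

end
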